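(* Let $\mathcal{K} = \langle K_1,\dots,K_r\rangle$ be an ordered collection of simplicial complexes $K_i\subsetneq 2^{[n]}$. (1) If $\mathcal{K}$ is collective $r$-unavoidable, then the deleted join $\mathcal{K}^{\ast r}_\Delta = K_1\ast_\Delta K_2\ast_\Delta\cdots\ast_\Delta K_r$ is $(n-r-1)$-connected. (2) If $\mathcal{K}$ is an Alexander $r$-tuple, then the Bier complex $Bier(\mathcal{K}) = K_1\ast_\Delta K_2\ast_\Delta\cdots\ast_\Delta K_r$ is a pure simplicial complex of dimension $n-r$, homotopy equivalent to a wedge of $(n-r)$-dimensional spheres.
   Context: $[n]=\{1,\dots,n\}$. A simplicial complex on a finite vertex set $V$ is a subset $K\subseteq 2^V$ with $\emptyset\in K$ that is closed under taking subsets (some $\{v\}$, $v\in V$, may fail to be in $K$). All complexes are assumed proper: $K_i\subsetneq 2^{[n]}$. Collective $r$-unavoidable: an ordered $r$-tuple $\langle K_1,\dots,K_r\rangle$ of complexes on $[n]$ such that for each ordered collection $(A_1,\dots,A_r)$ of pairwise disjoint subsets of $[n]$ there exists $i$ with $A_i\in K_i$. Alexander $r$-tuple: an $r$-tuple $\langle K_1,\dots,K_r\rangle$ of complexes on $[n]$ which is collective $r$-unavoidable and such that for all sets $A_1\in K_1,\dots,A_r\in K_r$ the set $[n]\setminus\bigcup_{i=1}^r A_i$ has at least $r-1$ elements. Deleted join: $K_1\ast_\Delta\cdots\ast_\Delta K_r$ is the simplicial complex, a subcomplex of the $r$-fold join $(2^{[n]})^{\ast r}$ (with vertices in $[n]\times[r]$),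 whose simplices are $A_1\uplus\cdots\uplus A_r$ with $A_i\in K_i$ for each $i$ and the $A_i$ pairwise disjoint as subsets of $[n]$. The Bier complex $Bier(\mathcal{K})$ of an Alexander $r$-tuple $\mathcal{K}$ is its deleted join. *)

theory Defs
  imports "HOL-Analysis.Analysis" "HOL-Library.Disjoint_Sets"
begin

section \<open>Abstract simplicial complexes\<close>

text \<open>Complexes are sets of simplices and contain the empty simplex, which has dimension \<open>-1\<close>;
  hence dimensions are integers.  Singletons of \<open>V\<close> need not be simplices.\<close>

definition simplicial_complex_on :: "'v set \<Rightarrow> 'v set set \<Rightarrow> bool" where
  "simplicial_complex_on V K \<longleftrightarrow>
     finite V \<and> K \<subseteq> Pow V \<and> {} \<in> K \<and> (\<forall>A\<in>K. \<forall>B. B \<subseteq> A \<longrightarrow> B \<in> K)"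

definition simplex_dim :: "'v set \<Rightarrow> int" where
  "simplex_dim A = int (card A) - 1"

definition complex_dim :: "'v set set \<Rightarrow> int" where
  "complex_dim K = Max (simplex_dim ` K)"

definition facets :: "'v set set \<Rightarrow> 'v set set" where
  "facets K = {A \<in> K. \<forall>B\<in>K. A \<subseteq> B \<longrightarrow> A = B}"

definition pure_complex :: "'v set set \<Rightarrow> bool" where
  "pure_complex K \<longleftrightarrow> (\<forall>A\<in>facets K. simplex_dim A = complex_dim K)"

text \<open>Barycentric coordinates with support in \<open>K\<close>.  The empty simplex contributes no point, since
  an empty sum is not \<open>1\<close>.  For a finite complex the product topology gives the usual polyhedron.\<close>

definition geometric_realization :: "'v set set \<Rightarrow> ('v \<Rightarrow> real) topology" where
  "geometric_realization K = subtopology (powertop_real UNIV)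
     {x. (\<forall>v. 0 \<le> x v) \<and> {v. x v \<noteq> 0} \<in> K \<and> (\<Sum>v\<in>{v. x v \<noteq> 0}. x v) = 1}"

section \<open>Unavoidable tuples, Alexander tuples, deleted joins\<close>

text \<open>The tuple \<open>\<langle>K\<^sub>1,\<dots>,K\<^sub>r\<rangle>\<close> is a function \<open>K\<close> of which only the values on \<open>{1..r}\<close> matter.\<close>

definition collective_unavoidable :: "nat \<Rightarrow> nat \<Rightarrow> (nat \<Rightarrow> nat set set) \<Rightarrow> bool" where
  "collective_unavoidable n r K \<longleftrightarrow>
     (\<forall>A. (\<forall>i\<in>{1..r}. A i \<subseteq> {1..n}) \<and> disjoint_family_on A {1..r} \<longrightarrow>
        (\<exists>i\<in>{1..r}. A i \<in> K i))"

definition Alexander_tuple :: "nat \<Rightarrow> nat \<Rightarrow> (nat \<Rightarrow> nat set set) \<Rightarrow> bool" where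
  "Alexander_tuple n r K \<longleftrightarrow>
     collective_unavoidable n r K \<and>
     (\<forall>A. (\<forall>i\<in>{1..r}. A i \<in> K i) \<longrightarrow> card ({1..n} - (\<Union>i\<in>{1..r}. A i)) \<ge> r - 1)"

definition deleted_join :: "nat \<Rightarrow> (nat \<Rightarrow> 'v set set) \<Rightarrow> ('v \<times> nat) set set" where
  "deleted_join r K =
     {(\<Union>i\<in>{1..r}. A i \<times> {i}) |A. (\<forall>i\<in>{1..r}. A i \<in> K i) \<and> disjoint_family_on A {1..r}}"

abbreviation Bier :: "nat \<Rightarrow> (nat \<Rightarrow> 'v set set) \<Rightarrow> ('v \<times> nat) set set" where
  "Bier \<equiv> deleted_join"

section \<open>Higher connectivity\<close>

text \<open>\<open>k\<close>-connected for an integer \<open>k\<close>: no condition if \<open>k < -1\<close>, nonempty if \<open>k = -1\<close>, and for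
  \<open>k \<ge> 0\<close> nonempty with every map from a sphere of dimension at most \<open>k\<close> null-homotopic (equivalently,
  path-connected with trivial homotopy groups up to degree \<open>k\<close>).\<close>

definition k_connected_space :: "int \<Rightarrow> 'a topology \<Rightarrow> bool" where
  "k_connected_space k X \<longleftrightarrow>
     (k \<ge> -1 \<longrightarrow> topspace X \<noteq> {}) \<and>
     (\<forall>i::nat. int i \<le> k \<longrightarrow>
        (\<forall>f. continuous_map (nsphere i) X f \<longrightarrow>
           (\<exists>a\<in>topspace X. homotopic_with (\<lambda>_. True) (nsphere i) X f (\<lambda>_. a))))"

section \<open>Wedges of spheres\<close>

text \<open>The wedge of pointed spaces \<open>(X j, p j)\<close>, \<open>j \<in> J\<close>.  All base points become \<open>None\<close>, any other
  point \<open>x\<close> of \<open>X j\<close> becomes \<open>Some (j, x)\<close>, and a set is open iff its preimage in each \<open>X j\<close> is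
  open, i.e. the topology is the quotient topology.  The empty wedge is a point.\<close>

definition wedge_incl :: "('j \<Rightarrow> 'a) \<Rightarrow> 'j \<Rightarrow> 'a \<Rightarrow> ('j \<times> 'a) option" where
  "wedge_incl p j x = (if x = p j then None else Some (j, x))"

definition wedge_set :: "'j set \<Rightarrow> ('j \<Rightarrow> 'a topology) \<Rightarrow> ('j \<Rightarrow> 'a) \<Rightarrow> ('j \<times> 'a) option set" where
  "wedge_set J X p = insert None (\<Union>j\<in>J. wedge_incl p j ` topspace (X j))"

definition wedge_topology ::
  "'j set \<Rightarrow> ('j \<Rightarrow> 'a topology) \<Rightarrow> ('j \<Rightarrow> 'a) \<Rightarrow> ('j \<times> 'a) option topology" where
  "wedge_topology J X p = topology (\<lambda>U. U \<subseteq> wedge_set J X p \<and>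
     (\<forall>j\<in>J. openin (X j) {x \<in> topspace (X j). wedge_incl p j x \<in> U}))"

lemma openin_wedge_topology:
  "openin (wedge_topology J X p) U \<longleftrightarrow> U \<subseteq> wedge_set J X p \<and>
     (\<forall>j\<in>J. openin (X j) {x \<in> topspace (X j). wedge_incl p j x \<in> U})"
proof -
  have "istopology (\<lambda>U. U \<subseteq> wedge_set J X p \<and>
     (\<forall>j\<in>J. openin (X j) {x \<in> topspace (X j). wedge_incl p j x \<in> U}))"
    unfolding istopology_def
  proof (intro conjI allI impI ballI)
    fix S T j
    assume S: "S \<subseteq> wedge_set J X p \<and>
        (\<forall>j\<in>J. openin (X j) {x \<in> topspace (X j). wedge_incl p j x \<in> S})"
      and T: "T \<subseteq> wedge_set J X p \<and>
        (\<forall>j\<in>J. openin (X j) {x \<in> topspace (X j). wedge_incl p j x \<in> T})"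
    show "S \<inter> T \<subseteq> wedge_set J X p" using S by blast
    assume "j \<in> J"
    then have "openin (X j) ({x \<in> topspace (X j). wedge_incl p j x \<in> S} \<inter>
        {x \<in> topspace (X j). wedge_incl p j x \<in> T})"
      using S T by (intro openin_Int) auto
    moreover have "{x \<in> topspace (X j). wedge_incl p j x \<in> S} \<inter>
        {x \<in> topspace (X j). wedge_incl p j x \<in> T} =
        {x \<in> topspace (X j). wedge_incl p j x \<in> S \<inter> T}" by blast
    ultimately show "openin (X j) {x \<in> topspace (X j). wedge_incl p j x \<in> S \<inter> T}" by simp
  next
    fix \<U> j
    assume U: "\<forall>S\<in>\<U>. S \<subseteq> wedge_set J X p \<and>
        (\<forall>j\<in>J. openin (X j) {x \<in> topspace (X j). wedge_incl p j x \<in> S})"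
    show "\<Union>\<U> \<subseteq> wedge_set J X p" using U by blast
    assume "j \<in> J"
    then have "openin (X j) (\<Union>S\<in>\<U>. {x \<in> topspace (X j). wedge_incl p j x \<in> S})"
      using U by (intro openin_Union) auto
    moreover have "(\<Union>S\<in>\<U>. {x \<in> topspace (X j). wedge_incl p j x \<in> S}) =
        {x \<in> topspace (X j). wedge_incl p j x \<in> \<Union>\<U>}" by blast
    ultimately show "openin (X j) {x \<in> topspace (X j). wedge_incl p j x \<in> \<Union>\<U>}" by simp
  qed
  then show ?thesis by (simp add: wedge_topology_def)
qed

lemma topspace_wedge_topology [simp]: "topspace (wedge_topology J X p) = wedge_set J X p"
proof -
  have "{x \<in> topspace (X j). wedge_incl p j x \<in> wedge_set J X p} = topspace (X j)" if "j \<in> J" for j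
    using that by (auto simp: wedge_set_def)
  then have "openin (wedge_topology J X p) (wedge_set J X p)"
    by (simp add: openin_wedge_topology)
  then have "wedge_set J X p \<subseteq> topspace (wedge_topology J X p)"
    by (rule openin_subset)
  moreover have "topspace (wedge_topology J X p) \<subseteq> wedge_set J X p"
    using openin_topspace[of "wedge_topology J X p"] unfolding openin_wedge_topology by (rule conjunct1)
  ultimately show ?thesis by (rule subset_antisym[rotated])
qed

definition sphere_base :: "nat \<Rightarrow> real" where
  "sphere_base i = (if i = 0 then 1 else 0)"

lemma sphere_base_in_nsphere: "sphere_base \<in> topspace (nsphere d)"
proof -
  have "(\<Sum>i\<le>d. (sphere_base i)\<^sup>2) = (\<Sum>i\<le>d. if i = 0 then 1 else 0)"
    by (rule sum.cong) (auto simp: sphere_base_def)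
  also have "\<dots> = 1" by simp
  finally show ?thesis
    by (auto simp: nsphere_def topspace_Euclidean_space sphere_base_def)
qed

text \<open>The wedge of \<open>m\<close> spheres of dimension \<open>d\<close>.  The sphere of dimension \<open>-1\<close> is the empty space,
  which has no base point; it is its own wedge.\<close>

definition sphere_wedge :: "int \<Rightarrow> nat \<Rightarrow> (nat \<times> (nat \<Rightarrow> real)) option topology" where
  "sphere_wedge d m =
     (if d < 0 then trivial_topology
      else wedge_topology {..<m} (\<lambda>_. nsphere (nat d)) (\<lambda>_. sphere_base))"

end

theory Submission
  imports Defs
begin

text \<open>
  A simplex of the deleted join is a partial labelling of \<open>{1..n}\<close> by \<open>{1..r}\<close>.  Scan the points
  upwards, starting with label \<open>1\<close>: at the first point that is unlabelled or carries the current
  label \<open>j\<close>, toggle that label if the result is still a simplex; otherwise move on to label \<open>j + 1\<close>.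
  This is an acyclic matching.  If no toggle ever succeeds and all \<open>r\<close> pivots exist, adding the
  \<open>j\<close>-th pivot to the \<open>j\<close>-th part gives disjoint sets \<open>A\<^sub>j \<notin> K\<^sub>j\<close>, contradicting unavoidability; hence
  unmatched simplices leave at most \<open>r - 1\<close> points unlabelled and have dimension at least \<open>n - r\<close>.
  So the deleted join arises from a vertex by elementary expansions, which are homotopy
  equivalences, and by attaching cells of dimension at least \<open>n - r\<close>, which do not affect maps from
  spheres of dimension below \<open>n - r\<close>: a Lipschitz approximation of such a map misses a point of the
  new cell, by counting, and is then pushed off radially.  For Alexander tuples the attached cells
  are simplices of top dimension, so the rest of the complex is collapsible; contracting it to a point
  leaves a wedge of spheres.
\<close>

section \<open>Discrete Morse matchings\<close>

text \<open>If no toggle succeeds, unavoidability rules out that all \<open>r\<close> pivots lie in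
  1..\<open>n\<close>, so some pivot \<open>j\<close> runs past \<open>n\<close>. The scan never
  skips an unlabelled point, so all of these are among the \<open>j - 1\<close> pivots before it;
  this is where \<open>r - 1\<close> comes from. Acyclicity is the delicate point: along a gradient
  path a pivot is toggled in and an older vertex is deleted. Deletion only makes more points
  eligible, so the first pivot that changes moves down, and the lists of pivots decrease
  lexicographically. The empty simplex is treated like any other; if it is matched, its partner is
  the starting vertex. Hence all bounds concern cardinalities, one more than dimensions. A merely
  continuous map from a low-dimensional sphere may fill a simplex of any dimension, so approximation
  by maps that cannot is essential. For Alexander tuples no simplex has more than
  \<open>n - r + 1\<close> elements, which is also the lower bound for unmatched ones; so no
  expansion uses an unmatched simplex as a proper face, and all of them can be attached
  last.\<close>

definition face_closed :: "'v set set \<Rightarrow> bool" where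
  "face_closed L \<longleftrightarrow> (\<forall>A\<in>L. finite A \<and> (\<forall>B. B \<subseteq> A \<longrightarrow> B \<in> L))"

lemma face_closedD:
  assumes "face_closed L" "A \<in> L"
  shows face_closed_finite: "finite A" and face_closed_subset: "B \<subseteq> A \<Longrightarrow> B \<in> L"
  using assms by (auto simp: face_closed_def)

text \<open>The start is the void complex, without even the empty simplex; an expansion with
  \<open>\<sigma> = {}\<close> turns it into a vertex. \<open>c\<close> bounds cardinalities, so
  attached simplices have dimension at least \<open>c - 1\<close>.\<close>

inductive morse_built :: "nat \<Rightarrow> 'v set set \<Rightarrow> bool" for c where
  empty: "morse_built c {}"
| expand: "morse_built c L \<Longrightarrow> finite \<sigma> \<Longrightarrow> v \<notin> \<sigma> \<Longrightarrow> \<sigma> \<notin> L \<Longrightarrow>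
    (\<And>B. B \<subset> insert v \<sigma> \<Longrightarrow> B \<noteq> \<sigma> \<Longrightarrow> B \<in> L) \<Longrightarrow> morse_built c (insert \<sigma> (insert (insert v \<sigma>) L))"
| attach: "morse_built c L \<Longrightarrow> finite \<sigma> \<Longrightarrow> c \<le> card \<sigma> \<Longrightarrow> \<sigma> \<notin> L \<Longrightarrow>
    (\<And>B. B \<subset> \<sigma> \<Longrightarrow> B \<in> L) \<Longrightarrow> morse_built c (insert \<sigma> L)"

text \<open>Without attached cells: the complex collapses to the void complex, that is, to a vertex.\<close>

inductive collapsible :: "'v set set \<Rightarrow> bool" where
  empty: "collapsible {}"
| expand: "collapsible L \<Longrightarrow> finite \<sigma> \<Longrightarrow> v \<notin> \<sigma> \<Longrightarrow> \<sigma> \<notin> L \<Longrightarrow>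
    (\<And>B. B \<subset> insert v \<sigma> \<Longrightarrow> B \<noteq> \<sigma> \<Longrightarrow> B \<in> L) \<Longrightarrow> collapsible (insert \<sigma> (insert (insert v \<sigma>) L))"

lemma face_closed_expand:
  assumes "face_closed L" "finite \<sigma>" "\<And>B. B \<subset> insert v \<sigma> \<Longrightarrow> B \<noteq> \<sigma> \<Longrightarrow> B \<in> L" "v \<notin> \<sigma>"
  shows "face_closed (insert \<sigma> (insert (insert v \<sigma>) L))"
  unfolding face_closed_def
proof (intro ballI conjI allI impI)
  fix A B assume A: "A \<in> insert \<sigma> (insert (insert v \<sigma>) L)" and BA: "B \<subseteq> A"
  show "B \<in> insert \<sigma> (insert (insert v \<sigma>) L)"
  proof (cases "A \<in> L")
    case True then show ?thesis using assms(1) BA by (auto simp: face_closed_def)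
  next
    case False
    then have "B \<subseteq> insert v \<sigma>" using A BA by auto
    then show ?thesis using assms(3)[of B] by blast
  qed
qed (use assms in \<open>auto simp: face_closed_def\<close>)

lemma face_closed_attach:
  assumes "face_closed L" "finite \<sigma>" "\<And>B. B \<subset> \<sigma> \<Longrightarrow> B \<in> L"
  shows "face_closed (insert \<sigma> L)"
  using assms unfolding face_closed_def by (metis insert_iff psubsetI)

lemma morse_built_face_closed: "morse_built c L \<Longrightarrow> face_closed L"
proof (induction rule: morse_built.induct)
  case empty then show ?case by (simp add: face_closed_def)
next
  case expand then show ?case by (intro face_closed_expand) auto
next
  case attach then show ?case by (intro face_closed_attach) auto
qed

lemma collapsible_face_closed: "collapsible L \<Longrightarrow> face_closed L"
proof (induction rule: collapsible.induct)
  case empty then show ?case by (simp add: face_closed_def)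
next
  case expand then show ?case by (intro face_closed_expand) auto
qed

text \<open>Attached simplices have exactly \<open>c\<close> elements, while the faces that an
  expansion requires are proper and have fewer; so the expansions remain valid when all attached
  simplices are left out.\<close>

lemma morse_built_split:
  assumes "morse_built c L" "\<forall>A\<in>L. card A \<le> c"
  shows "\<exists>S\<subseteq>L. (\<forall>A\<in>S. card A = c) \<and> collapsible (L - S)"
  using assms
proof (induction rule: morse_built.induct)
  case empty then show ?case by (auto intro: collapsible.empty)
next
  case (expand L \<sigma> v)
  then obtain S where S: "S \<subseteq> L" "\<forall>A\<in>S. card A = c" "collapsible (L - S)" by auto
  have cv: "card (insert v \<sigma>) \<le> c" using expand.prems by simp
  have v: "insert v \<sigma> \<notin> L"
    using expand.hyps(4) morse_built_face_closed[OF expand.hyps(1)] face_closed_subset by blast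
  have "collapsible (insert \<sigma> (insert (insert v \<sigma>) (L - S)))"
  proof (rule collapsible.expand[OF S(3)])
    fix B assume B: "B \<subset> insert v \<sigma>" "B \<noteq> \<sigma>"
    then have "B \<in> L" using expand.hyps(5) by blast
    moreover have "card B < c" using psubset_card_mono[OF _ B(1)] cv expand.hyps by auto
    ultimately show "B \<in> L - S" using S(2) by auto
  qed (use expand.hyps in auto)
  moreover have "insert \<sigma> (insert (insert v \<sigma>) (L - S)) = insert \<sigma> (insert (insert v \<sigma>) L) - S"
    using S(1) expand.hyps(4) v by auto
  ultimately show ?case using S by (intro exI[of _ S]) auto
next
  case (attach L \<sigma>)
  then obtain S where S: "S \<subseteq> L" "\<forall>A\<in>S. card A = c" "collapsible (L - S)" by auto
  have "card \<sigma> = c" using attach by (simp add: le_antisym)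
  moreover have "insert \<sigma> L - insert \<sigma> S = L - S" using attach.hyps by auto
  ultimately show ?case using S by (intro exI[of _ "insert \<sigma> S"]) auto
qed

text \<open>The vertex \<open>p A\<close> is toggled to reach the partner of \<open>A\<close>; \<open>h\<close> decreases along gradient
  paths.\<close>

lemma acyclic_matching_morse_built:
  fixes L :: "'v set set" and p :: "'v set \<Rightarrow> 'v" and R :: "('b \<times> 'b) set"
  assumes fin: "finite L" and fc: "face_closed L"
    and up: "\<And>A. A \<in> L \<Longrightarrow> matched A \<Longrightarrow> p A \<notin> A \<Longrightarrow>
               insert (p A) A \<in> L \<and> matched (insert (p A) A) \<and> p (insert (p A) A) = p A"
    and down: "\<And>A. A \<in> L \<Longrightarrow> matched A \<Longrightarrow> p A \<in> A \<Longrightarrow>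
               matched (A - {p A}) \<and> p (A - {p A}) = p A"
    and crit: "\<And>A. A \<in> L \<Longrightarrow> \<not> matched A \<Longrightarrow> c \<le> card A"
    and wf: "wf R"
    and acyclic: "\<And>A x. A \<in> L \<Longrightarrow> matched A \<Longrightarrow> p A \<notin> A \<Longrightarrow> x \<in> A \<Longrightarrow>
        matched (insert (p A) A - {x}) \<Longrightarrow> p (insert (p A) A - {x}) \<notin> insert (p A) A - {x} \<Longrightarrow>
        (h (insert (p A) A - {x}), h A) \<in> R"
  shows "morse_built c L"
proof -
  \<comment> \<open>Candidates for an initial segment of the construction: built subcomplexes that
    contain with a matched simplex also its partner. A maximal one is shown to be all of
    \<open>L\<close>.\<close>
  define good where "good M \<longleftrightarrow> M \<subseteq> L \<and> morse_built c M \<and>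
    (\<forall>A\<in>M. matched A \<longrightarrow> insert (p A) A \<in> M \<and> A - {p A} \<in> M)" for M
  have "good {}" by (simp add: good_def morse_built.empty)
  moreover have "finite {M. good M}"
    by (rule finite_subset[of _ "Pow L"]) (use fin in \<open>auto simp: good_def\<close>)
  ultimately obtain M where gM: "good M" and maxM: "\<And>N. good N \<Longrightarrow> M \<subseteq> N \<Longrightarrow> N = M"
    using finite_has_maximal[of "{M. good M}"] by auto
  note M = gM[unfolded good_def]
  have "M = L"
  proof (rule ccontr)
    assume "M \<noteq> L"
    then have ne: "L - M \<noteq> {}" using M by auto
    \<comment> \<open>A matched pair counts with the size of its upper member, so a remaining
      simplex with least \<open>top\<close> shows at which size the next pair or unmatched simplex
      can be added.\<close>
    define top where "top A = (if matched A then card (insert (p A) A) else card A)" for A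
    obtain A0 where A0: "A0 \<in> L - M" "\<And>A. A \<in> L - M \<Longrightarrow> top A0 \<le> top A"
      using arg_min_if_finite[of "L - M" top] fin ne
      by (metis finite_Diff not_le)
    define t where "t = top A0"
    \<comment> \<open>Below size \<open>t\<close>, only lower members of pairs whose upper member
      has exactly \<open>t\<close> elements can remain.\<close>
    have small: "matched B \<and> p B \<notin> B \<and> Suc (card B) = t" if "B \<in> L - M" "card B < t" for B
    proof -
      have finB: "finite B" using that fc face_closed_finite by blast
      have "t \<le> top B" using A0 that by (simp add: t_def)
      then have "matched B" "card B < card (insert (p B) B)" "t \<le> card (insert (p B) B)"
        using that by (auto simp: top_def split: if_splits)
      then show ?thesis using finB that(2) by (auto simp: card_insert_if split: if_splits)
    qed
    define ups where "ups = {A \<in> L - M. matched A \<and> p A \<notin> A \<and> Suc (card A) = t}"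
    show False
    proof (cases "ups = {}")
      case False
      \<comment> \<open>For a lower member with \<open>R\<close>-minimal \<open>h\<close>, all other
        proper faces of its upper member are present: a missing one would be the lower member of
        another pair and have smaller \<open>h\<close>.\<close>
      then obtain A where A: "A \<in> ups" and minA: "\<And>B. B \<in> ups \<Longrightarrow> (h B, h A) \<notin> R"
        using wfE_min[OF wf, of _ "h ` ups"] by (metis (no_types, lifting) ex_in_conv image_iff)
      let ?T = "insert (p A) A"
      have AL: "A \<in> L" "matched A" "p A \<notin> A" "Suc (card A) = t" "A \<notin> M" using A by (auto simp: ups_def)
      have finA: "finite A" using AL fc face_closed_finite by blast
      have T: "?T \<in> L" "matched ?T" "p ?T = p A" using up[OF AL(1-3)] by auto
      have "morse_built c (insert A (insert ?T M))"
      proof (rule morse_built.expand)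
        fix B assume B: "B \<subset> ?T" "B \<noteq> A"
        show "B \<in> M"
        proof (rule ccontr)
          assume nB: "B \<notin> M"
          have cB: "card B < t" using psubset_card_mono[OF _ B(1)] finA AL by simp
          have BL: "B \<in> L - M" using nB B T(1) fc face_closed_subset by blast
          have b: "matched B" "p B \<notin> B" "Suc (card B) = t" using small[OF BL cB] by auto
          then have ups: "B \<in> ups" using BL by (simp add: ups_def)
          obtain x where x: "x \<in> ?T" "x \<notin> B" using B by auto
          have "card (?T - {x}) = card A" using x finA AL by simp
          then have Bx: "B = ?T - {x}"
            using x B b AL finA by (intro card_subset_eq) auto
          have "x \<in> A" using x Bx B AL by auto
          then have "(h B, h A) \<in> R" using acyclic[OF AL(1-3), of x] b Bx by simp
          then show False using minA[OF ups] by simp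
        qed
      qed (use AL M finA in auto)
      then have "good (insert A (insert ?T M))"
        using M AL T by (auto simp: good_def insert_absorb)
      from maxM[OF this] AL show False by auto
    next
      case True
      have A0L: "A0 \<in> L" "A0 \<notin> M" using A0 by auto
      have finA: "finite A0" using A0L fc face_closed_finite by blast
      \<comment> \<open>If \<open>A0\<close> were matched, the lower member of its pair would lie in
        \<open>ups\<close>, which is empty.\<close>
      have nm: "\<not> matched A0"
      proof
        assume m: "matched A0"
        show False
        proof (cases "p A0 \<in> A0")
          case False
          then show False using m True A0L finA by (auto simp: ups_def t_def top_def)
        next
          case p: True
          let ?B = "A0 - {p A0}"
          have B: "matched ?B" "p ?B = p A0" using down[OF A0L(1) m p] by auto
          have "?B \<notin> M"
            using M B A0L p by (metis insert_Diff)
          moreover have "?B \<in> L" using A0L fc face_closed_subset by blast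
          moreover have "Suc (card ?B) = t"
            using p m finA unfolding t_def top_def by (metis card_Suc_Diff1 insert_absorb)
          ultimately show False using B True by (auto simp: ups_def)
        qed
      qed
      then have t: "t = card A0" by (simp add: t_def top_def)
      have "morse_built c (insert A0 M)"
      proof (rule morse_built.attach)
        fix B assume B: "B \<subset> A0"
        show "B \<in> M"
        proof (rule ccontr)
          assume nB: "B \<notin> M"
          have "card B < t" using psubset_card_mono[OF finA B] t by simp
          moreover have "B \<in> L - M" using nB B A0L fc face_closed_subset by blast
          ultimately have "B \<in> ups" using small by (simp add: ups_def)
          then show False using True by auto
        qed
      qed (use A0L M finA crit nm in auto)
      then have "good (insert A0 M)" using M A0L nm by (auto simp: good_def)
      from maxM[OF this] A0L show False by auto
    qed
  qed
  then show ?thesis using M by simp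
qed

section \<open>The matching on a deleted join\<close>

definition part :: "('a \<times> nat) set \<Rightarrow> nat \<Rightarrow> 'a set" where
  "part S i = {x. (x, i) \<in> S}"

text \<open>Read as a relation from points to labels, a simplex has pairwise disjoint parts
  precisely when no point carries two labels; \<open>single_valued\<close> then replaces the family
  of sets in the definition.\<close>

lemma deleted_join_iff:
  "S \<in> deleted_join r K \<longleftrightarrow>
     S \<subseteq> UNIV \<times> {1..r} \<and> (\<forall>i\<in>{1..r}. part S i \<in> K i) \<and> single_valued S"
proof
  assume "S \<in> deleted_join r K"
  then obtain A where A: "S = (\<Union>i\<in>{1..r}. A i \<times> {i})" "\<forall>i\<in>{1..r}. A i \<in> K i"
    "disjoint_family_on A {1..r}" by (auto simp: deleted_join_def)
  have "part S i = A i" if "i \<in> {1..r}" for i using that A(1) by (auto simp: part_def)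
  moreover have "single_valued S"
    using A(3) by (fastforce simp: A(1) single_valued_def disjoint_family_on_def)
  ultimately show "S \<subseteq> UNIV \<times> {1..r} \<and> (\<forall>i\<in>{1..r}. part S i \<in> K i) \<and> single_valued S"
    using A by auto
next
  assume S: "S \<subseteq> UNIV \<times> {1..r} \<and> (\<forall>i\<in>{1..r}. part S i \<in> K i) \<and> single_valued S"
  then have "S = (\<Union>i\<in>{1..r}. part S i \<times> {i})" by (fastforce simp: part_def)
  moreover have "disjoint_family_on (part S) {1..r}"
    using S by (auto simp: disjoint_family_on_def part_def single_valued_def)
  ultimately show "S \<in> deleted_join r K" using S unfolding deleted_join_def by blast
qed

section \<open>The deleted join as a finite simplicial complex\<close>

locale complexes =
  fixes n r :: nat and K :: "nat \<Rightarrow> nat set set"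
  assumes complex: "i \<in> {1..r} \<Longrightarrow> simplicial_complex_on {1..n} (K i)"
begin

lemma K_subset: "i \<in> {1..r} \<Longrightarrow> A \<in> K i \<Longrightarrow> A \<subseteq> {1..n}"
  and K_down: "i \<in> {1..r} \<Longrightarrow> A \<in> K i \<Longrightarrow> B \<subseteq> A \<Longrightarrow> B \<in> K i"
  and K_empty: "i \<in> {1..r} \<Longrightarrow> {} \<in> K i"
  using complex[of i] by (auto simp: simplicial_complex_on_def)

lemma deleted_join_subset: "S \<in> deleted_join r K \<Longrightarrow> S \<subseteq> {1..n} \<times> {1..r}"
proof
  fix z assume S: "S \<in> deleted_join r K" and z: "z \<in> S"
  obtain x i where xi: "z = (x, i)" by force
  have i: "i \<in> {1..r}" using S z xi by (auto simp: deleted_join_iff)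
  have "part S i \<subseteq> {1..n}" using S i K_subset[OF i] by (simp add: deleted_join_iff)
  then show "z \<in> {1..n} \<times> {1..r}" using i xi z by (auto simp: part_def)
qed

lemma deleted_join_down: "S \<in> deleted_join r K \<Longrightarrow> T \<subseteq> S \<Longrightarrow> T \<in> deleted_join r K"
proof -
  assume S: "S \<in> deleted_join r K" and T: "T \<subseteq> S"
  have "part T i \<in> K i" if i: "i \<in> {1..r}" for i
    by (rule K_down[OF i, of "part S i"]) (use S T i in \<open>auto simp: deleted_join_iff part_def\<close>)
  then show ?thesis
    using S T single_valued_subset[OF T] by (auto simp: deleted_join_iff)
qed

lemma empty_in_deleted_join: "{} \<in> deleted_join r K"
  by (simp add: deleted_join_iff part_def K_empty)

lemma simplicial_complex_deleted_join:
  "simplicial_complex_on ({1..n} \<times> {1..r}) (deleted_join r K)"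
  unfolding simplicial_complex_on_def
  using deleted_join_subset deleted_join_down empty_in_deleted_join by auto

lemma finite_deleted_join: "finite (deleted_join r K)"
  by (rule finite_subset[of _ "Pow ({1..n} \<times> {1..r})"]) (use deleted_join_subset in auto)

lemma face_closed_deleted_join: "face_closed (deleted_join r K)"
  unfolding face_closed_def
proof (intro ballI conjI allI impI)
  fix S assume S: "S \<in> deleted_join r K"
  show "finite S" by (rule finite_subset[OF deleted_join_subset[OF S]]) simp
  show "T \<in> deleted_join r K" if "T \<subseteq> S" for T using deleted_join_down[OF S that] .
qed

text \<open>\<open>pt S 1 < pt S 2 < \<dots>\<close> are the pivots: \<open>pt S j\<close> is the first point above \<open>pt S (j - 1)\<close> that
  lies in no part of \<open>S\<close> or in the \<open>j\<close>-th one.  Points above \<open>n\<close> count as lying in no part, so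
  pivots exist for all \<open>j\<close>.\<close>

definition free :: "(nat \<times> nat) set \<Rightarrow> nat \<Rightarrow> bool" where
  "free S y \<longleftrightarrow> (\<forall>i. (y, i) \<notin> S)"

primrec pt :: "(nat \<times> nat) set \<Rightarrow> nat \<Rightarrow> nat" where
  "pt S 0 = 0"
| "pt S (Suc s) = (LEAST y. pt S s < y \<and> (free S y \<or> (y, Suc s) \<in> S))"

declare pt.simps(2) [simp del]

text \<open>One condition covers both directions of the toggle: if the pivot already lies in the
  \<open>j\<close>-th part, inserting it changes nothing, and a simplex of the join satisfies the
  condition automatically. A pivot above \<open>n\<close> is never addable, since the simplices of
  \<open>K j\<close> are subsets of \<open>{1..n}\<close>.\<close>

definition addable :: "(nat \<times> nat) set \<Rightarrow> nat \<Rightarrow> bool" where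
  "addable S j \<longleftrightarrow> j \<in> {1..r} \<and> insert (pt S j) (part S j) \<in> K j"

definition matched :: "(nat \<times> nat) set \<Rightarrow> bool" where
  "matched S \<longleftrightarrow> (\<exists>j. addable S j)"

definition stage :: "(nat \<times> nat) set \<Rightarrow> nat" where
  "stage S = (LEAST j. addable S j)"

definition pivot :: "(nat \<times> nat) set \<Rightarrow> nat \<times> nat" where
  "pivot S = (pt S (stage S), stage S)"

text \<open>Padding to the fixed length \<open>r\<close> makes \<open>lexn\<close> applicable.
  Pivots are positive, so a 0 in place of a pivot, which records an earlier stage, makes the list
  smaller.\<close>

definition rank_list :: "(nat \<times> nat) set \<Rightarrow> nat list" where
  "rank_list S = map (\<lambda>s. if s \<le> stage S then pt S s else 0) [1..<Suc r]"

lemma pt_exists: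
  assumes "S \<subseteq> {1..n} \<times> {1..r}"
  shows "\<exists>y. pt S s < y \<and> (free S y \<or> (y, Suc s) \<in> S)"
  by (rule exI[of _ "Suc (max n (pt S s))"]) (use assms in \<open>auto simp: free_def\<close>)

lemma pt_Suc:
  assumes "S \<subseteq> {1..n} \<times> {1..r}"
  shows "pt S s < pt S (Suc s)" "free S (pt S (Suc s)) \<or> (pt S (Suc s), Suc s) \<in> S"
  using LeastI_ex[OF pt_exists[OF assms, of s]] by (auto simp: pt.simps(2))

lemma pt_Suc_le: "pt S s < y \<Longrightarrow> free S y \<or> (y, Suc s) \<in> S \<Longrightarrow> pt S (Suc s) \<le> y"
  by (auto simp: pt.simps(2) intro: Least_le)

lemma pt_mono: "S \<subseteq> {1..n} \<times> {1..r} \<Longrightarrow> s < s' \<Longrightarrow> pt S s < pt S s'"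
  using lift_Suc_mono_less[of "pt S" s s'] pt_Suc(1)[of S] by blast

lemma stage_addable: "matched S \<Longrightarrow> addable S (stage S)"
  unfolding matched_def stage_def by (rule LeastI_ex)

lemma stage_not_addable: "s < stage S \<Longrightarrow> \<not> addable S s"
  unfolding stage_def by (rule not_less_Least)

lemma stage_eqI: "addable S j \<Longrightarrow> (\<And>s. s < j \<Longrightarrow> \<not> addable S s) \<Longrightarrow> stage S = j"
  unfolding stage_def by (rule Least_equality) (auto simp: not_le[symmetric])

text \<open>Removing elements only enlarges the sets over which the minima are taken.\<close>

lemma pt_antimono:
  assumes "T \<subseteq> {1..n} \<times> {1..r}" "single_valued T" "S \<subseteq> T" "pt S s = pt T s"
  shows "pt S (Suc s) \<le> pt T (Suc s)"
proof (rule pt_Suc_le)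
  show "pt S s < pt T (Suc s)" using pt_Suc[OF assms(1), of s] assms(4) by simp
  show "free S (pt T (Suc s)) \<or> (pt T (Suc s), Suc s) \<in> S"
    using pt_Suc[OF assms(1), of s] assms(2,3) by (auto simp: free_def single_valued_def)
qed

text \<open>The pivots before the \<open>j\<close>-th lie below the inserted point and keep their
  status; the \<open>j\<close>-th stays eligible because it now carries label \<open>j\<close>. No
  pivot moves down, since an insertion makes no other point eligible.\<close>

lemma pt_insert:
  assumes S: "S \<subseteq> {1..n} \<times> {1..r}" and T: "insert (pt S j, j) S \<subseteq> {1..n} \<times> {1..r}"
    and sv: "single_valued (insert (pt S j, j) S)" and "s \<le> j"
  shows "pt (insert (pt S j, j) S) s = pt S s"
  using \<open>s \<le> j\<close>
proof (induction s)
  case (Suc s)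
  let ?T = "insert (pt S j, j) S"
  have IH: "pt ?T s = pt S s" using Suc by simp
  have "pt S (Suc s) \<le> pt ?T (Suc s)"
    by (rule pt_antimono[OF T sv]) (use IH in auto)
  moreover have "pt ?T (Suc s) \<le> pt S (Suc s)"
  proof (rule pt_Suc_le)
    show "pt ?T s < pt S (Suc s)" using IH pt_Suc[OF S, of s] by simp
    show "free ?T (pt S (Suc s)) \<or> (pt S (Suc s), Suc s) \<in> ?T"
    proof (cases "Suc s = j")
      case False
      then have "pt S (Suc s) < pt S j" using Suc.prems by (intro pt_mono[OF S]) auto
      then show ?thesis using pt_Suc(2)[OF S, of s] by (auto simp: free_def)
    qed simp
  qed
  ultimately show ?case by simp
qed simp

lemma part_insert: "s \<noteq> j \<Longrightarrow> part (insert (y, j) S) s = part S s"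
  "part (insert (y, j) S) j = insert y (part S j)"
  "s \<noteq> j \<Longrightarrow> part (S - {(y, j)}) s = part S s"
  "part (S - {(y, j)}) j = part S j - {y}"
  by (auto simp: part_def)

text \<open>The pivots up to the stage and the parts with smaller labels are unchanged, so the scan
  fails at the same earlier stages and stops at the same point.\<close>

lemma insert_pivot:
  assumes S: "S \<in> deleted_join r K" and m: "matched S"
  shows "insert (pivot S) S \<in> deleted_join r K"
    and "matched (insert (pivot S) S) \<and> stage (insert (pivot S) S) = stage S \<and>
      pivot (insert (pivot S) S) = pivot S"
proof -
  define j where "j = stage S"
  define T where "T = insert (pt S j, j) S"
  have p: "pivot S = (pt S j, j)" by (simp add: pivot_def j_def)
  have Ssub: "S \<subseteq> {1..n} \<times> {1..r}" using S by (rule deleted_join_subset)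
  have ad: "addable S j" using stage_addable[OF m] by (simp add: j_def)
  then have j: "j \<in> {1..r}" "insert (pt S j) (part S j) \<in> K j" by (auto simp: addable_def)
  then obtain s where s: "j = Suc s" by (cases j) auto
  have "free S (pt S j) \<or> (pt S j, j) \<in> S" using pt_Suc[OF Ssub, of s] s by simp
  then have sv: "single_valued T" using S by (auto simp: T_def deleted_join_iff single_valued_def free_def)
  have "part T i \<in> K i" if "i \<in> {1..r}" for i
    using that j S by (cases "i = j") (auto simp: T_def part_insert deleted_join_iff)
  then have T: "T \<in> deleted_join r K" using S sv j by (auto simp: T_def deleted_join_iff)
  then show "insert (pivot S) S \<in> deleted_join r K" by (simp add: T_def p)
  have pts: "pt T s = pt S s" if "s \<le> j" for s
    using pt_insert[OF Ssub _ _ that] sv deleted_join_subset[OF T] by (simp add: T_def)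
  have "addable T j" using ad pts[of j] by (simp add: addable_def T_def part_insert)
  moreover have "\<not> addable T s" if "s < j" for s
    using that stage_not_addable[of s S] pts[of s] by (simp add: addable_def T_def part_insert j_def)
  ultimately have "stage T = j" "matched T" by (auto intro: stage_eqI simp: matched_def)
  then show "matched (insert (pivot S) S) \<and> stage (insert (pivot S) S) = stage S \<and>
      pivot (insert (pivot S) S) = pivot S"
    using pts[of j] by (simp add: pivot_def T_def j_def)
qed

lemma remove_pivot:
  assumes T: "T \<in> deleted_join r K" and m: "matched T" and pT: "pivot T \<in> T"
  shows "matched (T - {pivot T}) \<and> pivot (T - {pivot T}) = pivot T"
proof -
  define j where "j = stage T"
  define S where "S = T - {(pt T j, j)}"
  have p: "pivot T = (pt T j, j)" by (simp add: pivot_def j_def)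
  have Tsub: "T \<subseteq> {1..n} \<times> {1..r}" using T by (rule deleted_join_subset)
  then have Ssub: "S \<subseteq> {1..n} \<times> {1..r}" by (auto simp: S_def)
  have svT: "single_valued T" using T by (simp add: deleted_join_iff)
  have pts: "s \<le> j \<Longrightarrow> pt S s = pt T s" for s
  proof (induction s)
    case (Suc s)
    then have IH: "pt S s = pt T s" by simp
    have "pt S (Suc s) \<le> pt T (Suc s)"
      by (rule pt_antimono[OF Tsub svT _ IH]) (auto simp: S_def)
    moreover have "pt T (Suc s) \<le> pt S (Suc s)"
    \<comment> \<open>The only point that the removal can make eligible is \<open>pt T j\<close>,
      and \<open>pt T (Suc s)\<close> does not exceed it.\<close>
    proof (cases "pt S (Suc s) = pt T j")
      case True
      then show ?thesis using Suc.prems pt_mono[OF Tsub, of "Suc s" j] by (cases "Suc s = j") auto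
    next
      case False
      show ?thesis
      proof (rule pt_Suc_le)
        show "pt T s < pt S (Suc s)" using IH pt_Suc[OF Ssub, of s] by simp
        show "free T (pt S (Suc s)) \<or> (pt S (Suc s), Suc s) \<in> T"
          using pt_Suc(2)[OF Ssub, of s] False by (auto simp: free_def S_def)
      qed
    qed
    ultimately show ?case by simp
  qed simp
  have ad: "addable T j" using stage_addable[OF m] by (simp add: j_def)
  have "insert (pt T j) (part T j) = insert (pt T j) (part T j - {pt T j})" by blast
  then have "addable S j" using ad pts[of j] by (simp add: addable_def S_def part_insert)
  moreover have "\<not> addable S s" if "s < j" for s
    using that stage_not_addable[of s T] pts[of s] by (simp add: addable_def S_def part_insert j_def)
  ultimately have "stage S = j" "matched S" by (auto intro: stage_eqI simp: matched_def)
  then show ?thesis using pts[of j] by (simp add: pivot_def S_def j_def)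
qed

lemma finite_simplex: "S \<in> deleted_join r K \<Longrightarrow> finite S"
  by (rule face_closed_finite[OF face_closed_deleted_join])

section \<open>Unmatched simplices are large\<close>

lemma card_eq:
  assumes "S \<in> deleted_join r K"
  shows "card S + card {y\<in>{1..n}. free S y} = n"
proof -
  have sub: "S \<subseteq> {1..n} \<times> {1..r}" and sv: "single_valued S"
    using deleted_join_subset[OF assms] assms by (auto simp: deleted_join_iff)
  have "card S = card (fst ` S)"
    using sv by (intro card_image[symmetric] inj_onI) (auto simp: single_valued_def)
  moreover have "{y\<in>{1..n}. free S y} = {1..n} - fst ` S" by (force simp: free_def)
  moreover have "fst ` S \<subseteq> {1..n}" using sub by auto
  moreover have "card (fst ` S) \<le> n" using card_mono[OF _ calculation(3)] by simp
  ultimately show ?thesis by (simp add: card_Diff_subset finite_subset)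
qed

text \<open>A free point is eligible under every label, so the scan cannot pass it without making it
  a pivot.\<close>

lemma free_below_pt:
  assumes "S \<subseteq> {1..n} \<times> {1..r}" "free S y" "1 \<le> y" "y < pt S j"
  shows "y \<in> pt S ` {1..<j}"
  using assms(4)
proof (induction j)
  case (Suc j)
  show ?case
  proof (cases "y < pt S j")
    case True
    then have "y \<in> pt S ` {1..<j}" by (rule Suc.IH)
    moreover have "{1..<j} \<subseteq> {1..<Suc j}" by auto
    ultimately show ?thesis by blast
  next
    case False
    then have "pt S j = y"
      using pt_Suc_le[of S j y] assms(2) Suc.prems by linarith
    moreover have "1 \<le> j" using calculation assms(3) by (cases j) auto
    ultimately show ?thesis by (intro image_eqI[of _ _ j]) auto
  qed
qed simp

lemma unmatched_card:
  assumes S: "S \<in> deleted_join r K" and nm: "\<not> matched S" and cu: "collective_unavoidable n r K"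
  shows "Suc n - r \<le> card S"
proof -
  have sub: "S \<subseteq> {1..n} \<times> {1..r}" using deleted_join_subset[OF S] .
  have sv: "single_valued S" and parts: "\<And>i. i\<in>{1..r} \<Longrightarrow> part S i \<in> K i" using S by (auto simp: deleted_join_iff)
  have nad: "insert (pt S j) (part S j) \<notin> K j" if "j \<in> {1..r}" for j
    using nm that by (auto simp: matched_def addable_def)
  \<comment> \<open>A pivot that already carried its label would be addable, because inserting it
    changes nothing.\<close>
  have fr: "free S (pt S j)" if j: "j \<in> {1..r}" for j
  proof (rule ccontr)
    assume "\<not> free S (pt S j)"
    then have "(pt S j, j) \<in> S" using pt_Suc(2)[OF sub, of "j - 1"] j by simp
    then have "insert (pt S j) (part S j) = part S j" by (auto simp: part_def)
    then show False using nad[OF j] parts[OF j] by simp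
  qed
  have "\<exists>j\<in>{1..r}. n < pt S j"
  proof (rule ccontr)
    assume "\<not> ?thesis"
    then have le: "pt S j \<le> n" if "j \<in> {1..r}" for j using that by (auto simp: not_less)
    define A where "A j = insert (pt S j) (part S j)" for j
    have "A j \<subseteq> {1..n}" if "j \<in> {1..r}" for j
      using le[OF that] K_subset[OF that parts[OF that]] pt_mono[OF sub, of 0 j] that by (auto simp: A_def)
    moreover have "disjoint_family_on A {1..r}"
      unfolding disjoint_family_on_def
    proof (intro ballI impI)
      fix i j assume ij: "i \<in> {1..r}" "j \<in> {1..r}" "i \<noteq> j"
      have "pt S i \<noteq> pt S j" using pt_mono[OF sub, of i j] pt_mono[OF sub, of j i] ij(3) by (cases i j rule: linorder_cases) auto
      then show "A i \<inter> A j = {}"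
        using fr[OF ij(1)] fr[OF ij(2)] sv ij(3) by (auto simp: A_def part_def free_def single_valued_def)
    qed
    ultimately obtain j where "j \<in> {1..r}" "A j \<in> K j" using cu unfolding collective_unavoidable_def by blast
    then show False using nad by (auto simp: A_def)
  qed
  then obtain j where j: "j \<in> {1..r}" "n < pt S j" by auto
  \<comment> \<open>All free points lie below the \<open>j\<close>-th pivot, hence among the
    \<open>j - 1\<close> pivots before it, and \<open>j \<le> r\<close>.\<close>
  have "{y\<in>{1..n}. free S y} \<subseteq> pt S ` {1..<j}"
    using free_below_pt[OF sub, of _ j] j(2) by auto
  then have "card {y\<in>{1..n}. free S y} \<le> card (pt S ` {1..<j})" by (rule card_mono[rotated]) simp
  also have "\<dots> \<le> j - 1" using card_image_le[of "{1..<j}" "pt S"] by simp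
  finally show ?thesis using card_eq[OF S] j(1) by (auto simp: le_diff_conv)
qed

text \<open>Inserting the pivot leaves the list up to the stage as it is; deleting \<open>x\<close>
  afterwards only enlarges the sets of eligible points. So at the first entry that changes, the
  pivot is smaller, or the stage has already been passed and the entry is 0.\<close>

lemma rank_list_decreases:
  assumes S: "S \<in> deleted_join r K" "matched S" "pivot S \<notin> S" and x: "x \<in> S"
    and S': "pivot (insert (pivot S) S - {x}) \<notin> insert (pivot S) S - {x}"
  shows "(rank_list (insert (pivot S) S - {x}), rank_list S) \<in> lexn less_than r"
proof -
  define j where "j = stage S"
  define T where "T = insert (pivot S) S"
  define U where "U = T - {x}"
  have p: "pivot S = (pt S j, j)" by (simp add: pivot_def j_def)
  have T: "T \<in> deleted_join r K" using insert_pivot[OF S(1,2)] by (simp add: T_def)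
  have U: "U \<in> deleted_join r K" using deleted_join_down[OF T] by (auto simp: U_def)
  note subs = deleted_join_subset[OF S(1)] deleted_join_subset[OF T] deleted_join_subset[OF U]
  have svT: "single_valued T" using T by (simp add: deleted_join_iff)
  have pts: "pt T s = pt S s" if "s \<le> j" for s
    using pt_insert[OF subs(1) _ _ that] svT subs(2) p by (simp add: T_def)
  have ad: "addable S j" using stage_addable[OF S(2)] by (simp add: j_def)
  then have jr: "j \<in> {1..r}" by (simp add: addable_def)
  have xp: "pivot S \<noteq> x" using x S(3) by auto
  define e where "e S s = (if s \<le> stage S then pt S s else 0)" for S s
  have epos: "0 < e S s" if "1 \<le> s" "s \<le> j" for s
    using that pt_mono[OF subs(1), of 0 s] by (simp add: e_def j_def)
  \<comment> \<open>Without a change up to \<open>j\<close>, the pivot of the new simplex would be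
    the vertex just inserted, which is still present because \<open>x\<close> is an older one; so
    the new simplex would be the upper member of its pair.\<close>
  have "\<exists>s. s \<in> {1..j} \<and> e U s \<noteq> e S s"
  proof (rule ccontr)
    assume "\<not> ?thesis"
    then have eq: "e U s = e S s" if "s \<in> {1..j}" for s using that by blast
    have jU: "j \<le> stage U" using eq[of j] epos[of j] jr by (auto simp: e_def split: if_splits)
    then have ptU: "pt U j = pt S j" using eq[of j] jr by (simp add: e_def j_def)
    have "(pt S j, j) \<in> U" using p xp by (simp add: U_def T_def)
    then have "insert (pt U j) (part U j) = part U j" using ptU by (auto simp: part_def)
    then have "addable U j" using U jr by (simp add: addable_def deleted_join_iff)
    then have "stage U = j" using jU stage_not_addable[of j U] by fastforce
    then have "pivot U \<in> U" using \<open>(pt S j, j) \<in> U\<close> ptU by (simp add: pivot_def)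
    then show False using S' by (simp add: U_def T_def)
  qed
  then obtain s where s: "s \<in> {1..j}" "e U s \<noteq> e S s"
    and min: "\<And>s'. s' < s \<Longrightarrow> \<not> (s' \<in> {1..j} \<and> e U s' \<noteq> e S s')"
    using exists_least_iff[of "\<lambda>s. s \<in> {1..j} \<and> e U s \<noteq> e S s"] by blast
  have before: "e U s' = e S s'" if "1 \<le> s'" "s' < s" for s'
    using min[of s'] that s by auto
  have less: "e U s < e S s"
  proof (cases "s \<le> stage U")
    case True
    have "pt U (s - 1) = pt T (s - 1)"
    proof (cases "s = 1")
      case False
      then have "1 \<le> s - 1" "s - 1 \<le> stage U" "s - 1 \<le> stage S" using s True by (auto simp: j_def)
      then have "pt U (s - 1) = pt S (s - 1)"
        using before[of "s - 1"] s True by (simp add: e_def j_def)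
      then show ?thesis using pts[of "s - 1"] s by auto
    qed simp
    then have "pt U (Suc (s - 1)) \<le> pt T (Suc (s - 1))"
      by (intro pt_antimono[OF subs(2) svT]) (auto simp: U_def)
    then have "pt U s \<le> pt S s" using pts[of s] s by simp
    then show ?thesis using s True by (auto simp: e_def j_def)
  next
    case False
    then show ?thesis using epos[of s] s by (simp add: e_def)
  qed
  have upt: "[1..<Suc r] = [1..<s] @ s # [Suc s..<Suc r]"
    using s jr upt_add_eq_append[of 1 s "Suc r - s"] upt_conv_Cons[of s "Suc r"] by auto
  have "rank_list U = map (e S) [1..<s] @ e U s # map (e U) [Suc s..<Suc r]"
    unfolding rank_list_def upt using before by (auto simp: e_def)
  moreover have "rank_list S = map (e S) [1..<s] @ e S s # map (e S) [Suc s..<Suc r]"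
    unfolding rank_list_def upt by (simp add: e_def)
  moreover have "length (rank_list U) = r" "length (rank_list S) = r" by (simp_all add: rank_list_def)
  ultimately have "(rank_list U, rank_list S) \<in> lexn less_than r"
    using less unfolding lexn_conv by fastforce
  then show ?thesis by (simp add: U_def T_def)
qed

theorem morse_built_deleted_join:
  assumes "collective_unavoidable n r K"
  shows "morse_built (Suc n - r) (deleted_join r K)"
proof (rule acyclic_matching_morse_built[where p = pivot and matched = matched and h = rank_list
      and R = "lexn less_than r"])
  show "wf (lexn less_than r)" by (rule wf_lexn) simp
  show "finite (deleted_join r K)" by (rule finite_deleted_join)
  show "face_closed (deleted_join r K)" by (rule face_closed_deleted_join)
next
  fix A assume A: "A \<in> deleted_join r K" "matched A" "pivot A \<notin> A"
  then show "insert (pivot A) A \<in> deleted_join r K \<and> matched (insert (pivot A) A) \<and>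
      pivot (insert (pivot A) A) = pivot A"
    using insert_pivot[of A] by blast
next
  fix A assume A: "A \<in> deleted_join r K" "matched A" "pivot A \<in> A"
  then show "matched (A - {pivot A}) \<and> pivot (A - {pivot A}) = pivot A" by (rule remove_pivot)
next
  fix A assume "A \<in> deleted_join r K" "\<not> matched A"
  then show "Suc n - r \<le> card A" by (rule unmatched_card[OF _ _ assms])
next
  fix A x assume "A \<in> deleted_join r K" "matched A" "pivot A \<notin> A" "x \<in> A"
    "matched (insert (pivot A) A - {x})"
    "pivot (insert (pivot A) A - {x}) \<notin> insert (pivot A) A - {x}"
  then show "(rank_list (insert (pivot A) A - {x}), rank_list A) \<in> lexn less_than r"
    by (intro rank_list_decreases)
qed

end

section \<open>Geometric realizations and elementary expansions\<close>

definition supp :: "('v \<Rightarrow> real) \<Rightarrow> 'v set" where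
  "supp x = {v. x v \<noteq> 0}"

lemma in_realization_iff:
  "x \<in> topspace (geometric_realization L) \<longleftrightarrow>
     (\<forall>v. 0 \<le> x v) \<and> supp x \<in> L \<and> (\<Sum>v\<in>supp x. x v) = 1"
  by (simp add: geometric_realization_def supp_def)

lemma sum_supp: "finite A \<Longrightarrow> supp x \<subseteq> A \<Longrightarrow> (\<Sum>v\<in>A. x v) = (\<Sum>v\<in>supp x. x v)"
  by (rule sum.mono_neutral_right) (auto simp: supp_def)

lemma in_realizationI:
  assumes "face_closed L" "A \<in> L" "\<And>v. 0 \<le> x v" "supp x \<subseteq> A" "(\<Sum>v\<in>A. x v) = 1"
  shows "x \<in> topspace (geometric_realization L)"
  using assms sum_supp[of A x] face_closedD[OF assms(1,2)] by (simp add: in_realization_iff)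

lemma realization_sum:
  assumes "x \<in> topspace (geometric_realization L)" "supp x \<subseteq> A" "finite A"
  shows "(\<Sum>v\<in>A. x v) = 1"
  using assms sum_supp[of A x] by (simp add: in_realization_iff)

lemma realization_nonneg: "x \<in> topspace (geometric_realization L) \<Longrightarrow> 0 \<le> x v"
  and realization_supp: "x \<in> topspace (geometric_realization L) \<Longrightarrow> supp x \<in> L"
  by (auto simp: in_realization_iff)

lemma realization_mono:
  "L \<subseteq> M \<Longrightarrow> topspace (geometric_realization L) \<subseteq> topspace (geometric_realization M)"
  by (auto simp: in_realization_iff)

lemma continuous_map_realization:
  "continuous_map X (geometric_realization L) f \<longleftrightarrow>
     (\<forall>v. continuous_map X euclideanreal (\<lambda>x. f x v)) \<and>
     (\<forall>x\<in>topspace X. f x \<in> topspace (geometric_realization L))"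
  by (auto simp: geometric_realization_def continuous_map_in_subtopology
      continuous_map_componentwise_UNIV)

lemma continuous_map_realization_coord:
  "continuous_map X (geometric_realization L) f \<Longrightarrow> continuous_map X euclideanreal (\<lambda>x. f x v)"
  by (simp add: continuous_map_realization)

lemma continuous_map_coord [continuous_intros]:
  "continuous_map (geometric_realization L) euclideanreal (\<lambda>x. x v)"
  by (rule continuous_map_realization_coord[of _ L]) (simp add: continuous_map_id[unfolded id_def])

lemma continuous_map_realization_mono:
  "L \<subseteq> M \<Longrightarrow> continuous_map X (geometric_realization L) f \<Longrightarrow>
     continuous_map X (geometric_realization M) f"
  using realization_mono[of L M] by (auto simp: continuous_map_realization)

lemma continuous_map_realization_incl:
  "L \<subseteq> M \<Longrightarrow> continuous_map (geometric_realization L) (geometric_realization M) id"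
  by (rule continuous_map_realization_mono) auto

lemma continuous_map_Min:
  assumes "finite A" "A \<noteq> {}" "\<And>v. v \<in> A \<Longrightarrow> continuous_map X euclideanreal (f v)"
  shows "continuous_map X euclideanreal (\<lambda>x. Min ((\<lambda>v. f v x) ` A))"
  using assms
proof (induction A rule: finite_ne_induct)
  case (insert v A)
  then have "continuous_map X euclideanreal (\<lambda>x. min (f v x) (Min ((\<lambda>v. f v x) ` A)))"
    by (intro continuous_map_real_min) auto
  then show ?case using insert.hyps by simp
qed simp

text \<open>Closed simplices are convex in barycentric coordinates. The common simplex
  \<open>A\<close> may depend on \<open>x\<close> in any way, since continuity is checked coordinate
  by coordinate.\<close>

lemma homotopic_straight_line:
  fixes f g :: "'b \<Rightarrow> 'v \<Rightarrow> real"
  assumes fc: "face_closed L"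
    and f: "continuous_map X (geometric_realization L) f"
    and g: "continuous_map X (geometric_realization L) g"
    and carrier: "\<And>x. x \<in> topspace X \<Longrightarrow> \<exists>A\<in>L. supp (f x) \<subseteq> A \<and> supp (g x) \<subseteq> A"
  shows "homotopic_with (\<lambda>_. True) X (geometric_realization L) f g"
proof -
  define h where "h = (\<lambda>(t::real, x) v. (1 - t) * f x v + t * g x v)"
  have "continuous_map (prod_topology (top_of_set {0..1}) X) (geometric_realization L) h"
    unfolding continuous_map_realization
  proof (intro conjI allI ballI)
    fix v
    have t: "continuous_map (prod_topology (top_of_set {0..1}) X) euclideanreal fst"
      using continuous_map_fst continuous_map_in_subtopology by blast
    have "continuous_map (prod_topology (top_of_set {0..1}) X) (geometric_realization L) (f \<circ> snd)"
      "continuous_map (prod_topology (top_of_set {0..1}) X) (geometric_realization L) (g \<circ> snd)"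
      using f g continuous_map_compose[OF continuous_map_snd] by blast+
    then have fg: "continuous_map (prod_topology (top_of_set {0..1}) X) euclideanreal (\<lambda>p. f (snd p) v)"
      "continuous_map (prod_topology (top_of_set {0..1}) X) euclideanreal (\<lambda>p. g (snd p) v)"
      by (auto simp: continuous_map_realization o_def)
    show "continuous_map (prod_topology (top_of_set {0..1}) X) euclideanreal (\<lambda>p. h p v)"
      unfolding h_def case_prod_unfold by (intro continuous_intros t fg)
  next
    fix p :: "real \<times> 'b" assume "p \<in> topspace (prod_topology (top_of_set {0..1}) X)"
    then obtain t x where p: "p = (t, x)" "0 \<le> t" "t \<le> 1" "x \<in> topspace X" by auto
    then obtain A where A: "A \<in> L" "supp (f x) \<subseteq> A" "supp (g x) \<subseteq> A" using carrier by blast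
    have fg: "f x \<in> topspace (geometric_realization L)" "g x \<in> topspace (geometric_realization L)"
      using f g p(4) by (auto simp: continuous_map_realization)
    have finA: "finite A" using fc A face_closed_finite by blast
    show "h p \<in> topspace (geometric_realization L)"
    proof (rule in_realizationI[OF fc A(1)])
      show "0 \<le> h p v" for v
        using p fg by (simp add: h_def realization_nonneg)
      show "supp (h p) \<subseteq> A" using A by (force simp: h_def p supp_def)
      have "(\<Sum>v\<in>A. h p v) = (1 - t) * (\<Sum>v\<in>A. f x v) + t * (\<Sum>v\<in>A. g x v)"
        by (simp add: h_def p sum.distrib sum_distrib_left)
      then show "(\<Sum>v\<in>A. h p v) = 1"
        using realization_sum[OF fg(1) A(2) finA] realization_sum[OF fg(2) A(3) finA] by simp
    qed
  qed
  then show ?thesis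
    unfolding homotopic_with_def by (intro exI[of _ h]) (auto simp: h_def)
qed

text \<open>Points move in the direction from the barycentre of \<open>\<sigma>\<close> to
  \<open>v\<close> until a coordinate in \<open>\<sigma>\<close> vanishes: the minimum
  \<open>m x\<close> is taken from each of these coordinates and the total is given to
  \<open>v\<close>. Outside the two new open simplices \<open>m x = 0\<close>, so nothing
  moves.\<close>

lemma expansion_retraction:
  assumes fc: "face_closed L" and \<sigma>: "finite \<sigma>" "\<sigma> \<noteq> {}" "v \<notin> \<sigma>" "\<sigma> \<notin> L"
    and faces: "\<And>B. B \<subset> insert v \<sigma> \<Longrightarrow> B \<noteq> \<sigma> \<Longrightarrow> B \<in> L"
  defines "M \<equiv> insert \<sigma> (insert (insert v \<sigma>) L)"
  shows "\<exists>\<rho>. continuous_map (geometric_realization M) (geometric_realization L) \<rho> \<and>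
    homotopic_with (\<lambda>_. True) (geometric_realization M) (geometric_realization M) id \<rho>"
proof -
  have fcM: "face_closed M" unfolding M_def by (rule face_closed_expand[OF fc \<sigma>(1) faces \<sigma>(3)])
  define m where "m x = Min (x ` \<sigma>)" for x :: "'a \<Rightarrow> real"
  define \<rho> where "\<rho> x u = x u - (if u \<in> \<sigma> then m x else 0) + (if u = v then real (card \<sigma>) * m x else 0)"
    for x :: "'a \<Rightarrow> real" and u
  have m: "0 \<le> m x \<and> (\<forall>u\<in>\<sigma>. m x \<le> x u) \<and> (\<exists>u\<in>\<sigma>. m x = x u)"
    if "x \<in> topspace (geometric_realization M)" for x
  proof -
    have "m x \<in> x ` \<sigma>" unfolding m_def using \<sigma> by (intro Min_in) auto
    moreover have "0 \<le> m x" using calculation realization_nonneg[OF that] by auto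
    moreover have "\<forall>u\<in>\<sigma>. m x \<le> x u" using \<sigma> by (auto simp: m_def)
    ultimately show ?thesis by auto
  qed
  have mpos: "supp x \<subseteq> insert v \<sigma>"
    if "x \<in> topspace (geometric_realization M)" "m x \<noteq> 0" for x
  proof -
    have "\<sigma> \<subseteq> supp x" using m[OF that(1)] that(2) by (force simp: supp_def)
    then have "supp x \<notin> L" using fc \<sigma>(4) face_closed_subset by blast
    then show ?thesis using realization_supp[OF that(1)] by (auto simp: M_def)
  qed
  have m0: "\<rho> x = x" if "m x = 0" for x using that by (auto simp: \<rho>_def)
  have in_L: "\<rho> x \<in> topspace (geometric_realization L) \<and> (\<exists>A\<in>M. supp x \<subseteq> A \<and> supp (\<rho> x) \<subseteq> A)"
    if x: "x \<in> topspace (geometric_realization M)" for x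
  proof -
    obtain w where w: "w \<in> \<sigma>" "m x = x w" using m[OF x] by blast
    show ?thesis
    proof (cases "m x = 0")
      case True
      have "supp x \<noteq> \<sigma>" "supp x \<noteq> insert v \<sigma>" using w True by (auto simp: supp_def)
      then have "supp x \<in> L" using realization_supp[OF x] by (auto simp: M_def)
      then show ?thesis using m0[OF True] x by (auto simp: in_realization_iff M_def)
    next
      case False
      have sub: "supp x \<subseteq> insert v \<sigma>" using mpos[OF x False] .
      have sub': "supp (\<rho> x) \<subseteq> insert v \<sigma> - {w}"
        using sub w \<sigma>(3) by (auto simp: supp_def \<rho>_def split: if_splits)
      have "insert v \<sigma> - {w} \<in> L" using w \<sigma>(3) by (intro faces) auto
      moreover have "0 \<le> \<rho> x u" for u
        using m[OF x] realization_nonneg[OF x, of u] by (auto simp: \<rho>_def)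
      moreover have "(\<Sum>u\<in>insert v \<sigma> - {w}. \<rho> x u) = 1"
      proof -
        have "(\<Sum>u\<in>insert v \<sigma> - {w}. \<rho> x u) = (\<Sum>u\<in>insert v \<sigma>. \<rho> x u)"
          using \<sigma> sub' by (intro sum.mono_neutral_left) (auto simp: supp_def)
        also have "\<dots> = \<rho> x v + (\<Sum>u\<in>\<sigma>. \<rho> x u)" using \<sigma> by simp
        also have "(\<Sum>u\<in>\<sigma>. \<rho> x u) = (\<Sum>u\<in>\<sigma>. x u - m x)"
          using \<sigma>(3) by (intro sum.cong) (auto simp: \<rho>_def)
        also have "\<rho> x v + (\<Sum>u\<in>\<sigma>. x u - m x) = (\<Sum>u\<in>insert v \<sigma>. x u)"
          using \<sigma> by (simp add: \<rho>_def sum_subtractf)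
        also have "\<dots> = 1" using realization_sum[OF x sub] \<sigma> by simp
        finally show ?thesis .
      qed
      ultimately have "\<rho> x \<in> topspace (geometric_realization L)"
        using sub' by (intro in_realizationI[OF fc]) auto
      then show ?thesis using sub sub' by (auto simp: M_def)
    qed
  qed
  have "continuous_map (geometric_realization M) euclideanreal m"
    unfolding m_def by (intro continuous_map_Min continuous_map_coord \<sigma>)
  then have "continuous_map (geometric_realization M) euclideanreal (\<lambda>x. \<rho> x u)" for u
    unfolding \<rho>_def by (auto intro!: continuous_intros)
  then have cont: "continuous_map (geometric_realization M) (geometric_realization L) \<rho>"
    using in_L by (simp add: continuous_map_realization)
  have "homotopic_with (\<lambda>_. True) (geometric_realization M) (geometric_realization M) id \<rho>"
  proof (rule homotopic_straight_line[OF fcM])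
    show "continuous_map (geometric_realization M) (geometric_realization M) \<rho>"
      using cont by (rule continuous_map_realization_mono[rotated]) (auto simp: M_def)
  qed (use in_L in auto)
  then show ?thesis using cont by blast
qed

lemma realization_vertex:
  assumes "{v} \<in> L"
  shows "(\<lambda>u. if u = v then 1 else 0) \<in> topspace (geometric_realization L)"
proof -
  have "supp (\<lambda>u. if u = v then 1 else 0) = {v}" by (auto simp: supp_def)
  then show ?thesis using assms by (simp add: in_realization_iff)
qed

lemma topspace_realization_point:
  "topspace (geometric_realization {{}, {v}}) = {\<lambda>u. if u = v then 1 else 0}"
proof -
  have "x = (\<lambda>u. if u = v then 1 else 0)"
    if x: "x \<in> topspace (geometric_realization {{}, {v}})" for x
  proof -
    have s: "supp x \<subseteq> {v}" "(\<Sum>u\<in>{v}. x u) = 1"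
      using x realization_sum[OF x, of "{v}"] by (auto simp: in_realization_iff)
    then show ?thesis by (auto simp: supp_def fun_eq_iff)
  qed
  then show ?thesis using realization_vertex[of v "{{}, {v}}"] by blast
qed

lemma face_closed_without_empty:
  assumes "face_closed L" "{} \<notin> L"
  shows "L = {}"
  using face_closed_subset[OF assms(1), of _ "{}"] assms(2) by blast

text \<open>The expansion from the void complex yields a single point. Every later one has a
  retraction homotopic to the identity, after which the contraction of the smaller complex is
  applied.\<close>

lemma contractible_collapsible:
  assumes "collapsible L" "L \<noteq> {}"
  shows "contractible_space (geometric_realization L)"
  using assms
proof (induction rule: collapsible.induct)
  case (expand L \<sigma> v)
  let ?M = "insert \<sigma> (insert (insert v \<sigma>) L)"
  have fc: "face_closed L" using expand.hyps collapsible_face_closed by blast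
  show ?case
  proof (cases "\<sigma> = {}")
    case True
    then have "L = {}" using face_closed_without_empty[OF fc] expand.hyps by blast
    then have "topspace (geometric_realization ?M) = {\<lambda>u. if u = v then 1 else 0}"
      using True topspace_realization_point[of v] by simp
    then show ?thesis using contractible_space_subset_singleton[of "geometric_realization ?M"] by blast
  next
    case False
    obtain \<rho> where \<rho>: "continuous_map (geometric_realization ?M) (geometric_realization L) \<rho>"
      "homotopic_with (\<lambda>_. True) (geometric_realization ?M) (geometric_realization ?M) id \<rho>"
      using expansion_retraction[OF fc expand.hyps(2) False expand.hyps(3-5)] by blast
    have "{} \<in> L" using expand.hyps False by blast
    then obtain a where a: "homotopic_with (\<lambda>_. True) (geometric_realization L) (geometric_realization L) id (\<lambda>_. a)"
      using expand.IH by (auto simp: contractible_space_def)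
    have "homotopic_with (\<lambda>_. True) (geometric_realization ?M) (geometric_realization L) (id \<circ> \<rho>) ((\<lambda>_. a) \<circ> \<rho>)"
      using a \<rho>(1) by (intro homotopic_with_compose_continuous_map_right) auto
    then have "homotopic_with (\<lambda>_. True) (geometric_realization ?M) (geometric_realization ?M)
        (id \<circ> (id \<circ> \<rho>)) (id \<circ> ((\<lambda>_. a) \<circ> \<rho>))"
      by (rule homotopic_with_compose_continuous_map_left) (auto intro: continuous_map_realization_incl)
    then have "homotopic_with (\<lambda>_. True) (geometric_realization ?M) (geometric_realization ?M) \<rho> (\<lambda>_. a)"
      by (simp add: o_def)
    then show ?thesis using homotopic_with_trans[OF \<rho>(2)] by (auto simp: contractible_space_def)
  qed
qed simp

section \<open>Maps from low-dimensional spheres\<close>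

lemma topspace_nsphere:
  "topspace (nsphere i) = {x. (\<Sum>j\<le>i. (x j)\<^sup>2) = 1 \<and> (\<forall>j>i. x j = 0)}"
  by (auto simp: nsphere Suc_le_eq)

text \<open>Connects abstract topologies with the type class topology on functions, where
  \<open>compact\<close>, \<open>continuous_on\<close> and the Stone-Weierstrass theorem
  live.\<close>

lemma nsphere_top_of_set: "nsphere i = top_of_set (topspace (nsphere i))"
proof -
  have "nsphere i = top_of_set {x. (\<Sum>j\<le>i. (x j)\<^sup>2) = 1 \<and> (\<forall>j>i. x j = 0)}"
    unfolding nsphere euclidean_product_topology ..
  then show ?thesis by simp
qed

lemma nsphere_coord_le_1:
  assumes "x \<in> topspace (nsphere i)"
  shows "\<bar>x j\<bar> \<le> 1"
proof (cases "j \<le> i")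
  case True
  have "(x j)\<^sup>2 \<le> (\<Sum>j\<le>i. (x j)\<^sup>2)" using True by (intro member_le_sum) auto
  then show ?thesis using assms by (simp add: topspace_nsphere abs_square_le_1)
next
  case False
  then have "x j = 0" using assms unfolding topspace_nsphere by auto
  then show ?thesis by simp
qed

lemma compact_nsphere: "compact (topspace (nsphere i))"
proof -
  have "compactin (powertop_real UNIV) (PiE UNIV (\<lambda>j::nat. {-1..1::real}))"
    by (simp add: compactin_PiE)
  then have c: "compact (PiE UNIV (\<lambda>j::nat. {-1..1::real}))"
    by (simp add: euclidean_product_topology)
  have "continuous_on UNIV (\<lambda>x::nat\<Rightarrow>real. x j)" for j
    by (rule continuous_on_product_coordinates)
  then have "closed {x::nat\<Rightarrow>real. (\<Sum>j\<le>i. (x j)\<^sup>2) = 1}" "closed {x::nat\<Rightarrow>real. \<forall>j>i. x j = 0}"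
    by (auto intro!: closed_Collect_eq closed_Collect_all closed_Collect_imp continuous_intros)
  then have "closed (topspace (nsphere i))"
    unfolding topspace_nsphere Collect_conj_eq by (rule closed_Int)
  moreover have "topspace (nsphere i) \<subseteq> PiE UNIV (\<lambda>j::nat. {-1..1::real})"
    using nsphere_coord_le_1 by (force simp: abs_le_iff)
  ultimately show ?thesis using compact_Int_closed[OF c] by (metis inf.absorb2)
qed

text \<open>Closeness in the maximum norm over the coordinates 0 to \<open>i\<close>. Lipschitz
  bounds refer to this norm because it is the one in which the cells of the sphere are
  measured.\<close>

definition near :: "nat \<Rightarrow> real \<Rightarrow> (nat \<Rightarrow> real) \<Rightarrow> (nat \<Rightarrow> real) \<Rightarrow> bool" where
  "near i \<delta> x y \<longleftrightarrow> x \<in> topspace (nsphere i) \<and> y \<in> topspace (nsphere i) \<and> 0 \<le> \<delta> \<and>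
     (\<forall>j\<le>i. \<bar>x j - y j\<bar> \<le> \<delta>)"

definition sphere_lipschitz :: "nat \<Rightarrow> ((nat \<Rightarrow> real) \<Rightarrow> real) \<Rightarrow> bool" where
  "sphere_lipschitz i g \<longleftrightarrow> (\<exists>C\<ge>0. \<forall>x y \<delta>. near i \<delta> x y \<longrightarrow> \<bar>g x - g y\<bar> \<le> C * \<delta>)"

section \<open>Lipschitz functions on the sphere and approximation by them\<close>

lemma sphere_lipschitzI:
  assumes "0 \<le> C" "\<And>x y \<delta>. near i \<delta> x y \<Longrightarrow> \<bar>g x - g y\<bar> \<le> C * \<delta>"
  shows "sphere_lipschitz i g"
  using assms unfolding sphere_lipschitz_def by blast

lemma sphere_lipschitzE:
  assumes "sphere_lipschitz i g"
  obtains C where "0 \<le> C" "\<And>x y \<delta>. near i \<delta> x y \<Longrightarrow> \<bar>g x - g y\<bar> \<le> C * \<delta>"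
  using assms unfolding sphere_lipschitz_def by blast

lemma sphere_lipschitz_const: "sphere_lipschitz i (\<lambda>x. c)"
  by (rule sphere_lipschitzI[of 0]) auto

lemma sphere_lipschitz_coord: "sphere_lipschitz i (\<lambda>x. x j)"
proof (rule sphere_lipschitzI[of 1])
  fix x y \<delta> assume "near i \<delta> x y"
  then show "\<bar>x j - y j\<bar> \<le> 1 * \<delta>"
    unfolding near_def topspace_nsphere by (cases "j \<le> i") auto
qed simp

lemma sphere_lipschitz_add:
  assumes "sphere_lipschitz i f" "sphere_lipschitz i g"
  shows "sphere_lipschitz i (\<lambda>x. f x + g x)"
proof -
  obtain C where C: "0 \<le> C" "\<And>x y \<delta>. near i \<delta> x y \<Longrightarrow> \<bar>f x - f y\<bar> \<le> C * \<delta>"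
    by (rule sphere_lipschitzE[OF assms(1)]) auto
  obtain D where D: "0 \<le> D" "\<And>x y \<delta>. near i \<delta> x y \<Longrightarrow> \<bar>g x - g y\<bar> \<le> D * \<delta>"
    by (rule sphere_lipschitzE[OF assms(2)]) auto
  show ?thesis
  proof (rule sphere_lipschitzI[of "C + D"])
    fix x y \<delta> assume xy: "near i \<delta> x y"
    have "\<bar>f x - f y\<bar> \<le> C * \<delta>" "\<bar>g x - g y\<bar> \<le> D * \<delta>" using C(2)[OF xy] D(2)[OF xy] .
    then show "\<bar>f x + g x - (f y + g y)\<bar> \<le> (C + D) * \<delta>" by (simp add: algebra_simps)
  qed (use C D in auto)
qed

text \<open>A product of Lipschitz functions is Lipschitz if the factors are bounded; continuity on
  the compact sphere provides the bounds \<open>F\<close> and \<open>G\<close>.\<close>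

lemma sphere_lipschitz_mult:
  assumes "sphere_lipschitz i f" "sphere_lipschitz i g"
    and "continuous_on (topspace (nsphere i)) f" "continuous_on (topspace (nsphere i)) g"
  shows "sphere_lipschitz i (\<lambda>x. f x * g x)"
proof -
  obtain C where C: "0 \<le> C" "\<And>x y \<delta>. near i \<delta> x y \<Longrightarrow> \<bar>f x - f y\<bar> \<le> C * \<delta>"
    by (rule sphere_lipschitzE[OF assms(1)]) auto
  obtain D where D: "0 \<le> D" "\<And>x y \<delta>. near i \<delta> x y \<Longrightarrow> \<bar>g x - g y\<bar> \<le> D * \<delta>"
    by (rule sphere_lipschitzE[OF assms(2)]) auto
  have bd: "\<exists>B>0. \<forall>x\<in>topspace (nsphere i). \<bar>h x\<bar> \<le> B" if "continuous_on (topspace (nsphere i)) h" for h :: "_ \<Rightarrow> real"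
    using compact_imp_bounded[OF compact_continuous_image[OF that compact_nsphere]]
    by (auto simp: bounded_pos)
  obtain F where F: "0 < F" "\<forall>x\<in>topspace (nsphere i). \<bar>f x\<bar> \<le> F" using bd[OF assms(3)] by blast
  obtain G where G: "0 < G" "\<forall>x\<in>topspace (nsphere i). \<bar>g x\<bar> \<le> G" using bd[OF assms(4)] by blast
  show ?thesis
  proof (rule sphere_lipschitzI[of "C * G + F * D"])
    fix x y \<delta> assume xy: "near i \<delta> x y"
    have fg: "\<bar>f x - f y\<bar> \<le> C * \<delta>" "\<bar>g x - g y\<bar> \<le> D * \<delta>" using C(2)[OF xy] D(2)[OF xy] .
    have "f x * g x - f y * g y = (f x - f y) * g x + f y * (g x - g y)" by (simp add: algebra_simps)
    also have "\<bar>\<dots>\<bar> \<le> \<bar>f x - f y\<bar> * \<bar>g x\<bar> + \<bar>f y\<bar> * \<bar>g x - g y\<bar>"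
      by (rule order_trans[OF abs_triangle_ineq]) (simp add: abs_mult)
    also have "\<dots> \<le> (C * \<delta>) * G + F * (D * \<delta>)"
      using fg F G C(1) D(1) xy by (intro add_mono mult_mono) (auto simp: near_def)
    finally show "\<bar>f x * g x - f y * g y\<bar> \<le> (C * G + F * D) * \<delta>" by (simp add: algebra_simps)
  qed (use C D F G in auto)
qed

lemma sphere_lipschitz_sum:
  "(\<And>v. v \<in> A \<Longrightarrow> sphere_lipschitz i (f v)) \<Longrightarrow> sphere_lipschitz i (\<lambda>x. \<Sum>v\<in>A. f v x)"
proof (induction A rule: infinite_finite_induct)
  case (insert v A)
  then have "sphere_lipschitz i (\<lambda>x. f v x + (\<Sum>v\<in>A. f v x))"
    by (intro sphere_lipschitz_add) simp_all
  then show ?case using insert.hyps by simp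
qed (simp_all add: sphere_lipschitz_const)

lemma sphere_lipschitz_cmult: "sphere_lipschitz i f \<Longrightarrow> sphere_lipschitz i (\<lambda>x. c * f x)"
proof -
  assume "sphere_lipschitz i f"
  then obtain C where C: "0 \<le> C" "\<And>x y \<delta>. near i \<delta> x y \<Longrightarrow> \<bar>f x - f y\<bar> \<le> C * \<delta>"
    by (rule sphere_lipschitzE) auto
  show ?thesis
  proof (rule sphere_lipschitzI[of "\<bar>c\<bar> * C"])
    fix x y \<delta> assume xy: "near i \<delta> x y"
    have "\<bar>c * f x - c * f y\<bar> = \<bar>c\<bar> * \<bar>f x - f y\<bar>" by (simp add: abs_mult flip: right_diff_distrib)
    also have "\<dots> \<le> \<bar>c\<bar> * (C * \<delta>)" using C(2)[OF xy] by (intro mult_left_mono) auto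
    finally show "\<bar>c * f x - c * f y\<bar> \<le> \<bar>c\<bar> * C * \<delta>" by (simp add: mult.assoc)
  qed (use C in auto)
qed

text \<open>The continuous Lipschitz functions form an algebra that contains the constants and, by
  the coordinate functions, separates points; so the Stone-Weierstrass theorem applies to
  it.\<close>

lemma sphere_lipschitz_approximation:
  assumes "continuous_map (nsphere i) euclideanreal f" "0 < e"
  shows "\<exists>g. continuous_map (nsphere i) euclideanreal g \<and> sphere_lipschitz i g \<and>
    (\<forall>x\<in>topspace (nsphere i). \<bar>f x - g x\<bar> < e)"
proof -
  let ?S = "topspace (nsphere i)"
  have iff: "continuous_map (nsphere i) euclideanreal g \<longleftrightarrow> continuous_on ?S g" for g :: "_ \<Rightarrow> real"
    by (subst nsphere_top_of_set) simp
  have "\<exists>g. (continuous_on ?S g \<and> sphere_lipschitz i g) \<and> (\<forall>x\<in>?S. \<bar>f x - g x\<bar> < e)"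
  proof (rule Stone_Weierstrass_HOL[where P = "\<lambda>g. continuous_on ?S g \<and> sphere_lipschitz i g", OF compact_nsphere])
    fix x y :: "nat \<Rightarrow> real" assume xy: "x \<in> ?S \<and> y \<in> ?S \<and> x \<noteq> y"
    then obtain j where "x j \<noteq> y j" by blast
    moreover have "continuous_on ?S (\<lambda>x. x j)"
      by (rule continuous_on_subset[OF continuous_on_product_coordinates]) simp
    ultimately show "\<exists>f. (continuous_on ?S f \<and> sphere_lipschitz i f) \<and> f x \<noteq> f y"
      using sphere_lipschitz_coord by (intro exI[of _ "\<lambda>x. x j"]) auto
  qed (use assms iff in \<open>auto intro!: sphere_lipschitz_const sphere_lipschitz_add sphere_lipschitz_mult continuous_intros\<close>)
  then show ?thesis using iff by blast
qed

text \<open>Coordinates have modulus at most 1, so squares are bounded by absolute values, and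
  \<open>i + 1\<close> of the latter below \<open>1 / (i + 1)\<close> are too small. The sharper
  bound with a square root would gain nothing here.\<close>

lemma sphere_large_coord:
  assumes "x \<in> topspace (nsphere i)"
  shows "\<exists>j\<le>i. 1 / (real i + 1) \<le> \<bar>x j\<bar>"
proof (rule ccontr)
  assume "\<not> ?thesis"
  then have "\<bar>x j\<bar> < 1 / (real i + 1)" if "j \<le> i" for j using that by (meson not_le)
  then have "(x j)\<^sup>2 < 1 / (real i + 1)" if "j \<le> i" for j
  proof -
    have a: "\<bar>x j\<bar> < 1 / (real i + 1)" using \<open>\<And>j. j \<le> i \<Longrightarrow> \<bar>x j\<bar> < 1 / (real i + 1)\<close> that .
    have "(x j)\<^sup>2 = \<bar>x j\<bar> * \<bar>x j\<bar>" by (simp add: power2_eq_square)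
    also have "\<dots> \<le> \<bar>x j\<bar> * 1" using nsphere_coord_le_1[OF assms] by (intro mult_left_mono) auto
    finally show ?thesis using a by simp
  qed
  then have "(\<Sum>j\<le>i. (x j)\<^sup>2) < (\<Sum>j\<le>i. 1 / (real i + 1))" by (intro sum_strict_mono) auto
  then show False using assms by (simp add: topspace_nsphere field_simps)
qed

text \<open>The sphere has box dimension at most \<open>i\<close>: a cell records a large coordinate, its sign, and
  the other coordinates up to \<open>1 / m\<close>.\<close>

lemma sphere_cells:
  fixes m :: nat
  assumes m: "0 < m"
  shows "\<exists>cell :: (nat \<Rightarrow> real) \<Rightarrow> nat \<times> bool \<times> (nat \<Rightarrow> int).
    finite (cell ` topspace (nsphere i)) \<and>
    card (cell ` topspace (nsphere i)) \<le> 2 * (i + 1) * 3 ^ i * m ^ i \<and>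
    (\<forall>x\<in>topspace (nsphere i). \<forall>y\<in>topspace (nsphere i). cell x = cell y \<longrightarrow>
      (\<forall>j\<le>i. \<bar>x j - y j\<bar> \<le> (real i + 1)\<^sup>2 / m))"
proof -
  let ?S = "topspace (nsphere i)"
  obtain c where c: "\<And>x. x \<in> ?S \<Longrightarrow> c x \<le> i \<and> 1 / (real i + 1) \<le> \<bar>x (c x)\<bar>"
    using sphere_large_coord[of _ i] by metis
  define cell where "cell x = (c x, 0 < x (c x), restrict (\<lambda>j. \<lfloor>m * x j\<rfloor>) ({..i} - {c x}))"
    for x :: "nat \<Rightarrow> real"
  define T where "T = (SIGMA j:{..i}. (UNIV :: bool set) \<times> (({..i} - {j}) \<rightarrow>\<^sub>E {- int m..int m}))"
  have "finite T" unfolding T_def by (intro finite_SigmaI finite_cartesian_product finite_PiE) auto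
  moreover have "cell ` ?S \<subseteq> T"
  proof (rule image_subsetI)
    fix x assume x: "x \<in> ?S"
    have "\<lfloor>m * x j\<rfloor> \<in> {- int m..int m}" for j
    proof -
      have "\<bar>m * x j\<bar> \<le> m" using nsphere_coord_le_1[OF x, of j] m by (simp add: abs_mult mult_left_le)
      then show ?thesis by (auto simp: le_floor_iff floor_le_iff)
    qed
    then show "cell x \<in> T" using c[OF x] by (auto simp: cell_def T_def)
  qed
  ultimately have fin: "finite (cell ` ?S)" and le: "card (cell ` ?S) \<le> card T"
    using finite_subset[of "cell ` ?S" T] card_mono[of T "cell ` ?S"] by blast+
  have cardT: "card T = 2 * (i + 1) * (2 * m + 1) ^ i"
  proof -
    have "card (({..i} - {j}) \<rightarrow>\<^sub>E {- int m..int m}) = (2 * m + 1) ^ i" if "j \<le> i" for j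
    proof -
      have "nat (int m - - int m + 1) = 2 * m + 1" by simp
      then show ?thesis using that by (simp add: card_PiE)
    qed
    then show ?thesis unfolding T_def by (subst card_SigmaI) (auto simp: finite_PiE card_cartesian_product)
  qed
  have bound: "2 * (i + 1) * (2 * m + 1) ^ i \<le> 2 * (i + 1) * 3 ^ i * m ^ i"
  proof -
    have "(2 * m + 1) ^ i \<le> (3 * m) ^ i" using m by (intro power_mono) auto
    then have "2 * (i + 1) * (2 * m + 1) ^ i \<le> 2 * (i + 1) * (3 ^ i * m ^ i)"
      unfolding power_mult_distrib by (rule mult_le_mono2)
    then show ?thesis by (simp only: mult.assoc)
  qed
  have close: "\<bar>x j - y j\<bar> \<le> (real i + 1)\<^sup>2 / m"
    if x: "x \<in> ?S" and y: "y \<in> ?S" and eq: "cell x = cell y" and j: "j \<le> i" for x y j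
  proof -
    have cc: "c y = c x" using eq by (simp add: cell_def)
    have sgn: "0 < x (c x) \<longleftrightarrow> 0 < y (c x)" using eq cc by (auto simp: cell_def)
    have near: "\<bar>x l - y l\<bar> \<le> 1 / m" if l: "l \<le> i" "l \<noteq> c x" for l
    proof -
      have "restrict (\<lambda>j. \<lfloor>m * x j\<rfloor>) ({..i} - {c x}) l = restrict (\<lambda>j. \<lfloor>m * y j\<rfloor>) ({..i} - {c x}) l"
        using eq cc by (simp add: cell_def)
      then have "\<lfloor>m * x l\<rfloor> = \<lfloor>m * y l\<rfloor>" using l by simp
      then have "\<bar>m * x l - m * y l\<bar> \<le> 1" by linarith
      then have "m * \<bar>x l - y l\<bar> \<le> 1" by (simp add: abs_mult flip: right_diff_distrib)
      then show ?thesis using m by (simp add: field_simps)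
    qed
    have dsq: "\<bar>a\<^sup>2 - b\<^sup>2\<bar> = \<bar>a + b\<bar> * \<bar>a - b\<bar>" for a b :: real
      by (simp add: power2_eq_square square_diff_square_factored abs_mult)
    show ?thesis
    proof (cases "j = c x")
      case False
      then have "\<bar>x j - y j\<bar> \<le> 1 / m" using near j by blast
      also have "\<dots> \<le> (real i + 1)\<^sup>2 / m" by (intro divide_right_mono) auto
      finally show ?thesis .
    next
      case True
      let ?R = "{..i} - {j}"
      \<comment> \<open>The recorded large coordinate is controlled through its square, which the
        other coordinates determine. To divide by \<open>x j + y j\<close>, note that both terms
        have the same sign and modulus at least \<open>1 / (i + 1)\<close>.\<close>
      have sq: "(x j)\<^sup>2 + (\<Sum>l\<in>?R. (x l)\<^sup>2) = 1" "(y j)\<^sup>2 + (\<Sum>l\<in>?R. (y l)\<^sup>2) = 1"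
        using x y j sum.remove[of "{..i}" j "\<lambda>l. (x l)\<^sup>2"] sum.remove[of "{..i}" j "\<lambda>l. (y l)\<^sup>2"]
        by (auto simp: topspace_nsphere)
      have "(y j)\<^sup>2 - (x j)\<^sup>2 = (\<Sum>l\<in>?R. (x l)\<^sup>2 - (y l)\<^sup>2)"
        using sq by (simp add: sum_subtractf)
      then have "\<bar>(x j)\<^sup>2 - (y j)\<^sup>2\<bar> = \<bar>\<Sum>l\<in>?R. (x l)\<^sup>2 - (y l)\<^sup>2\<bar>" by linarith
      also have "\<dots> \<le> (\<Sum>l\<in>?R. \<bar>(x l)\<^sup>2 - (y l)\<^sup>2\<bar>)" by (rule sum_abs)
      also have "\<dots> \<le> (\<Sum>l\<in>?R. 2 * (1 / m))"
      proof (rule sum_mono)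
        fix l assume l: "l \<in> ?R"
        have "\<bar>x l + y l\<bar> \<le> 2"
          using nsphere_coord_le_1[OF x, of l] nsphere_coord_le_1[OF y, of l] by linarith
        then show "\<bar>(x l)\<^sup>2 - (y l)\<^sup>2\<bar> \<le> 2 * (1 / m)"
          unfolding dsq using near[of l] l True by (intro mult_mono) auto
      qed
      also have "\<dots> = real i * 2 / m" using j by simp
      finally have b1: "\<bar>(x j)\<^sup>2 - (y j)\<^sup>2\<bar> \<le> real i * 2 / m" .
      have "2 / (real i + 1) \<le> \<bar>x j\<bar> + \<bar>y j\<bar>" using c[OF x] c[OF y] cc True by simp
      also have "\<dots> = \<bar>x j + y j\<bar>"
        using sgn True c[OF x] c[OF y] by (auto simp: abs_if)
      finally have b2: "2 / (real i + 1) \<le> \<bar>x j + y j\<bar>" .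
      have "\<bar>x j - y j\<bar> * (2 / (real i + 1)) \<le> \<bar>x j - y j\<bar> * \<bar>x j + y j\<bar>"
        using b2 by (intro mult_left_mono) auto
      also have "\<dots> = \<bar>(x j)\<^sup>2 - (y j)\<^sup>2\<bar>" unfolding dsq by (rule mult.commute)
      also have "\<dots> \<le> real i * 2 / m" by (rule b1)
      finally have "\<bar>x j - y j\<bar> \<le> real i * (real i + 1) / m" using m by (simp add: field_simps)
      also have "\<dots> \<le> (real i + 1)\<^sup>2 / m" by (intro divide_right_mono) (auto simp: power2_eq_square)
      finally show ?thesis .
    qed
  qed
  show ?thesis
  proof (intro exI[of _ cell] conjI ballI impI allI)
    show "card (cell ` ?S) \<le> 2 * (i + 1) * 3 ^ i * m ^ i" using le bound unfolding cardT by (rule le_trans)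
    show "finite (cell ` ?S)" by (rule fin)
  next
    fix x y j assume "x \<in> ?S" "y \<in> ?S" "cell x = cell y" "j \<le> i"
    then show "\<bar>x j - y j\<bar> \<le> (real i + 1)\<^sup>2 / m" by (rule close)
  qed
qed

text \<open>The constant is a natural number so that it can enter the number of grid
  subdivisions.\<close>

lemma uniform_lipschitz:
  assumes "finite A" "\<And>v. v \<in> A \<Longrightarrow> sphere_lipschitz i (N v)"
  shows "\<exists>C::nat. \<forall>v\<in>A. \<forall>x y \<delta>. near i \<delta> x y \<longrightarrow> \<bar>N v x - N v y\<bar> \<le> C * \<delta>"
  using assms
proof (induction A rule: finite_induct)
  case (insert v A)
  obtain C :: nat where C: "\<forall>u\<in>A. \<forall>x y \<delta>. near i \<delta> x y \<longrightarrow> \<bar>N u x - N u y\<bar> \<le> real C * \<delta>"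
    using insert.IH insert.prems by auto
  obtain D where D: "0 \<le> D" "\<And>x y \<delta>. near i \<delta> x y \<Longrightarrow> \<bar>N v x - N v y\<bar> \<le> D * \<delta>"
    by (rule sphere_lipschitzE[OF insert.prems[of v]]) auto
  obtain E :: nat where E: "real C \<le> E" "D \<le> E"
    using real_arch_simple[of "max (real C) D"] by auto
  have "\<bar>N u x - N u y\<bar> \<le> real E * \<delta>" if u: "u \<in> insert v A" and n: "near i \<delta> x y" for u x y \<delta>
  proof -
    have \<delta>: "0 \<le> \<delta>" using n by (simp add: near_def)
    show ?thesis
    proof (cases "u = v")
      case True
      have "D * \<delta> \<le> real E * \<delta>" using E \<delta> by (intro mult_right_mono) auto
      then show ?thesis using D(2)[OF n] True by simp
    next
      case False
      have "real C * \<delta> \<le> real E * \<delta>" using E \<delta> by (intro mult_right_mono) auto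
      moreover have "\<bar>N u x - N u y\<bar> \<le> real C * \<delta>" using C u False n by blast
      ultimately show ?thesis by simp
    qed
  qed
  then show ?case by blast
qed simp

text \<open>The \<open>m ^ (card A - 1)\<close> grid points of the simplex are too many for the \<open>O(m ^ i)\<close> cells
  of the sphere if each of the latter can reach only one of the former.\<close>

lemma lipschitz_image_misses_point:
  fixes N :: "'v \<Rightarrow> (nat \<Rightarrow> real) \<Rightarrow> real"
  assumes A: "finite A" "i + 2 \<le> card A"
    and lip: "\<And>v. v \<in> A \<Longrightarrow> sphere_lipschitz i (N v)"
  shows "\<exists>q. (\<forall>v\<in>A. 3 / (4 * card A) \<le> q v) \<and> (\<forall>v. v \<notin> A \<longrightarrow> q v = 0) \<and> (\<Sum>v\<in>A. q v) = 1 \<and>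
    (\<forall>x\<in>topspace (nsphere i). \<exists>v\<in>A. N v x \<noteq> q v)"
proof (rule ccontr)
  let ?S = "topspace (nsphere i)"
  assume contra: "\<not> ?thesis"
  define k where "k = card A"
  \<comment> \<open>The coordinate at \<open>v0\<close> makes up for the sum; the others range
    freely over a grid, and there are at least \<open>i + 1\<close> of them.\<close>
  obtain v0 where v0: "v0 \<in> A" using A by (cases "A = {}") auto
  define A' where "A' = A - {v0}"
  have A': "finite A'" "card A' = k - 1" "i + 1 \<le> card A'" using A v0 by (auto simp: A'_def k_def)
  have k: "2 \<le> k" using A by (simp add: k_def)
  obtain C :: nat where C: "\<And>v x y \<delta>. v \<in> A \<Longrightarrow> near i \<delta> x y \<Longrightarrow> \<bar>N v x - N v y\<bar> \<le> real C * \<delta>"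
    using uniform_lipschitz[OF A(1), of i N] lip by blast
  \<comment> \<open>\<open>M\<close> refines the sphere cells relative to the grid by a factor that
    beats the Lipschitz constant. Then \<open>m\<close> exceeds the factor
    \<open>2 * (i + 1) * 3 ^ i * M ^ i\<close> in the cell count, so that at least
    \<open>m ^ (i + 1)\<close> grid points outnumber the cells.\<close>
  define M where "M = 4 * k * (C * (i + 1)\<^sup>2 + 1)"
  define m where "m = 2 * (i + 1) * 3 ^ i * M ^ i + 1"
  have m: "0 < m" by (simp add: m_def)
  have M: "0 < M" using k by (simp add: M_def)
  obtain cell :: "(nat \<Rightarrow> real) \<Rightarrow> nat \<times> bool \<times> (nat \<Rightarrow> int)" where
    cell: "finite (cell ` ?S)" "card (cell ` ?S) \<le> 2 * (i + 1) * 3 ^ i * (M * m) ^ i"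
      "\<And>x y j. x \<in> ?S \<Longrightarrow> y \<in> ?S \<Longrightarrow> cell x = cell y \<Longrightarrow> j \<le> i \<Longrightarrow> \<bar>x j - y j\<bar> \<le> (real i + 1)\<^sup>2 / (M * m)"
    using sphere_cells[of "M * m" i] M m by (metis nat_0_less_mult_iff of_nat_mult)
  \<comment> \<open>Each coordinate on \<open>A'\<close> lies between \<open>3 / (4 * k)\<close> and
    \<open>1 / k\<close>, which leaves at least \<open>1 / k\<close> for \<open>v0\<close>; so the
    whole grid stays well inside the simplex.\<close>
  define q where "q s v = (if v \<in> A' then 3 / (4 * real k) + real (s v) / (4 * real k * real m)
      else if v = v0 then 1 - (\<Sum>u\<in>A'. 3 / (4 * real k) + real (s u) / (4 * real k * real m)) else 0)"
    for s :: "'v \<Rightarrow> nat" and v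
  let ?F = "A' \<rightarrow>\<^sub>E {..<m}"
  have v0A': "v0 \<notin> A'" and AA': "A = insert v0 A'" using v0 by (auto simp: A'_def)
  have "\<exists>x\<in>?S. \<forall>v\<in>A. N v x = q s v" if s: "s \<in> ?F" for s
  proof -
    have "(\<Sum>v\<in>A. q s v) = q s v0 + (\<Sum>v\<in>A'. q s v)" using A' v0A' AA' by simp
    also have "(\<Sum>v\<in>A'. q s v) = (\<Sum>u\<in>A'. 3 / (4 * real k) + real (s u) / (4 * real k * real m))"
      by (rule sum.cong) (auto simp: q_def)
    also have "q s v0 + \<dots> = 1" using v0A' by (simp add: q_def)
    finally have sum: "(\<Sum>v\<in>A. q s v) = 1" .
    have "(\<Sum>u\<in>A'. 3 / (4 * real k) + real (s u) / (4 * real k * real m)) \<le>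
        (\<Sum>u\<in>A'. 3 / (4 * real k) + 1 / (4 * real k))"
    proof (intro sum_mono add_left_mono)
      fix u assume "u \<in> A'"
      then have "real (s u) \<le> real m" using s by (auto simp: PiE_iff less_imp_le)
      then have "real (s u) / (4 * real k * real m) \<le> real m / (4 * real k * real m)"
        by (rule divide_right_mono) simp
      also have "\<dots> = 1 / (4 * real k)" using m by simp
      finally show "real (s u) / (4 * real k * real m) \<le> 1 / (4 * real k)" .
    qed
    also have "\<dots> = real (k - 1) / real k" using A' by simp
    also have "\<dots> = 1 - 1 / real k" using k by (simp add: field_simps of_nat_diff)
    finally have "1 / real k \<le> q s v0" using v0A' by (simp add: q_def)
    moreover have "3 / (4 * real k) \<le> 1 / real k" using k by (simp add: field_simps)
    ultimately have v0: "3 / (4 * real k) \<le> q s v0" by linarith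
    have ge: "\<forall>v\<in>A. 3 / (4 * card A) \<le> q s v"
    proof
      fix v assume "v \<in> A"
      then show "3 / (4 * card A) \<le> q s v"
        using v0 AA' unfolding k_def[symmetric] by (cases "v = v0") (simp_all add: q_def)
    qed
    have zero: "\<forall>v. v \<notin> A \<longrightarrow> q s v = 0" using AA' by (simp add: q_def)
    have "\<not> (\<forall>x\<in>?S. \<exists>v\<in>A. N v x \<noteq> q s v)"
      using contra[unfolded not_ex, THEN spec, of "q s"] ge zero sum by argo
    then show ?thesis by blast
  qed
  then obtain X where "\<forall>s\<in>?F. X s \<in> ?S \<and> (\<forall>v\<in>A. N v (X s) = q s v)"
    using bchoice[of ?F "\<lambda>s x. x \<in> ?S \<and> (\<forall>v\<in>A. N v x = q s v)"] by blast
  then have X: "\<And>s. s \<in> ?F \<Longrightarrow> X s \<in> ?S" "\<And>s v. s \<in> ?F \<Longrightarrow> v \<in> A \<Longrightarrow> N v (X s) = q s v"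
    by blast+
  \<comment> \<open>Two grid points reached from one cell would differ in a coordinate by at least
    the spacing \<open>1 / (4 * k * m)\<close>, yet by at most
    \<open>C * (i + 1)^2 / (M * m)\<close>, which is smaller by the choice of
    \<open>M\<close>.\<close>
  have "inj_on (cell \<circ> X) ?F"
  proof (rule inj_onI, rule ccontr)
    fix s t assume s: "s \<in> ?F" and t: "t \<in> ?F" and eq: "(cell \<circ> X) s = (cell \<circ> X) t" and ne: "s \<noteq> t"
    obtain v where v: "v \<in> A'" "s v \<noteq> t v" using ne PiE_ext[OF s t] by blast
    have vA: "v \<in> A" using v AA' by simp
    define \<delta> where "\<delta> = (real i + 1)\<^sup>2 / (M * m)"
    have "near i \<delta> (X s) (X t)"
      unfolding near_def \<delta>_def using X(1)[OF s] X(1)[OF t] eq cell(3)[of "X s" "X t"] by auto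
    then have "\<bar>q s v - q t v\<bar> \<le> C * \<delta>" using C[OF vA] X(2)[OF s vA] X(2)[OF t vA] by force
    moreover have "q s v - q t v = (real (s v) - real (t v)) / (4 * real k * real m)"
      using v by (simp add: q_def diff_divide_distrib)
    ultimately have le: "\<bar>real (s v) - real (t v)\<bar> / (4 * real k * real m) \<le> C * \<delta>"
      using k m by (simp add: abs_mult)
    have "1 \<le> \<bar>real (s v) - real (t v)\<bar>" using v(2) by linarith
    then have "1 / (4 * real k * real m) \<le> \<bar>real (s v) - real (t v)\<bar> / (4 * real k * real m)"
      by (rule divide_right_mono) simp
    then have "1 / (4 * real k * real m) \<le> C * \<delta>" using le by (rule order_trans)
    then have "1 * (M * m) \<le> C * (real i + 1)\<^sup>2 * (4 * real k * real m)"
      unfolding \<delta>_def using k m M by (simp add: field_simps)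
    then have "real M \<le> C * (real i + 1)\<^sup>2 * (4 * real k)" using m by simp
    moreover have "real M = 4 * real k * (C * (real i + 1)\<^sup>2 + 1)" by (simp add: M_def distrib_left add.commute)
    ultimately show False using k by (simp add: algebra_simps)
  qed
  moreover have "(cell \<circ> X) ` ?F \<subseteq> cell ` ?S" using X(1) by auto
  ultimately have "card ?F \<le> card (cell ` ?S)" using cell(1) by (rule card_inj_on_le)
  also have "\<dots> \<le> 2 * (i + 1) * 3 ^ i * (M * m) ^ i" by (rule cell)
  also have "\<dots> = (m - 1) * m ^ i"
  proof -
    have "m - 1 = 2 * (i + 1) * 3 ^ i * M ^ i" by (simp add: m_def)
    then show ?thesis by (simp only: power_mult_distrib mult.assoc)
  qed
  also have "\<dots> < m * m ^ i" using m by simp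
  also have "\<dots> \<le> m ^ card A'" using power_increasing[OF A'(3), of m] m by simp
  also have "\<dots> = card ?F" using A' by (simp add: card_PiE)
  finally show False by simp
qed

section \<open>Pushing sphere maps off an attached simplex\<close>

lemma attached_maximal:
  assumes "face_closed L" "\<sigma> \<notin> L" "A \<in> insert \<sigma> L" "\<sigma> \<subseteq> A"
  shows "A = \<sigma>"
  using assms face_closed_subset by blast

text \<open>Radial projection of a simplex without the point \<open>q\<close> onto its boundary: the ray from \<open>q\<close>
  through \<open>y\<close> leaves the simplex at parameter \<open>1 / m\<close>.\<close>

lemma radial_projection:
  assumes fc: "face_closed L" and \<sigma>: "finite \<sigma>" "\<sigma> \<noteq> {}" "\<sigma> \<notin> L"
    and faces: "\<And>B. B \<subset> \<sigma> \<Longrightarrow> B \<in> L"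
    and q: "\<And>v. v \<in> \<sigma> \<Longrightarrow> 0 < q v" "\<And>v. v \<notin> \<sigma> \<Longrightarrow> q v = 0" "(\<Sum>v\<in>\<sigma>. q v) = 1"
    and f: "continuous_map X (geometric_realization (insert \<sigma> L)) f" "\<And>x. x \<in> topspace X \<Longrightarrow> f x \<noteq> q"
  shows "\<exists>g. continuous_map X (geometric_realization L) g \<and>
    homotopic_with (\<lambda>_. True) X (geometric_realization (insert \<sigma> L)) f g"
proof -
  let ?M = "insert \<sigma> L"
  have fcM: "face_closed ?M" by (rule face_closed_attach[OF fc \<sigma>(1) faces])
  \<comment> \<open>Coordinate \<open>v\<close> of \<open>q + s * (y - q)\<close> vanishes at
    \<open>s = 1 / (1 - y v / q v)\<close>; the first positive such \<open>s\<close> belongs to the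
    smallest quotient \<open>y v / q v\<close>.\<close>
  define m where "m y = 1 - Min ((\<lambda>v. y v / q v) ` \<sigma>)" for y
  define \<rho> where "\<rho> y v = q v + (y v - q v) / m y" for y v
  have m_ge: "1 - y v / q v \<le> m y" if "v \<in> \<sigma>" for y v
    using \<sigma> that by (simp add: m_def)
  have m_eq: "\<exists>v\<in>\<sigma>. m y = 1 - y v / q v" for y
  proof -
    have "Min ((\<lambda>v. y v / q v) ` \<sigma>) \<in> (\<lambda>v. y v / q v) ` \<sigma>" using \<sigma> by (intro Min_in) auto
    then show ?thesis by (auto simp: m_def)
  qed
  have full: "supp y = \<sigma>" if "y \<in> topspace (geometric_realization ?M)" "\<And>v. v \<in> \<sigma> \<Longrightarrow> y v \<noteq> 0" for y
    using attached_maximal[OF fc \<sigma>(3) realization_supp[OF that(1)]] that(2) by (auto simp: supp_def)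
  have m_pos: "0 < m y" if y: "y \<in> topspace (geometric_realization ?M)" "y \<noteq> q" for y
  proof (rule ccontr)
    assume "\<not> 0 < m y"
    then have quot: "1 \<le> y v / q v" if "v \<in> \<sigma>" for v using m_ge[OF that, of y] by linarith
    have ge: "q v \<le> y v" if "v \<in> \<sigma>" for v using q(1)[OF that] quot[OF that] by (simp add: field_simps)
    have "y v \<noteq> 0" if "v \<in> \<sigma>" for v using ge[OF that] q(1)[OF that] by simp
    then have s: "supp y = \<sigma>" by (rule full[OF y(1)])
    then have "(\<Sum>v\<in>\<sigma>. y v - q v) = 0"
      using realization_sum[OF y(1), of \<sigma>] \<sigma>(1) q(3) by (simp add: sum_subtractf)
    then have "\<forall>v\<in>\<sigma>. y v - q v = 0" using ge \<sigma>(1) by (subst (asm) sum_nonneg_eq_0_iff) auto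
    then have "y v = q v" for v using s q(2)[of v] by (cases "v \<in> \<sigma>") (auto simp: supp_def)
    then show False using y(2) by auto
  qed
  have \<rho>: "\<rho> y \<in> topspace (geometric_realization L) \<and> (\<exists>A\<in>?M. supp y \<subseteq> A \<and> supp (\<rho> y) \<subseteq> A)"
    if y: "y \<in> topspace (geometric_realization ?M)" "y \<noteq> q" for y
  proof -
    have m: "0 < m y" using m_pos[OF y] .
    obtain w where w: "w \<in> \<sigma>" "m y = 1 - y w / q w" using m_eq by blast
    show ?thesis
    proof (cases "supp y = \<sigma>")
      \<comment> \<open>Off the open simplex some coordinate in \<open>\<sigma>\<close> is 0, so the
        smallest quotient is 0, \<open>m y = 1\<close>, and \<open>\<rho>\<close> fixes
        \<open>y\<close>.\<close>
      case False
      then obtain u where u: "u \<in> \<sigma>" "y u = 0" using full[OF y(1)] by blast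
      have "1 \<le> m y" using m_ge[OF u(1), of y] u(2) by simp
      moreover have "0 \<le> y w / q w" using q(1)[OF w(1)] realization_nonneg[OF y(1)] by simp
      ultimately have "m y = 1" using w(2) by linarith
      then have "\<rho> y = y" by (auto simp: \<rho>_def)
      moreover have "y \<in> topspace (geometric_realization L)"
        using y(1) False by (auto simp: in_realization_iff)
      ultimately show ?thesis using realization_supp[OF y(1)] by auto
    next
      case True
      have "y w - q w = - (m y * q w)" using w(2) q(1)[OF w(1)] by (simp add: field_simps)
      then have \<rho>w: "\<rho> y w = 0" using m by (simp add: \<rho>_def)
      have out: "\<rho> y v = 0" if "v \<notin> \<sigma>" for v using that True q(2) by (auto simp: \<rho>_def supp_def)
      have sub: "supp (\<rho> y) \<subseteq> \<sigma> - {w}" using \<rho>w out by (auto simp: supp_def)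
      have nonneg: "0 \<le> \<rho> y v" for v
      proof (cases "v \<in> \<sigma>")
        case v: True
        have "q v * (1 - y v / q v) \<le> q v * m y"
          using m_ge[OF v, of y] q(1)[OF v] by (intro mult_left_mono) auto
        moreover have "q v * (1 - y v / q v) = q v - y v"
          using q(1)[OF v] by (simp add: right_diff_distrib)
        ultimately have "0 \<le> q v * m y + (y v - q v)" by linarith
        then have "0 \<le> (q v * m y + (y v - q v)) / m y" using m by simp
        then show ?thesis using m by (simp add: \<rho>_def add_divide_distrib)
      qed (simp add: out)
      have "(\<Sum>v\<in>\<sigma> - {w}. \<rho> y v) = (\<Sum>v\<in>\<sigma>. \<rho> y v)"
        using \<sigma>(1) \<rho>w by (intro sum.mono_neutral_left) auto
      also have "\<dots> = (\<Sum>v\<in>\<sigma>. q v) + ((\<Sum>v\<in>\<sigma>. y v) - (\<Sum>v\<in>\<sigma>. q v)) / m y"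
        by (simp add: \<rho>_def sum.distrib sum_subtractf sum_divide_distrib[symmetric])
      also have "\<dots> = 1" using q(3) realization_sum[OF y(1), of \<sigma>] True \<sigma>(1) by simp
      finally have "\<rho> y \<in> topspace (geometric_realization L)"
        using w(1) by (intro in_realizationI[OF fc faces[of "\<sigma> - {w}"] nonneg sub]) auto
      then show ?thesis using sub True by auto
    qed
  qed
  have fM: "f x \<in> topspace (geometric_realization ?M)" if "x \<in> topspace X" for x
    using f(1) that by (simp add: continuous_map_realization)
  have "continuous_map X euclideanreal (\<lambda>x. m (f x))"
    unfolding m_def using q(1)
    by (intro continuous_intros continuous_map_Min \<sigma> continuous_map_realization_coord[OF f(1)]) force
  then have "continuous_map X euclideanreal (\<lambda>x. \<rho> (f x) v)" for v
    unfolding \<rho>_def using m_pos[OF fM f(2)]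
    by (intro continuous_intros continuous_map_realization_coord[OF f(1)]) force+
  then have g: "continuous_map X (geometric_realization L) (\<lambda>x. \<rho> (f x))"
    using \<rho>[OF fM f(2)] by (simp add: continuous_map_realization)
  have "homotopic_with (\<lambda>_. True) X (geometric_realization ?M) f (\<lambda>x. \<rho> (f x))"
  proof (rule homotopic_straight_line[OF fcM f(1)])
    show "continuous_map X (geometric_realization ?M) (\<lambda>x. \<rho> (f x))"
      by (rule continuous_map_realization_mono[OF _ g]) auto
  qed (use \<rho>[OF fM f(2)] in blast)
  then show ?thesis using g by blast
qed

text \<open>Approximating \<open>f\<close> everywhere would leave the realization, so
  \<open>\<theta>\<close> fades from \<open>f\<close>, where the least coordinate on
  \<open>\<sigma>\<close> is at most \<open>a\<close>, to the Lipschitz map \<open>N\<close>, where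
  it is at least \<open>2 * a\<close>. The missed point \<open>q\<close> has all coordinates at
  least \<open>3 * a\<close>. Where \<open>\<theta> x < 1\<close>, some coordinate of
  \<open>f' x\<close> is below \<open>3 * a\<close>; where \<open>\<theta> x = 1\<close>, the
  coordinates on \<open>\<sigma>\<close> are those of \<open>N\<close>, which misses
  \<open>q\<close>.\<close>

lemma sphere_map_off_attached_simplex:
  assumes fc: "face_closed L" and \<sigma>: "finite \<sigma>" "i + 2 \<le> card \<sigma>" "\<sigma> \<notin> L"
    and faces: "\<And>B. B \<subset> \<sigma> \<Longrightarrow> B \<in> L"
    and f: "continuous_map (nsphere i) (geometric_realization (insert \<sigma> L)) f"
  shows "\<exists>g. continuous_map (nsphere i) (geometric_realization L) g \<and>
    homotopic_with (\<lambda>_. True) (nsphere i) (geometric_realization (insert \<sigma> L)) f g"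
proof -
  let ?M = "insert \<sigma> L" and ?S = "topspace (nsphere i)"
  have fcM: "face_closed ?M" by (rule face_closed_attach[OF fc \<sigma>(1) faces])
  have ne: "\<sigma> \<noteq> {}" using \<sigma>(2) by auto
  define k where "k = real (card \<sigma>)"
  \<comment> \<open>This turns the lower bound \<open>3 / (4 * card \<sigma>)\<close> on the missed
    point into \<open>3 * a\<close>.\<close>
  define a where "a = 1 / (4 * k)"
  have k: "0 < k" using \<sigma>(2) by (simp add: k_def)
  then have a: "0 < a" by (simp add: a_def)
  have fcoord: "continuous_map (nsphere i) euclideanreal (\<lambda>x. f x v)" for v
    by (rule continuous_map_realization_coord[OF f])
  \<comment> \<open>An error below \<open>a / 4\<close> leaves room for the correction of the sum,
    which costs at most another \<open>a / 4\<close>; then \<open>N\<close> is within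
    \<open>a / 2\<close> of \<open>f\<close> and nonnegative where all coordinates of
    \<open>f\<close> exceed \<open>a\<close>.\<close>
  have "\<forall>v. \<exists>g. continuous_map (nsphere i) euclideanreal g \<and> sphere_lipschitz i g \<and>
    (\<forall>x\<in>?S. \<bar>f x v - g x\<bar> < a / 4)"
    using sphere_lipschitz_approximation[OF fcoord, of "a / 4"] a by simp
  then obtain G where "\<forall>v. continuous_map (nsphere i) euclideanreal (G v) \<and> sphere_lipschitz i (G v) \<and>
    (\<forall>x\<in>?S. \<bar>f x v - G v x\<bar> < a / 4)"
    by (rule choice[THEN exE])
  then have G: "continuous_map (nsphere i) euclideanreal (G v)" "sphere_lipschitz i (G v)"
    "x \<in> ?S \<Longrightarrow> \<bar>f x v - G v x\<bar> < a / 4" for v x by blast+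
  \<comment> \<open>The defect of the coordinate sum is spread equally over \<open>\<sigma>\<close>,
    so that the coordinates of \<open>N\<close> sum to 1. Writing the difference with the factor
    \<open>- 1\<close> lets the closure rules for Lipschitz functions apply.\<close>
  define N where "N v x = G v x + (1 / k) * (1 + (- 1) * (\<Sum>u\<in>\<sigma>. G u x))" for v x
  have Ncont: "continuous_map (nsphere i) euclideanreal (N v)" for v
    unfolding N_def by (intro continuous_intros G(1) \<sigma>(1)) auto
  have Nlip: "sphere_lipschitz i (N v)" for v
    unfolding N_def
    by (intro sphere_lipschitz_add sphere_lipschitz_cmult sphere_lipschitz_const sphere_lipschitz_sum G(2))
  obtain q where q: "\<forall>v\<in>\<sigma>. 3 / (4 * card \<sigma>) \<le> q v" "\<forall>v. v \<notin> \<sigma> \<longrightarrow> q v = 0" "(\<Sum>v\<in>\<sigma>. q v) = 1"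
    and miss: "\<forall>x\<in>?S. \<exists>v\<in>\<sigma>. N v x \<noteq> q v"
    using lipschitz_image_misses_point[OF \<sigma>(1,2), of N] Nlip by blast
  have q3: "3 * a \<le> q v" if "v \<in> \<sigma>" for v using q(1) that by (simp add: a_def k_def)
  define \<mu> where "\<mu> x = Min ((\<lambda>v. f x v) ` \<sigma>)" for x
  define \<theta> where "\<theta> x = max 0 (min 1 ((\<mu> x - a) / a))" for x
  define f' where "f' x v = (1 - \<theta> x) * f x v + \<theta> x * (if v \<in> \<sigma> then N v x else 0)" for x v
  have fM: "f x \<in> topspace (geometric_realization ?M)" if "x \<in> ?S" for x
    using f that by (simp add: continuous_map_realization)
  have \<theta>01: "0 \<le> \<theta> x" "\<theta> x \<le> 1" for x by (auto simp: \<theta>_def)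
  have \<mu>_le: "\<mu> x \<le> f x v" if "v \<in> \<sigma>" for x v using that \<sigma>(1) by (simp add: \<mu>_def)
  have inside: "supp (f x) = \<sigma> \<and> (\<Sum>v\<in>\<sigma>. N v x) = 1 \<and> (\<forall>v\<in>\<sigma>. \<bar>N v x - f x v\<bar> < a / 2 \<and> a < f x v)"
    if x: "x \<in> ?S" and \<theta>: "\<theta> x \<noteq> 0" for x
  proof -
    have "\<mu> x > a" using \<theta> a by (auto simp: \<theta>_def max_def min_def divide_simps split: if_splits)
    then have pos: "a < f x v" if "v \<in> \<sigma>" for v using \<mu>_le[OF that, of x] by simp
    then have "\<sigma> \<subseteq> supp (f x)" using a by (force simp: supp_def)
    then have s: "supp (f x) = \<sigma>"
      by (rule attached_maximal[OF fc \<sigma>(3) realization_supp[OF fM[OF x]]])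
    then have f1: "(\<Sum>v\<in>\<sigma>. f x v) = 1" using realization_sum[OF fM[OF x], of \<sigma>] \<sigma>(1) by simp
    have N1: "(\<Sum>v\<in>\<sigma>. N v x) = 1"
      using k by (simp add: N_def sum.distrib flip: k_def)
    have "\<bar>1 - (\<Sum>u\<in>\<sigma>. G u x)\<bar> = \<bar>\<Sum>u\<in>\<sigma>. f x u - G u x\<bar>" using f1 by (simp add: sum_subtractf)
    also have "\<dots> \<le> (\<Sum>u\<in>\<sigma>. \<bar>f x u - G u x\<bar>)" by (rule sum_abs)
    also have "\<dots> \<le> (\<Sum>u\<in>\<sigma>. a / 4)" using G(3)[OF x] by (intro sum_mono) (simp add: less_imp_le)
    also have "\<dots> = k * (a / 4)" by (simp add: k_def)
    finally have "\<bar>1 - (\<Sum>u\<in>\<sigma>. G u x)\<bar> / k \<le> a / 4" using k by (simp add: field_simps)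
    then have err: "\<bar>(1 - (\<Sum>u\<in>\<sigma>. G u x)) / k\<bar> \<le> a / 4" using k by simp
    have "\<bar>N v x - f x v\<bar> < a / 2" for v
    proof -
      have "N v x - f x v = - (f x v - G v x) + (1 - (\<Sum>u\<in>\<sigma>. G u x)) / k" by (simp add: N_def)
      then show ?thesis using err G(3)[OF x, of v] by linarith
    qed
    then show ?thesis using s N1 pos by blast
  qed
  have f'0: "f' x = f x" if "\<theta> x = 0" for x using that by (auto simp: f'_def)
  have f'M: "f' x \<in> topspace (geometric_realization ?M) \<and> (\<exists>A\<in>?M. supp (f x) \<subseteq> A \<and> supp (f' x) \<subseteq> A)"
    if x: "x \<in> ?S" for x
  proof (cases "\<theta> x = 0")
    case True
    then show ?thesis using f'0[OF True] fM[OF x] realization_supp[OF fM[OF x]] by auto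
  next
    case False
    note ins = inside[OF x False]
    have sub: "supp (f' x) \<subseteq> \<sigma>" using ins by (auto simp: f'_def supp_def)
    have "0 \<le> f' x v" for v
    proof (cases "v \<in> \<sigma>")
      case True
      then have "\<bar>N v x - f x v\<bar> < a / 2" "a < f x v" using ins by auto
      then have "0 \<le> N v x" "0 \<le> f x v" using a by linarith+
      then show ?thesis using \<theta>01[of x] True by (simp add: f'_def)
    next
      case False
      then have "f' x v = 0" using sub unfolding supp_def by blast
      then show ?thesis by simp
    qed
    moreover have "(\<Sum>v\<in>\<sigma>. f' x v) = (1 - \<theta> x) * (\<Sum>v\<in>\<sigma>. f x v) + \<theta> x * (\<Sum>v\<in>\<sigma>. N v x)"
      by (simp add: f'_def sum.distrib sum_distrib_left)
    then have "(\<Sum>v\<in>\<sigma>. f' x v) = 1"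
      using ins realization_sum[OF fM[OF x], of \<sigma>] \<sigma>(1) by simp
    ultimately have "f' x \<in> topspace (geometric_realization ?M)"
      using sub by (intro in_realizationI[OF fcM, of \<sigma>]) auto
    then show ?thesis using sub ins by auto
  qed
  have "continuous_map (nsphere i) euclideanreal \<mu>"
    unfolding \<mu>_def by (intro continuous_map_Min \<sigma>(1) ne fcoord)
  then have "continuous_map (nsphere i) euclideanreal \<theta>"
    unfolding \<theta>_def using a by (intro continuous_intros) auto
  then have "continuous_map (nsphere i) euclideanreal (\<lambda>x. f' x v)" for v
    unfolding f'_def by (cases "v \<in> \<sigma>") (simp_all, (intro continuous_intros fcoord Ncont; assumption)+)
  then have contf': "continuous_map (nsphere i) (geometric_realization ?M) f'"
    using f'M by (simp add: continuous_map_realization)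
  have hom: "homotopic_with (\<lambda>_. True) (nsphere i) (geometric_realization ?M) f f'"
    by (rule homotopic_straight_line[OF fcM f contf']) (use f'M in blast)
  have "f' x \<noteq> q" if x: "x \<in> ?S" for x
  proof (cases "\<theta> x = 1")
    case True
    obtain v where "v \<in> \<sigma>" "N v x \<noteq> q v" using miss x by blast
    then have "f' x v \<noteq> q v" using True by (simp add: f'_def)
    then show ?thesis by auto
  next
    case False
    have \<mu>2: "\<mu> x < 2 * a" using False a by (auto simp: \<theta>_def max_def min_def divide_simps split: if_splits)
    have "\<mu> x \<in> (\<lambda>v. f x v) ` \<sigma>" unfolding \<mu>_def using \<sigma>(1) ne by (intro Min_in) auto
    then obtain v where v: "v \<in> \<sigma>" "f x v < 2 * a" using \<mu>2 by auto
    have "f' x v < 3 * a"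
    proof (cases "\<theta> x = 0")
      case True
      then show ?thesis using f'0 v a by simp
    next
      case False
      have "\<bar>N v x - f x v\<bar> < a / 2" using inside[OF x False] v(1) by blast
      then have "N v x < 2 * a + a / 2" using v(2) by linarith
      then have "\<theta> x * N v x \<le> \<theta> x * (2 * a + a / 2)" using \<theta>01[of x] by (intro mult_left_mono) auto
      moreover have "(1 - \<theta> x) * f x v \<le> (1 - \<theta> x) * (2 * a + a / 2)"
        using \<theta>01[of x] v a by (intro mult_left_mono) auto
      ultimately have "f' x v \<le> (1 - \<theta> x) * (2 * a + a / 2) + \<theta> x * (2 * a + a / 2)"
        using v by (simp add: f'_def)
      also have "\<dots> = 2 * a + a / 2" by (simp only: left_diff_distrib diff_add_cancel mult_1)
      finally show ?thesis using a by simp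
    qed
    then have "f' x v \<noteq> q v" using q3[OF v(1)] by simp
    then show ?thesis by auto
  qed
  moreover have "0 < q v" if "v \<in> \<sigma>" for v using q3[OF that] a by simp
  ultimately obtain g where "continuous_map (nsphere i) (geometric_realization L) g"
    "homotopic_with (\<lambda>_. True) (nsphere i) (geometric_realization ?M) f' g"
    using radial_projection[OF fc \<sigma>(1) ne \<sigma>(3) faces, of q "nsphere i" f'] q(2,3) contf' by blast
  then show ?thesis using homotopic_with_trans[OF hom] by blast
qed

section \<open>Connectivity of complexes built with large cells only\<close>

lemma homotopic_realization_mono:
  assumes "L \<subseteq> M" "homotopic_with (\<lambda>_. True) X (geometric_realization L) f g"
  shows "homotopic_with (\<lambda>_. True) X (geometric_realization M) f g"
  using homotopic_with_compose_continuous_map_left[OF assms(2)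
      continuous_map_realization_incl[OF assms(1)], of "\<lambda>_. True"] by simp

text \<open>The construction is undone for the map: a retraction undoes an expansion, and an
  attached simplex has dimension greater than \<open>i\<close>, so the map can be pushed off it.
  What remains is a map to a point.\<close>

lemma morse_built_null_homotopic:
  assumes "morse_built c L" "L \<noteq> {}" "i + 2 \<le> c" "continuous_map (nsphere i) (geometric_realization L) f"
  shows "\<exists>a\<in>topspace (geometric_realization L).
    homotopic_with (\<lambda>_. True) (nsphere i) (geometric_realization L) f (\<lambda>_. a)"
  using assms
proof (induction arbitrary: f rule: morse_built.induct)
  case (expand L \<sigma> v)
  let ?M = "insert \<sigma> (insert (insert v \<sigma>) L)"
  have fc: "face_closed L" using expand.hyps(1) by (rule morse_built_face_closed)
  show ?case
  proof (cases "\<sigma> = {}")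
    case True
    then have L: "L = {}" using face_closed_without_empty[OF fc] expand.hyps by blast
    define a where "a = (\<lambda>u. if u = v then 1 else 0 :: real)"
    have a: "a \<in> topspace (geometric_realization ?M)"
      unfolding a_def using True by (intro realization_vertex) auto
    have fc: "face_closed ?M" unfolding True L by (auto simp: face_closed_def)
    have "homotopic_with (\<lambda>_. True) (nsphere i) (geometric_realization ?M) f (\<lambda>_. a)"
    proof (rule homotopic_straight_line[OF fc expand.prems(3)])
      show "continuous_map (nsphere i) (geometric_realization ?M) (\<lambda>_. a)" using a by simp
      fix x assume "x \<in> topspace (nsphere i)"
      then have "f x \<in> topspace (geometric_realization ?M)"
        using expand.prems(3) by (simp add: continuous_map_realization)
      then have "supp (f x) \<in> ?M" by (rule realization_supp)
      then show "\<exists>A\<in>?M. supp (f x) \<subseteq> A \<and> supp a \<subseteq> A"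
        using realization_supp[OF a] unfolding True L by auto
    qed
    then show ?thesis using a by blast
  next
    case False
    obtain \<rho> where \<rho>: "continuous_map (geometric_realization ?M) (geometric_realization L) \<rho>"
      "homotopic_with (\<lambda>_. True) (geometric_realization ?M) (geometric_realization ?M) id \<rho>"
      using expansion_retraction[OF fc expand.hyps(2) False expand.hyps(3-5)] by blast
    have "{} \<in> L" using expand.hyps(5)[of "{}"] False by blast
    then have "L \<noteq> {}" by blast
    moreover have "continuous_map (nsphere i) (geometric_realization L) (\<rho> \<circ> f)"
      by (rule continuous_map_compose[OF expand.prems(3) \<rho>(1)])
    ultimately obtain a where a: "a \<in> topspace (geometric_realization L)"
      "homotopic_with (\<lambda>_. True) (nsphere i) (geometric_realization L) (\<rho> \<circ> f) (\<lambda>_. a)"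
      using expand.IH expand.prems(2) by blast
    have sub: "L \<subseteq> ?M" by blast
    have "homotopic_with (\<lambda>_. True) (nsphere i) (geometric_realization ?M) (id \<circ> f) (\<rho> \<circ> f)"
      by (rule homotopic_with_compose_continuous_map_right[OF \<rho>(2) expand.prems(3)]) simp
    then have "homotopic_with (\<lambda>_. True) (nsphere i) (geometric_realization ?M) f (\<lambda>_. a)"
      using homotopic_with_trans[OF _ homotopic_realization_mono[OF sub a(2)]] by simp
    then show ?thesis using a(1) realization_mono[OF sub] by blast
  qed
next
  case (attach L \<sigma>)
  have fc: "face_closed L" using attach.hyps(1) by (rule morse_built_face_closed)
  have card: "i + 2 \<le> card \<sigma>" using attach by linarith
  then have "\<sigma> \<noteq> {}" by auto
  then have "L \<noteq> {}" using attach.hyps(5)[of "{}"] by blast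
  moreover obtain g where g: "continuous_map (nsphere i) (geometric_realization L) g"
    "homotopic_with (\<lambda>_. True) (nsphere i) (geometric_realization (insert \<sigma> L)) f g"
    using sphere_map_off_attached_simplex[OF fc attach.hyps(2) card attach.hyps(4,5) attach.prems(3)] by blast
  ultimately obtain a where a: "a \<in> topspace (geometric_realization L)"
    "homotopic_with (\<lambda>_. True) (nsphere i) (geometric_realization L) g (\<lambda>_. a)"
    using attach.IH attach.prems(2) by blast
  have sub: "L \<subseteq> insert \<sigma> L" by blast
  show ?case
    using homotopic_with_trans[OF g(2) homotopic_realization_mono[OF sub a(2)]] a(1)
      realization_mono[OF sub] by blast
qed simp

lemma realization_nonempty:
  assumes "face_closed L" "A \<in> L" "A \<noteq> {}"
  shows "topspace (geometric_realization L) \<noteq> {}"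
proof -
  obtain v where "v \<in> A" using assms(3) by blast
  then have "{v} \<in> L" using face_closed_subset[OF assms(1,2)] by blast
  then show ?thesis using realization_vertex[of v L] by auto
qed

text \<open>Excludes the complex \<open>{{}}\<close>, whose realization is empty: for
  \<open>1 \<le> c\<close> the empty simplex cannot be attached, so it enters together with a
  vertex.\<close>

lemma morse_built_nonempty:
  assumes "morse_built c L" "1 \<le> c" "L \<noteq> {}"
  shows "\<exists>A\<in>L. A \<noteq> {}"
  using assms
proof (induction rule: morse_built.induct)
  case (expand L \<sigma> v)
  have "insert v \<sigma> \<in> insert \<sigma> (insert (insert v \<sigma>) L)" by simp
  then show ?case by blast
next
  case (attach L \<sigma>)
  have "\<sigma> \<noteq> {}" using attach.hyps(3) attach.prems(1) by auto
  then show ?case by blast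
qed simp

theorem morse_built_k_connected:
  assumes "morse_built c L" "L \<noteq> {}"
  shows "k_connected_space (int c - 2) (geometric_realization L)"
  unfolding k_connected_space_def
proof (intro conjI impI allI)
  assume "- 1 \<le> int c - 2"
  then obtain A where "A \<in> L" "A \<noteq> {}" using morse_built_nonempty[OF assms(1) _ assms(2)] by auto
  then show "topspace (geometric_realization L) \<noteq> {}"
    using realization_nonempty morse_built_face_closed[OF assms(1)] by blast
next
  fix i f assume "int i \<le> int c - 2" "continuous_map (nsphere i) (geometric_realization L) f"
  then show "\<exists>a\<in>topspace (geometric_realization L).
      homotopic_with (\<lambda>_. True) (nsphere i) (geometric_realization L) f (\<lambda>_. a)"
    using morse_built_null_homotopic[OF assms] by auto
qed

section \<open>Collapsing a contractible subcomplex\<close>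

text \<open>The final stage of \<open>E\<close> is constant on \<open>C\<close>, so it factors
  through \<open>q\<close> as a map \<open>g\<close>, and \<open>E\<close> is a homotopy from the
  identity to \<open>g \<circ> q\<close>. Since \<open>E\<close> keeps \<open>C\<close> invariant,
  \<open>q \<circ> E\<close> descends to a homotopy from the identity to \<open>q \<circ> g\<close>.
  Descending needs \<open>Q\<close>, the product of the interval with \<open>q\<close>, to be a
  quotient map; compactness and the Hausdorff property ensure this.\<close>

lemma collapse_homotopy_equivalence:
  fixes q :: "'a \<Rightarrow> 'b"
  assumes X: "compact_space X" and Y: "Hausdorff_space Y"
    and q: "continuous_map X Y q" "q ` topspace X = topspace Y"
    and E: "continuous_map (prod_topology (top_of_set {0..1}) X) X E" "\<And>x. x \<in> topspace X \<Longrightarrow> E (0::real, x) = x"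
    and C: "\<And>t x. x \<in> C \<Longrightarrow> 0 \<le> t \<Longrightarrow> t \<le> 1 \<Longrightarrow> E (t, x) \<in> C" "\<And>x. x \<in> C \<Longrightarrow> E (1, x) = c0"
    and fibre: "\<And>x y. x \<in> topspace X \<Longrightarrow> y \<in> topspace X \<Longrightarrow> q x = q y \<Longrightarrow> x = y \<or> x \<in> C \<and> y \<in> C"
    and qC: "\<And>x y. x \<in> C \<Longrightarrow> y \<in> C \<Longrightarrow> q x = q y"
  shows "X homotopy_equivalent_space Y"
proof -
  let ?I = "top_of_set {0..1::real}"
  \<comment> \<open>\<open>s\<close> is an arbitrary choice of preimages, in general discontinuous;
    the continuity of \<open>g\<close> and \<open>F\<close> is derived from that of their composites
    with the quotient maps.\<close>
  define s where "s y = (SOME x. x \<in> topspace X \<and> q x = y)" for y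
  have s: "s y \<in> topspace X \<and> q (s y) = y" if "y \<in> topspace Y" for y
  proof -
    have "y \<in> q ` topspace X" using that q(2) by simp
    then obtain x where "x \<in> topspace X \<and> q x = y" by auto
    then show ?thesis unfolding s_def by (rule someI)
  qed
  have sq: "s (q x) = x \<or> s (q x) \<in> C \<and> x \<in> C" if "x \<in> topspace X" for x
  proof -
    have "q x \<in> topspace Y" using that q(2) by auto
    then show ?thesis using fibre[of "s (q x)" x] s[of "q x"] that by simp
  qed
  have quot: "quotient_map X Y q" by (rule continuous_imp_quotient_map[OF q(1) X Y q(2)])
  have "continuous_map X (prod_topology ?I X) (\<lambda>x. (1, x))"
    by (simp add: continuous_map_pairwise o_def)
  then have e1: "continuous_map X X (\<lambda>x. E (1, x))"
    using continuous_map_compose[OF _ E(1)] by (fastforce simp: o_def)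
  define g where "g y = E (1, s y)" for y
  have gq: "g (q x) = E (1, x)" if "x \<in> topspace X" for x
    using sq[OF that] C(2) by (auto simp: g_def)
  have "continuous_map X X (g \<circ> q)" by (rule continuous_map_eq[OF e1]) (simp add: gq)
  then have g: "continuous_map Y X g" by (rule continuous_compose_quotient_map[OF quot])
  have "homotopic_with (\<lambda>_. True) X X id (g \<circ> q)"
    by (subst homotopic_with) (use E gq in \<open>auto intro!: exI[of _ E]\<close>)
  then have h1: "homotopic_with (\<lambda>_. True) X X (g \<circ> q) id" by (rule homotopic_with_symD)
  define Q where "Q = (\<lambda>(t::real, x). (t, q x))"
  define F where "F = (\<lambda>(t::real, y). q (E (t, s y)))"
  have "continuous_map (prod_topology ?I X) (prod_topology ?I Y) Q"
    unfolding Q_def using q(1)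
    by (simp add: continuous_map_prod_top continuous_map_pairwise case_prod_unfold o_def
        continuous_map_fst continuous_map_of_snd[unfolded o_def])
  moreover have "compact_space (prod_topology ?I X)"
    using X by (simp add: compact_space_prod_topology compact_space_subtopology)
  moreover have "Hausdorff_space (prod_topology ?I Y)"
    using Y by (simp add: Hausdorff_space_prod_topology Hausdorff_space_subtopology)
  moreover have "Q ` topspace (prod_topology ?I X) = topspace (prod_topology ?I Y)"
    using q(2) by (force simp: Q_def)
  ultimately have Q: "quotient_map (prod_topology ?I X) (prod_topology ?I Y) Q"
    by (rule continuous_imp_quotient_map)
  have FQ: "F (Q z) = q (E z)" if zI: "z \<in> topspace (prod_topology ?I X)" for z
  proof -
    obtain t x where z: "z = (t, x)" "0 \<le> t" "t \<le> 1" "x \<in> topspace X" using zI by auto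
    show ?thesis using sq[OF z(4)] qC[OF C(1)[OF _ z(2,3)] C(1)[OF _ z(2,3)]]
      by (auto simp: F_def Q_def z)
  qed
  have "continuous_map (prod_topology ?I X) Y (q \<circ> E)" by (rule continuous_map_compose[OF E(1) q(1)])
  then have "continuous_map (prod_topology ?I X) Y (F \<circ> Q)"
    by (rule continuous_map_eq) (simp only: FQ o_apply)
  then have F: "continuous_map (prod_topology ?I Y) Y F" by (rule continuous_compose_quotient_map[OF Q])
  have "homotopic_with (\<lambda>_. True) Y Y id (q \<circ> g)"
    by (subst homotopic_with) (use F s E(2) in \<open>auto intro!: exI[of _ F] simp: F_def g_def\<close>)
  then have "homotopic_with (\<lambda>_. True) Y Y (q \<circ> g) id" by (rule homotopic_with_symD)
  then show ?thesis unfolding homotopy_equivalent_space_def using q(1) g h1 by blast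
qed

lemma top_simplex_maximal:
  assumes "face_closed C" "L = C \<union> S" "C \<inter> S = {}" "\<And>\<sigma>. \<sigma> \<in> S \<Longrightarrow> card \<sigma> = c" "0 < c"
    and "\<sigma> \<in> S" "A \<in> L" "\<sigma> \<subseteq> A"
  shows "A = \<sigma>"
proof -
  have "A \<notin> C" using face_closed_subset[OF assms(1) _ assms(8)] assms(3,6) by blast
  then have "card A = c" "card \<sigma> = c" using assms(2,4,6,7) by auto
  moreover have "finite A" using calculation(1) assms(5) by (simp add: card_ge_0_finite)
  ultimately show ?thesis using card_subset_eq[of A \<sigma>] assms(8) by simp
qed

text \<open>On the cell \<open>\<sigma>\<close>, \<open>\<theta>\<close> grows from \<open>0\<close> on the boundary to \<open>1\<close> at the barycentre.  At time \<open>t\<close>,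
  \<open>P t\<close> pushes points outwards by lowering all coordinates by \<open>\<alpha> \<sigma> t\<close> and renormalizing, so that the
  collar \<open>\<theta> * (1 + t) \<le> t\<close> reaches the boundary; there the given contraction of \<open>C\<close> takes over, run up
  to the time \<open>t - \<theta> * (1 + t)\<close>, which is \<open>t\<close> on the boundary and \<open>0\<close> at the inner end of the collar.
  The formulas sum over all cells since at most one summand is nonzero.\<close>

lemma contraction_extends:
  fixes L C :: "'v set set" and q :: "('v \<Rightarrow> real) \<Rightarrow> 'b"
  assumes fcL: "face_closed L" and fcC: "face_closed C" and L: "L = C \<union> S" "C \<inter> S = {}" and S: "finite S"
    and cardS: "\<forall>\<sigma>\<in>S. card \<sigma> = c" and c: "0 < c"
    and contr: "contractible_space (geometric_realization C)"
  shows "\<exists>E c0. continuous_map (prod_topology (top_of_set {0..1}) (geometric_realization L)) (geometric_realization L) E \<and>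
    (\<forall>x\<in>topspace (geometric_realization L). E (0::real, x) = x) \<and>
    (\<forall>x\<in>topspace (geometric_realization C). E (1, x) = c0) \<and>
    (\<forall>x\<in>topspace (geometric_realization C). \<forall>t\<in>{0..1}. E (t, x) \<in> topspace (geometric_realization C))"
proof -
  let ?L = "topspace (geometric_realization L)" and ?C = "topspace (geometric_realization C)"
  note card = bspec[OF cardS]
  let ?I = "top_of_set {0..1::real}"
  let ?P = "prod_topology ?I (geometric_realization L)"
  obtain H c0 where H: "continuous_map (prod_topology ?I (geometric_realization C)) (geometric_realization C) H"
    and H0: "\<And>x. H (0, x) = x" and H1: "\<And>x. H (1, x) = c0"
    using contr by (auto simp: contractible_space_def homotopic_with_def)
  have fin: "finite \<sigma>" "\<sigma> \<noteq> {}" if "\<sigma> \<in> S" for \<sigma>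
    using card[OF that] c by (auto intro: card_ge_0_finite)
  have maximal: "A = \<sigma>" if "\<sigma> \<in> S" "A \<in> L" "\<sigma> \<subseteq> A" for A \<sigma>
    by (rule top_simplex_maximal[OF fcC L _ c that]) (rule card)
  have proper: "A \<in> C" if "\<sigma> \<in> S" "A \<subset> \<sigma>" for A \<sigma>
  proof -
    have "A \<in> L" using face_closed_subset[OF fcL, of \<sigma> A] that L(1) by blast
    moreover have "A \<notin> S" using psubset_card_mono[OF fin(1)[OF that(1)] that(2)] card that(1) by fastforce
    ultimately show ?thesis using L(1) by blast
  qed
  define k where "k = real c"
  have k: "1 \<le> k" using c by (simp add: k_def)
  define \<mu> where "\<mu> \<sigma> x = Min ((\<lambda>v. x v) ` \<sigma>)" for \<sigma> and x :: "'v \<Rightarrow> real"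
  define \<theta> where "\<theta> x = k * (\<Sum>\<sigma>\<in>S. \<mu> \<sigma> x)" for x
  \<comment> \<open>The minimum is \<open>\<mu> \<sigma> x\<close>, so that a smallest coordinate is
    lowered to 0, exactly if \<open>k * \<mu> \<sigma> x * (1 + t) \<le> t\<close>, the condition
    for the collar.\<close>
  define \<alpha> where "\<alpha> \<sigma> t x = min (\<mu> \<sigma> x) (t * (1 / k - \<mu> \<sigma> x))" for \<sigma> t x
  define W where "W t x v = (\<Sum>\<sigma>\<in>S. if v \<in> \<sigma> then \<alpha> \<sigma> t x else 0)" for t x v
  define A where "A t x = k * (\<Sum>\<sigma>\<in>S. \<alpha> \<sigma> t x)" for t x
  define P where "P t x v = (x v - W t x v) / (1 - A t x)" for t x v
  have \<mu>_le: "\<mu> \<sigma> x \<le> x v" if "\<sigma> \<in> S" "v \<in> \<sigma>" for \<sigma> x v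
    using fin[OF that(1)] that(2) by (simp add: \<mu>_def)
  have \<mu>_eq: "\<exists>v\<in>\<sigma>. \<mu> \<sigma> x = x v" if "\<sigma> \<in> S" for \<sigma> x
  proof -
    have "\<mu> \<sigma> x \<in> x ` \<sigma>" unfolding \<mu>_def using fin[OF that] by (intro Min_in) auto
    then show ?thesis by auto
  qed
  have \<mu>0: "\<mu> \<sigma> x = 0" if x: "x \<in> ?L" and \<sigma>: "\<sigma> \<in> S" "supp x \<noteq> \<sigma>" for x \<sigma>
  proof -
    have "\<not> \<sigma> \<subseteq> supp x" using maximal[OF \<sigma>(1) realization_supp[OF x]] \<sigma>(2) by blast
    then obtain v where v: "v \<in> \<sigma>" "x v = 0" by (auto simp: supp_def)
    obtain w where "\<mu> \<sigma> x = x w" using \<mu>_eq[OF \<sigma>(1)] by blast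
    then show ?thesis using \<mu>_le[OF \<sigma>(1) v(1), of x] v(2) realization_nonneg[OF x, of w] by linarith
  qed
  have \<alpha>0: "\<alpha> \<sigma> t x = 0" if "x \<in> ?L" "\<sigma> \<in> S" "supp x \<noteq> \<sigma>" "0 \<le> t" for x \<sigma> t
    using \<mu>0[OF that(1-3)] that(4) k by (simp add: \<alpha>_def)
  have inC: "\<theta> x = 0 \<and> W t x = (\<lambda>v. 0) \<and> A t x = 0 \<and> P t x = x" if x: "x \<in> ?C" and t: "0 \<le> t" for x t
  proof -
    have xL: "x \<in> ?L" using x L(1) by (auto simp: in_realization_iff)
    have ne: "supp x \<noteq> \<sigma>" if "\<sigma> \<in> S" for \<sigma> using that realization_supp[OF x] L(2) by blast
    have "\<theta> x = 0" unfolding \<theta>_def using \<mu>0[OF xL _ ne] by simp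
    moreover have "W t x = (\<lambda>v. 0)" unfolding W_def using \<alpha>0[OF xL _ ne t] by (auto intro!: sum.neutral)
    moreover have "A t x = 0" unfolding A_def using \<alpha>0[OF xL _ ne t] by simp
    ultimately show ?thesis by (auto simp: P_def)
  qed
  have inS: "\<theta> x = k * \<mu> \<sigma> x \<and> W t x = (\<lambda>v. if v \<in> \<sigma> then \<alpha> \<sigma> t x else 0) \<and> A t x = k * \<alpha> \<sigma> t x"
    if x: "x \<in> ?L" and \<sigma>: "\<sigma> \<in> S" "supp x = \<sigma>" and t: "0 \<le> t" for x \<sigma> t
  proof -
    have ne: "supp x \<noteq> \<tau>" if "\<tau> \<in> S - {\<sigma>}" for \<tau> using that \<sigma> by blast
    have "(\<Sum>\<tau>\<in>S. f \<tau>) = f \<sigma>" if "\<And>\<tau>. \<tau> \<in> S - {\<sigma>} \<Longrightarrow> f \<tau> = 0" for f :: "'v set \<Rightarrow> real"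
      using sum.remove[OF S \<sigma>(1), of f] that by simp
    note single = this
    have "\<theta> x = k * \<mu> \<sigma> x" unfolding \<theta>_def
      by (subst single) (use \<mu>0[OF x _ ne] in auto)
    moreover have "W t x v = (if v \<in> \<sigma> then \<alpha> \<sigma> t x else 0)" for v unfolding W_def
      by (subst single) (use \<alpha>0[OF x _ ne t] in auto)
    moreover have "A t x = k * \<alpha> \<sigma> t x" unfolding A_def
      by (subst single) (use \<alpha>0[OF x _ ne t] in auto)
    ultimately show ?thesis by auto
  qed
  have bounds: "0 < \<mu> \<sigma> x \<and> k * \<mu> \<sigma> x \<le> 1 \<and> (\<Sum>v\<in>\<sigma>. x v) = 1" if x: "x \<in> ?L" and \<sigma>: "\<sigma> \<in> S" "supp x = \<sigma>" for x \<sigma>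
  proof -
    obtain v where v: "v \<in> \<sigma>" "\<mu> \<sigma> x = x v" using \<mu>_eq[OF \<sigma>(1)] by blast
    have "x v \<noteq> 0" using v(1) \<sigma>(2) by (auto simp: supp_def)
    then have "0 < \<mu> \<sigma> x" using v(2) realization_nonneg[OF x, of v] by simp
    moreover have s: "(\<Sum>v\<in>\<sigma>. x v) = 1" using realization_sum[OF x, of \<sigma>] \<sigma> fin by simp
    have "(\<Sum>v\<in>\<sigma>. \<mu> \<sigma> x) \<le> (\<Sum>v\<in>\<sigma>. x v)" using \<mu>_le[OF \<sigma>(1)] by (rule sum_mono)
    then have "k * \<mu> \<sigma> x \<le> 1" using s card[OF \<sigma>(1)] by (simp add: k_def)
    ultimately show ?thesis using s by blast
  qed
  \<comment> \<open>\<open>k * \<alpha> \<sigma> t x\<close> is at most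
    \<open>k * \<mu> \<sigma> x\<close> and at most \<open>1 - k * \<mu> \<sigma> x\<close>, one of
    which is at most 1/2; this keeps the denominator of \<open>P\<close> away from 0.\<close>
  have \<alpha>b: "0 \<le> \<alpha> \<sigma> t x \<and> \<alpha> \<sigma> t x \<le> \<mu> \<sigma> x \<and> k * \<alpha> \<sigma> t x \<le> 1 / 2"
    if x: "x \<in> ?L" and \<sigma>: "\<sigma> \<in> S" "supp x = \<sigma>" and t: "0 \<le> t" "t \<le> 1" for x \<sigma> t
  proof -
    have b: "0 < \<mu> \<sigma> x" "k * \<mu> \<sigma> x \<le> 1" using bounds[OF x \<sigma>] by auto
    then have "\<mu> \<sigma> x \<le> 1 / k" using k by (simp add: field_simps)
    then have t0: "0 \<le> t * (1 / k - \<mu> \<sigma> x)" using t by simp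
    have "t * (1 / k - \<mu> \<sigma> x) \<le> 1 * (1 / k - \<mu> \<sigma> x)"
      using t \<open>\<mu> \<sigma> x \<le> 1 / k\<close> by (intro mult_right_mono) auto
    then have "\<alpha> \<sigma> t x \<le> 1 / k - \<mu> \<sigma> x" by (simp add: \<alpha>_def)
    then have "k * \<alpha> \<sigma> t x \<le> k * (1 / k - \<mu> \<sigma> x)" using k by (intro mult_left_mono) auto
    also have "\<dots> = 1 - k * \<mu> \<sigma> x" using k by (simp add: right_diff_distrib)
    finally have "k * \<alpha> \<sigma> t x \<le> 1 - k * \<mu> \<sigma> x" .
    moreover have "k * \<alpha> \<sigma> t x \<le> k * \<mu> \<sigma> x" using k by (intro mult_left_mono) (auto simp: \<alpha>_def)
    ultimately have "k * \<alpha> \<sigma> t x \<le> 1 / 2" by linarith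
    then show ?thesis using b t0 by (simp add: \<alpha>_def)
  qed
  have A_half: "A t x \<le> 1 / 2" if x: "x \<in> ?L" and t: "0 \<le> t" "t \<le> 1" for x t
  proof (cases "supp x \<in> C")
    case True
    then have "x \<in> ?C" using x by (auto simp: in_realization_iff)
    then show ?thesis using inC t by simp
  next
    case False
    then have "supp x \<in> S" using realization_supp[OF x] L(1) by blast
    then show ?thesis using inS[OF x _ refl t(1)] \<alpha>b[OF x _ refl t] by simp
  qed
  have P_in: "P t x \<in> ?L \<and> (\<theta> x * (1 + t) \<le> t \<longrightarrow> P t x \<in> ?C)" if x: "x \<in> ?L" and t: "0 \<le> t" "t \<le> 1" for x t
  proof (cases "supp x \<in> C")
    case True
    then have "x \<in> ?C" using x by (auto simp: in_realization_iff)
    then show ?thesis using inC t x by simp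
  next
    case False
    define \<sigma> where "\<sigma> = supp x"
    have \<sigma>: "\<sigma> \<in> S" "supp x = \<sigma>" using False realization_supp[OF x] L(1) by (auto simp: \<sigma>_def)
    note S' = inS[OF x \<sigma> t(1)] and ab = \<alpha>b[OF x \<sigma> t] and b = bounds[OF x \<sigma>]
    have Pv: "P t x v = (if v \<in> \<sigma> then (x v - \<alpha> \<sigma> t x) / (1 - k * \<alpha> \<sigma> t x) else 0)" for v
      using S' \<sigma>(2) by (auto simp: P_def supp_def)
    have nonneg: "0 \<le> P t x v" for v
      using ab \<mu>_le[OF \<sigma>(1), of v x] by (auto simp: Pv intro!: divide_nonneg_pos)
    have "(\<Sum>v\<in>\<sigma>. P t x v) = (\<Sum>v\<in>\<sigma>. x v - \<alpha> \<sigma> t x) / (1 - k * \<alpha> \<sigma> t x)"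
      unfolding sum_divide_distrib by (rule sum.cong) (auto simp: Pv)
    also have "\<dots> = 1" using b ab card[OF \<sigma>(1)] by (simp add: sum_subtractf k_def)
    finally have sum: "(\<Sum>v\<in>\<sigma>. P t x v) = 1" .
    have sub: "supp (P t x) \<subseteq> \<sigma>" by (auto simp: supp_def Pv)
    have PL: "P t x \<in> ?L" using \<sigma>(1) L(1) by (intro in_realizationI[OF fcL _ nonneg sub sum]) auto
    have "P t x \<in> ?C" if "\<theta> x * (1 + t) \<le> t"
    proof -
      obtain w where w: "w \<in> \<sigma>" "\<mu> \<sigma> x = x w" using \<mu>_eq[OF \<sigma>(1)] by blast
      have "k * \<mu> \<sigma> x \<le> t * (1 - k * \<mu> \<sigma> x)" using that S' by (simp add: algebra_simps)
      also have "\<dots> = k * (t * (1 / k - \<mu> \<sigma> x))" using k by (simp add: field_simps)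
      finally have "\<mu> \<sigma> x \<le> t * (1 / k - \<mu> \<sigma> x)" using k by simp
      then have "\<alpha> \<sigma> t x = \<mu> \<sigma> x" by (simp add: \<alpha>_def)
      then have "P t x w = 0" using w by (simp add: Pv)
      then have "supp (P t x) \<subseteq> \<sigma> - {w}" using sub by (auto simp: supp_def)
      then have "supp (P t x) \<in> C" using proper[OF \<sigma>(1), of "supp (P t x)"] w(1) by blast
      then show ?thesis using PL by (simp add: in_realization_iff)
    qed
    then show ?thesis using PL by blast
  qed
  define E where "E z = (if \<theta> (snd z) * (1 + fst z) \<le> fst z
      then H (fst z - \<theta> (snd z) * (1 + fst z), P (fst z) (snd z)) else P (fst z) (snd z))" for z
  have \<theta>0: "0 \<le> \<theta> x" if x: "x \<in> ?L" for x
  proof (cases "supp x \<in> C")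
    case True
    then have "x \<in> ?C" using x by (auto simp: in_realization_iff)
    then show ?thesis using inC[of x 0] by simp
  next
    case False
    then have \<sigma>: "supp x \<in> S" using realization_supp[OF x] L(1) by blast
    show ?thesis using inS[OF x \<sigma> refl, of 0] bounds[OF x \<sigma> refl] k by simp
  qed
  have cfst: "continuous_map ?P euclideanreal fst"
    using continuous_map_fst continuous_map_in_subtopology by blast
  have csnd: "continuous_map ?P euclideanreal (\<lambda>z. snd z v)" for v
    by (rule continuous_map_realization_coord[OF continuous_map_snd[unfolded comp_def]])
  have c\<mu>: "continuous_map ?P euclideanreal (\<lambda>z. \<mu> \<sigma> (snd z))" if "\<sigma> \<in> S" for \<sigma>
    unfolding \<mu>_def by (intro continuous_map_Min fin[OF that] csnd)
  have c\<theta>: "continuous_map ?P euclideanreal (\<lambda>z. \<theta> (snd z))"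
    unfolding \<theta>_def by (intro continuous_intros c\<mu> S)
  have c\<alpha>: "continuous_map ?P euclideanreal (\<lambda>z. \<alpha> \<sigma> (fst z) (snd z))" if "\<sigma> \<in> S" for \<sigma>
    unfolding \<alpha>_def by (intro continuous_intros c\<mu>[OF that] cfst)
  have cW: "continuous_map ?P euclideanreal (\<lambda>z. W (fst z) (snd z) v)" for v
  proof -
    have "continuous_map ?P euclideanreal (\<lambda>z. if v \<in> \<sigma> then \<alpha> \<sigma> (fst z) (snd z) else 0)" if "\<sigma> \<in> S" for \<sigma>
      using c\<alpha>[OF that] by (cases "v \<in> \<sigma>") auto
    then show ?thesis unfolding W_def by (intro continuous_map_sum S)
  qed
  have cA: "continuous_map ?P euclideanreal (\<lambda>z. A (fst z) (snd z))"
    unfolding A_def by (intro continuous_intros c\<alpha> S)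
  have cP: "continuous_map ?P (geometric_realization L) (\<lambda>z. P (fst z) (snd z))"
    unfolding continuous_map_realization
  proof (intro conjI allI ballI)
    fix v
    have "1 - A (fst z) (snd z) \<noteq> 0" if "z \<in> topspace ?P" for z
      using A_half[of "snd z" "fst z"] that by (cases z) auto
    then show "continuous_map ?P euclideanreal (\<lambda>z. P (fst z) (snd z) v)"
      unfolding P_def by (intro continuous_intros csnd cW cA)
  next
    fix z assume "z \<in> topspace ?P"
    then show "P (fst z) (snd z) \<in> ?L" using P_in[of "snd z" "fst z"] by (cases z) auto
  qed
  have cE: "continuous_map ?P (geometric_realization L) E"
    unfolding E_def
  proof (rule continuous_map_cases_le)
    show "continuous_map ?P euclideanreal (\<lambda>z. \<theta> (snd z) * (1 + fst z))"
      by (intro continuous_intros c\<theta> cfst)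
    show "continuous_map ?P euclideanreal fst" by (rule cfst)
    let ?R = "subtopology ?P {z \<in> topspace ?P. \<theta> (snd z) * (1 + fst z) \<le> fst z}"
    have "continuous_map ?R (prod_topology ?I (geometric_realization C))
        (\<lambda>z. (fst z - \<theta> (snd z) * (1 + fst z), P (fst z) (snd z)))"
      unfolding continuous_map_pairwise comp_def fst_conv snd_conv
    proof
      have "continuous_map ?R euclideanreal (\<lambda>z. fst z - \<theta> (snd z) * (1 + fst z))"
        by (intro continuous_map_from_subtopology continuous_intros c\<theta> cfst)
      moreover have "fst z - \<theta> (snd z) * (1 + fst z) \<in> {0..1}" if "z \<in> topspace ?R" for z
      proof -
        have z: "0 \<le> fst z" "fst z \<le> 1" "snd z \<in> ?L" "\<theta> (snd z) * (1 + fst z) \<le> fst z"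
          using that by auto
        have "0 \<le> \<theta> (snd z) * (1 + fst z)" using \<theta>0[OF z(3)] z(1) by simp
        then show ?thesis using z by simp
      qed
      ultimately show "continuous_map ?R ?I (\<lambda>z. fst z - \<theta> (snd z) * (1 + fst z))"
        by (auto simp: continuous_map_in_subtopology)
      have "continuous_map ?R (geometric_realization L) (\<lambda>z. P (fst z) (snd z))"
        by (rule continuous_map_from_subtopology[OF cP])
      moreover have "P (fst z) (snd z) \<in> ?C" if "z \<in> topspace ?R" for z
        using that P_in[of "snd z" "fst z"] by (cases z) auto
      ultimately show "continuous_map ?R (geometric_realization C) (\<lambda>z. P (fst z) (snd z))"
        by (auto simp: continuous_map_realization)
    qed
    then have "continuous_map ?R (geometric_realization C)
        (H \<circ> (\<lambda>z. (fst z - \<theta> (snd z) * (1 + fst z), P (fst z) (snd z))))"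
      using H by (rule continuous_map_compose)
    then show "continuous_map ?R (geometric_realization L)
        (\<lambda>z. H (fst z - \<theta> (snd z) * (1 + fst z), P (fst z) (snd z)))"
      unfolding comp_def using L(1) by (intro continuous_map_realization_mono[of C L]) auto
    show "continuous_map (subtopology ?P {z \<in> topspace ?P. fst z \<le> \<theta> (snd z) * (1 + fst z)})
        (geometric_realization L) (\<lambda>z. P (fst z) (snd z))"
      by (rule continuous_map_from_subtopology[OF cP])
  \<comment> \<open>At the inner end of the collar \<open>H\<close> runs for time 0, so both
    formulas give \<open>P\<close>.\<close>
  qed (simp add: H0)
  have E0: "E (0, x) = x" if x: "x \<in> ?L" for x
  proof (cases "supp x \<in> C")
    case True
    then have "x \<in> ?C" using x by (auto simp: in_realization_iff)
    then show ?thesis using inC[of x 0] H0 by (simp add: E_def)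
  next
    case False
    then have \<sigma>: "supp x \<in> S" using realization_supp[OF x] L(1) by blast
    have "\<theta> x > 0" using inS[OF x \<sigma> refl, of 0] bounds[OF x \<sigma> refl] k by simp
    moreover have "\<alpha> (supp x) 0 x = 0" using bounds[OF x \<sigma> refl] by (simp add: \<alpha>_def)
    ultimately show ?thesis using inS[OF x \<sigma> refl, of 0] by (auto simp: E_def P_def)
  qed
  have E1: "E (1, x) = c0" if "x \<in> ?C" for x
    using inC[OF that, of 1] H1 by (simp add: E_def)
  have EC: "E (t, x) \<in> ?C" if x: "x \<in> ?C" and t: "t \<in> {0..1}" for x t
  proof -
    have "(t, x) \<in> topspace (prod_topology ?I (geometric_realization C))" using x t by simp
    then have "H (t, x) \<in> ?C" using H continuous_map_image_subset_topspace by blast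
    then show ?thesis using inC[OF x, of t] t by (simp add: E_def)
  qed
  show ?thesis by (intro exI[of _ E] exI[of _ c0] conjI ballI cE E0 E1 EC)
qed

section \<open>Wedges of spheres\<close>

lemma topspace_nsphere_split:
  "topspace (nsphere d) = {z. (z 0)\<^sup>2 + (\<Sum>j\<in>{1..d}. (z j)\<^sup>2) = 1 \<and> (\<forall>j>d. z j = 0)}"
proof -
  have "(\<Sum>j\<le>d. (z j)\<^sup>2) = (z 0)\<^sup>2 + (\<Sum>j\<in>{1..d}. (z j)\<^sup>2)" for z :: "nat \<Rightarrow> real"
  proof -
    have "{..d} = insert 0 {1..d}" by auto
    then show ?thesis by simp
  qed
  then show ?thesis by (auto simp: nsphere Suc_le_eq)
qed

lemma sphere_eq_base:
  assumes "z \<in> topspace (nsphere d)" "1 \<le> z 0"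
  shows "z = sphere_base"
proof -
  have s: "(z 0)\<^sup>2 + (\<Sum>j\<in>{1..d}. (z j)\<^sup>2) = 1" and out: "\<forall>j>d. z j = 0"
    using assms(1) by (auto simp: topspace_nsphere_split)
  have "1 \<le> (z 0)\<^sup>2" using assms(2) by (simp add: one_le_power)
  moreover have nn: "0 \<le> (\<Sum>j\<in>{1..d}. (z j)\<^sup>2)" by (simp add: sum_nonneg)
  ultimately have z0: "(z 0)\<^sup>2 = 1" and s0: "(\<Sum>j\<in>{1..d}. (z j)\<^sup>2) = 0" using s by linarith+
  have "z 0 = 1" using z0 assms(2) by (simp add: power2_eq_1_iff)
  moreover have "z j = 0" if "j \<noteq> 0" for j
  proof (cases "j \<le> d")
    case True
    have "\<forall>j\<in>{1..d}. (z j)\<^sup>2 = 0" using s0 by (subst (asm) sum_nonneg_eq_0_iff) auto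
    then show ?thesis using that True by simp
  next
    case False
    then show ?thesis using out by simp
  qed
  ultimately show ?thesis by (auto simp: sphere_base_def)
qed

text \<open>In an open simplex with minimal barycentric coordinate \<open>\<mu>\<close>, the differences
  \<open>(x (e j) - x (e 0)) / \<mu>\<close> are coordinates identifying it with Euclidean space; composing with the
  inverse stereographic projection and clearing denominators gives a formula that sends the rest
  of the complex to the base point.  The last term of the denominator \<open>D\<close> vanishes on the closed
  simplex and keeps \<open>D\<close> positive elsewhere.\<close>

lemma simplex_sphere_map:
  fixes L :: "'v set set" and \<sigma> :: "'v set"
  assumes fc: "face_closed L" and \<sigma>: "\<sigma> \<in> L" "card \<sigma> = Suc d"
    and maximal: "\<And>A. A \<in> L \<Longrightarrow> \<sigma> \<subseteq> A \<Longrightarrow> A = \<sigma>"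
  shows "\<exists>s. continuous_map (geometric_realization L) (nsphere d) s \<and>
    (\<forall>x\<in>topspace (geometric_realization L). s x = sphere_base \<longleftrightarrow> supp x \<noteq> \<sigma>) \<and>
    inj_on s {x \<in> topspace (geometric_realization L). supp x = \<sigma>} \<and>
    (\<forall>z\<in>topspace (nsphere d). z \<noteq> sphere_base \<longrightarrow>
       (\<exists>x\<in>topspace (geometric_realization L). supp x = \<sigma> \<and> s x = z))"
proof -
  let ?L = "topspace (geometric_realization L)"
  have fin: "finite \<sigma>" "\<sigma> \<noteq> {}" using \<sigma> by (auto intro: card_ge_0_finite)
  obtain e where e: "bij_betw e {..d} \<sigma>"
    using ex_bij_betw_nat_finite[OF fin(1)] \<sigma>(2) by (auto simp: lessThan_Suc_atMost lessThan_atLeast0[symmetric])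
  have e\<sigma>: "e j \<in> \<sigma>" if "j \<le> d" for j using e that by (auto simp: bij_betw_def)
  have e_ex: "\<exists>j\<le>d. v = e j" if "v \<in> \<sigma>" for v using e that by (auto simp: bij_betw_def)
  have e_inj: "i = j" if "e i = e j" "i \<le> d" "j \<le> d" for i j
    using e that by (auto simp: bij_betw_def inj_on_def)
  define \<mu> where "\<mu> x = Min ((\<lambda>v. x v) ` \<sigma>)" for x :: "'v \<Rightarrow> real"
  define u where "u x j = x (e j) - x (e 0)" for x :: "'v \<Rightarrow> real" and j
  define U where "U x = (\<Sum>j\<in>{1..d}. (u x j)\<^sup>2)" for x
  define D where "D x = U x + (\<mu> x)\<^sup>2 + (1 - (\<Sum>v\<in>\<sigma>. x v))\<^sup>2" for x
  \<comment> \<open>On the open simplex, with \<open>w j = u x j / \<mu> x\<close>, this is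
    \<open>(|w|^2 - 1) / (|w|^2 + 1)\<close> in coordinate 0 and
    \<open>2 * w j / (|w|^2 + 1)\<close> in coordinates 1 to \<open>d\<close>. Where
    \<open>\<mu> x = 0\<close> it is the base point.\<close>
  define s where "s x j = (if j = 0 then 1 - 2 * (\<mu> x)\<^sup>2 / D x
     else if j \<le> d then 2 * \<mu> x * u x j / D x else 0)" for x j
  have \<mu>_le: "\<mu> x \<le> x v" if "v \<in> \<sigma>" for x v using fin that by (simp add: \<mu>_def)
  have \<mu>_eq: "\<exists>v\<in>\<sigma>. \<mu> x = x v" for x
  proof -
    have "\<mu> x \<in> x ` \<sigma>" unfolding \<mu>_def using fin by (intro Min_in) auto
    then show ?thesis by auto
  qed
  have U0: "0 \<le> U x" for x unfolding U_def by (intro sum_nonneg) auto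
  have \<mu>0: "\<mu> x = 0" if x: "x \<in> ?L" "supp x \<noteq> \<sigma>" for x
  proof -
    have "\<not> \<sigma> \<subseteq> supp x" using maximal[OF realization_supp[OF x(1)]] x(2) by blast
    then obtain v where v: "v \<in> \<sigma>" "x v = 0" by (auto simp: supp_def)
    obtain w where "\<mu> x = x w" using \<mu>_eq by blast
    then show ?thesis using \<mu>_le[OF v(1), of x] v(2) realization_nonneg[OF x(1), of w] by linarith
  qed
  have inside: "0 < \<mu> x \<and> (\<Sum>v\<in>\<sigma>. x v) = 1 \<and> D x = U x + (\<mu> x)\<^sup>2" if x: "x \<in> ?L" "supp x = \<sigma>" for x
  proof -
    obtain v where v: "v \<in> \<sigma>" "\<mu> x = x v" using \<mu>_eq by blast
    have "x v \<noteq> 0" using v(1) x(2) by (auto simp: supp_def)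
    then have "0 < \<mu> x" using v(2) realization_nonneg[OF x(1), of v] by simp
    moreover have "(\<Sum>v\<in>\<sigma>. x v) = 1" using realization_sum[OF x(1), of \<sigma>] x(2) fin by simp
    ultimately show ?thesis by (simp add: D_def)
  qed
  \<comment> \<open>If \<open>D x\<close> vanished, all coordinates on \<open>\<sigma>\<close> would
    be equal by the first term and 0 by the second, while the third makes their sum 1.\<close>
  have D_pos: "0 < D x" for x
  proof (rule ccontr)
    assume "\<not> 0 < D x"
    then have z: "U x = 0" "(\<mu> x)\<^sup>2 = 0" "(1 - (\<Sum>v\<in>\<sigma>. x v))\<^sup>2 = 0"
      using U0[of x] zero_le_power2[of "\<mu> x"] zero_le_power2[of "1 - (\<Sum>v\<in>\<sigma>. x v)"]
      unfolding D_def by linarith+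
    have u0: "\<forall>j\<in>{1..d}. (u x j)\<^sup>2 = 0" using z(1) unfolding U_def by (subst (asm) sum_nonneg_eq_0_iff) auto
    have const: "x v = x (e 0)" if v: "v \<in> \<sigma>" for v
    proof -
      obtain j where j: "j \<le> d" "v = e j" using e_ex[OF v] by blast
      have "u x j = 0" using u0 j(1) by (cases "j = 0") (simp_all add: u_def)
      then show ?thesis using j(2) by (simp add: u_def)
    qed
    obtain w where "w \<in> \<sigma>" "\<mu> x = x w" using \<mu>_eq by blast
    then have x0: "x (e 0) = 0" using const[of w] z(2) by simp
    have "(\<Sum>v\<in>\<sigma>. x v) = 0"
    proof (rule sum.neutral, rule ballI)
      show "x v = 0" if "v \<in> \<sigma>" for v using const[OF that] x0 by (rule trans)
    qed
    then show False using z(3) by simp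
  qed
  have base: "s x = sphere_base \<longleftrightarrow> supp x \<noteq> \<sigma>" if x: "x \<in> ?L" for x
  proof
    assume sx: "s x = sphere_base"
    show "supp x \<noteq> \<sigma>"
    proof
      assume "supp x = \<sigma>"
      then have "0 < 2 * (\<mu> x)\<^sup>2 / D x" using inside[OF x] D_pos[of x] by simp
      moreover have "s x 0 = 1" using sx by (simp add: sphere_base_def)
      ultimately show False by (auto simp: s_def)
    qed
  next
    assume "supp x \<noteq> \<sigma>"
    then show "s x = sphere_base" using \<mu>0[OF x] by (auto simp: s_def sphere_base_def)
  qed
  have s_in: "s x \<in> topspace (nsphere d)" if x: "x \<in> ?L" for x
  proof (cases "supp x = \<sigma>")
    case False
    then show ?thesis using base[OF x] sphere_base_in_nsphere by simp
  next
    case True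
    have D: "D x = U x + (\<mu> x)\<^sup>2" "0 < D x" using inside[OF x True] D_pos[of x] by blast+
    have "(\<Sum>j\<in>{1..d}. (s x j)\<^sup>2) = (\<Sum>j\<in>{1..d}. (2 * \<mu> x / D x)\<^sup>2 * (u x j)\<^sup>2)"
      by (rule sum.cong) (auto simp: s_def power_mult_distrib power_divide)
    also have "\<dots> = (2 * \<mu> x / D x)\<^sup>2 * U x" by (simp add: U_def sum_distrib_left)
    finally have "(s x 0)\<^sup>2 + (\<Sum>j\<in>{1..d}. (s x j)\<^sup>2) =
        (1 - 2 * (\<mu> x)\<^sup>2 / D x)\<^sup>2 + (2 * \<mu> x / D x)\<^sup>2 * (D x - (\<mu> x)\<^sup>2)"
      using D by (simp add: s_def)
    also have "\<dots> = 1"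
    proof -
      have "(1 - 2 * m\<^sup>2 / E)\<^sup>2 + (2 * m / E)\<^sup>2 * (E - m\<^sup>2) = 1" if "0 < E" for m E :: real
        using that by (simp add: field_simps power2_eq_square)
      then show ?thesis using D(2) .
    qed
    finally show ?thesis by (simp add: topspace_nsphere_split s_def)
  qed
  have cont: "continuous_map (geometric_realization L) (nsphere d) s"
  proof -
    have c\<mu>: "continuous_map (geometric_realization L) euclideanreal \<mu>"
      unfolding \<mu>_def by (intro continuous_map_Min fin continuous_map_coord)
    have cu: "continuous_map (geometric_realization L) euclideanreal (\<lambda>x. u x j)" for j
      unfolding u_def by (intro continuous_intros)
    have cD: "continuous_map (geometric_realization L) euclideanreal D"
      unfolding D_def U_def by (intro continuous_intros c\<mu> cu fin) auto
    have "continuous_map (geometric_realization L) euclideanreal (\<lambda>x. s x j)" for j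
    proof -
      have "continuous_map (geometric_realization L) euclideanreal (\<lambda>x. 1 - 2 * (\<mu> x)\<^sup>2 / D x)"
        "continuous_map (geometric_realization L) euclideanreal (\<lambda>x. 2 * \<mu> x * u x j / D x)"
        using D_pos by (intro continuous_intros c\<mu> cu cD; simp add: less_imp_neq[symmetric])+
      then show ?thesis unfolding s_def by (cases "j = 0"; cases "j \<le> d") simp_all
    qed
    moreover have "s x \<in> {z. (\<Sum>i\<le>d. (z i)\<^sup>2) = 1 \<and> (\<forall>i>d. z i = 0)}" if "x \<in> ?L" for x
      using s_in[OF that] by (simp add: nsphere)
    ultimately show ?thesis
      unfolding nsphere by (auto simp: continuous_map_in_subtopology continuous_map_componentwise_UNIV)
  qed
  have inj: "x = y"
    if x: "x \<in> ?L" "supp x = \<sigma>" and y: "y \<in> ?L" "supp y = \<sigma>" and eq: "s x = s y" for x y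
  proof -
    have px: "0 < \<mu> x" "0 < D x" and py: "0 < \<mu> y" "0 < D y"
      using inside[OF x] inside[OF y] D_pos by blast+
    have "s x 0 = s y 0" using eq by simp
    then have a: "(\<mu> x)\<^sup>2 / D x = (\<mu> y)\<^sup>2 / D y" by (simp add: s_def)
    \<comment> \<open>Equal images force \<open>y v = r * x v + b\<close> on
      \<open>\<sigma>\<close>. Comparing the minima gives \<open>b = 0\<close>, comparing the sums
      gives \<open>r = 1\<close>.\<close>
    define r where "r = \<mu> y / \<mu> x"
    have r: "0 < r" "\<mu> y = r * \<mu> x" using px py by (auto simp: r_def)
    have Dy: "D y = r\<^sup>2 * D x"
      using a px py by (simp add: r_def field_simps power2_eq_square)
    have uy: "u y j = r * u x j" if "j \<le> d" for j
    proof (cases "j = 0")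
      case False
      have "s x j = s y j" using eq by simp
      then have "2 * \<mu> x * u x j / D x = 2 * (r * \<mu> x) * u y j / (r\<^sup>2 * D x)"
        using False that r(2) Dy by (simp add: s_def)
      then show ?thesis using px r(1) by (simp add: field_simps power2_eq_square)
    qed (simp add: u_def)
    define b where "b = y (e 0) - r * x (e 0)"
    have yx: "y v = r * x v + b" if "v \<in> \<sigma>" for v
      using e_ex[OF that] uy by (auto simp: u_def b_def algebra_simps)
    obtain w where w: "w \<in> \<sigma>" "\<mu> x = x w" using \<mu>_eq by blast
    obtain w' where w': "w' \<in> \<sigma>" "\<mu> y = y w'" using \<mu>_eq by blast
    have "r * \<mu> x \<le> r * \<mu> x + b" using \<mu>_le[OF w(1), of y] yx[OF w(1)] w(2) r(2) by simp
    moreover have "r * \<mu> x \<le> r * x w'" using \<mu>_le[OF w'(1), of x] r(1) by simp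
    then have "b \<le> 0" using yx[OF w'(1)] w'(2) r(2) by linarith
    ultimately have b: "b = 0" by simp
    have "(\<Sum>v\<in>\<sigma>. y v) = r * (\<Sum>v\<in>\<sigma>. x v)"
      unfolding sum_distrib_left by (rule sum.cong) (auto simp: yx b)
    then have r1: "r = 1" using inside[OF x] inside[OF y] by simp
    have "x v = y v" for v
    proof (cases "v \<in> \<sigma>")
      case True
      then show ?thesis using yx[OF True] b r1 by simp
    next
      case False
      then have "v \<notin> supp x" "v \<notin> supp y" using x(2) y(2) by blast+
      then show ?thesis by (simp add: supp_def)
    qed
    then show ?thesis by (rule ext)
  qed
  have surj: "\<exists>x\<in>?L. supp x = \<sigma> \<and> s x = z"
    if z: "z \<in> topspace (nsphere d)" "z \<noteq> sphere_base" for z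
  proof -
    have z0: "z 0 < 1" using sphere_eq_base[OF z(1)] z(2) by force
    have zs: "(z 0)\<^sup>2 + (\<Sum>j\<in>{1..d}. (z j)\<^sup>2) = 1" "\<forall>j>d. z j = 0" using z(1) by (auto simp: topspace_nsphere_split)
    \<comment> \<open>\<open>w\<close> is the stereographic projection of \<open>z\<close> from the
      base point, extended by \<open>w 0 = 0\<close>. The shift \<open>a\<close> makes the least
      value of \<open>w j + a\<close> equal to 1, and \<open>t\<close> normalizes the sum, so
      \<open>\<mu> x = 1 / t\<close> and the quotients \<open>u x j / \<mu> x\<close> return
      \<open>w j\<close>.\<close>
    define w where "w j = (if j = 0 then 0 else z j / (1 - z 0))" for j
    define a where "a = 1 - Min (w ` {..d})"
    define t where "t = (\<Sum>j\<le>d. w j + a)"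
    define f where "f = inv_into {..d} e"
    have f: "f (e j) = j" if "j \<le> d" for j
      unfolding f_def using e that by (intro inv_into_f_f) (auto simp: bij_betw_def)
    define x where "x v = (if v \<in> \<sigma> then (w (f v) + a) / t else 0)" for v
    have xe: "x (e j) = (w j + a) / t" if "j \<le> d" for j using that e\<sigma> f by (simp add: x_def)
    have wa: "1 \<le> w j + a" if "j \<le> d" for j
    proof -
      have "Min (w ` {..d}) \<le> w j" using that by (intro Min_le) auto
      then show ?thesis unfolding a_def by linarith
    qed
    have "Min (w ` {..d}) \<in> w ` {..d}" by (intro Min_in) auto
    then obtain j0 where "j0 \<in> {..d}" "Min (w ` {..d}) = w j0" by (rule imageE)
    then have j0: "j0 \<le> d" "w j0 + a = 1" unfolding a_def by simp_all
    have t: "0 < t"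
    proof -
      have "(\<Sum>j\<le>d. 1) \<le> t" unfolding t_def using wa by (intro sum_mono) auto
      then show ?thesis by simp
    qed
    have xpos: "0 < x v" if v: "v \<in> \<sigma>" for v
    proof -
      obtain j where j: "j \<le> d" "v = e j" using e_ex[OF v] by blast
      have "0 < w j + a" using wa[OF j(1)] by linarith
      then show ?thesis using xe[OF j(1)] j(2) t by simp
    qed
    have sx: "supp x = \<sigma>"
    proof
      show "supp x \<subseteq> \<sigma>" by (auto simp: supp_def x_def)
      show "\<sigma> \<subseteq> supp x" using xpos by (force simp: supp_def)
    qed
    have xsum: "(\<Sum>v\<in>\<sigma>. x v) = 1"
    proof -
      have "(\<Sum>v\<in>\<sigma>. x v) = (\<Sum>j\<le>d. x (e j))" using sum.reindex_bij_betw[OF e, of x] by simp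
      also have "\<dots> = (\<Sum>j\<le>d. (w j + a) / t)" using xe by (intro sum.cong) auto
      also have "\<dots> = 1" using t by (simp add: t_def flip: sum_divide_distrib)
      finally show ?thesis .
    qed
    have xL: "x \<in> ?L"
    proof (rule in_realizationI[OF fc \<sigma>(1)])
      show "0 \<le> x v" for v using xpos[of v] by (cases "v \<in> \<sigma>") (auto simp: x_def)
    qed (use sx xsum in auto)
    have \<mu>x: "\<mu> x = 1 / t"
      unfolding \<mu>_def
    proof (rule Min_eqI)
      show "1 / t \<in> (\<lambda>v. x v) ` \<sigma>" using e\<sigma>[OF j0(1)] xe[OF j0(1)] j0(2) by (auto intro!: image_eqI[of _ _ "e j0"])
      fix y assume "y \<in> (\<lambda>v. x v) ` \<sigma>"
      then obtain v where v: "v \<in> \<sigma>" "y = x v" by blast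
      obtain j where j: "j \<le> d" "v = e j" using e_ex[OF v(1)] by blast
      show "1 / t \<le> y" using xe[OF j(1)] v(2) j(2) wa[OF j(1)] t by (simp add: divide_right_mono)
    qed (use fin in auto)
    have ux: "u x j = w j / t" if "j \<le> d" for j
      using xe[OF that] xe[of 0] by (simp add: u_def w_def[of 0] diff_divide_distrib add_divide_distrib)
    have "U x = (\<Sum>j\<in>{1..d}. (1 / (t * (1 - z 0)))\<^sup>2 * (z j)\<^sup>2)"
      unfolding U_def using ux by (intro sum.cong) (auto simp: w_def power_mult_distrib power_divide)
    also have "\<dots> = (1 / (t * (1 - z 0)))\<^sup>2 * (1 - (z 0)\<^sup>2)"
      using zs(1) by (simp flip: sum_distrib_left)
    finally have "D x = (1 / (t * (1 - z 0)))\<^sup>2 * (1 - (z 0)\<^sup>2) + (1 / t)\<^sup>2"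
      using inside[OF xL sx] \<mu>x by simp
    also have "\<dots> = 2 / (t\<^sup>2 * (1 - z 0))"
    proof -
      have "(1 / (t * h))\<^sup>2 * (1 - (1 - h)\<^sup>2) + (1 / t)\<^sup>2 = 2 / (t\<^sup>2 * h)" if "0 < h" for h :: real
        using that t by (simp add: field_simps power2_eq_square)
      from this[of "1 - z 0"] z0 show ?thesis by simp
    qed
    finally have Dx: "D x = 2 / (t\<^sup>2 * (1 - z 0))" .
    have "s x j = z j" for j
    proof -
      consider "j = 0" | "j \<noteq> 0" "j \<le> d" | "j > d" by linarith
      then show ?thesis
      proof cases
        case 1
        have "2 * (1 / t)\<^sup>2 / (2 / (t\<^sup>2 * (1 - z 0))) = 1 - z 0"
          using t z0 by (simp add: field_simps)
        moreover have "s x 0 = 1 - 2 * (1 / t)\<^sup>2 / (2 / (t\<^sup>2 * (1 - z 0)))"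
          by (simp only: s_def \<mu>x Dx if_True refl)
        ultimately have "s x 0 = 1 - (1 - z 0)" by (simp only:)
        then show ?thesis using 1 by simp
      next
        case 2
        have "w j = z j / (1 - z 0)" using 2(1) by (simp add: w_def)
        then have "s x j = 2 * (1 / t) * (z j / (1 - z 0) / t) / (2 / (t\<^sup>2 * (1 - z 0)))"
          using 2 by (simp only: s_def \<mu>x Dx ux if_True if_False)
        also have "\<dots> = z j" using t z0 by (simp add: field_simps power2_eq_square)
        finally show ?thesis .
      next
        case 3
        then show ?thesis using zs(2) by (simp add: s_def)
      qed
    qed
    then have "s x = z" by (rule ext)
    then show ?thesis using xL sx by blast
  qed
  have "inj_on s {x \<in> ?L. supp x = \<sigma>}"
    by (rule inj_onI) (use inj in blast)
  with cont base show ?thesis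
    by (intro exI[of _ s] conjI ballI impI surj)
qed

text \<open>Collapsing all summands but the \<open>j\<close>-th to the base point gives maps that
  tell the points of the wedge apart, which is how its Hausdorff property is obtained.\<close>

lemma wedge_projection_continuous:
  assumes j: "j \<in> J" and p: "\<And>i. i \<in> J \<Longrightarrow> p i \<in> topspace (X i)"
  shows "continuous_map (wedge_topology J X p) (X j)
    (\<lambda>w. case w of None \<Rightarrow> p j | Some (i, x) \<Rightarrow> if i = j then x else p j)"
    (is "continuous_map _ _ ?\<pi>")
  unfolding continuous_map_def
proof (intro conjI allI impI)
  have incl: "?\<pi> (wedge_incl p i x) = (if i = j then x else p j)" for i x
    by (auto simp: wedge_incl_def)
  show "?\<pi> \<in> topspace (wedge_topology J X p) \<rightarrow> topspace (X j)"
  proof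
    fix w assume "w \<in> topspace (wedge_topology J X p)"
    then consider "w = None" | i x where "i \<in> J" "x \<in> topspace (X i)" "w = wedge_incl p i x"
      by (auto simp: wedge_set_def)
    then show "?\<pi> w \<in> topspace (X j)"
    proof cases
      case 2
      then show ?thesis using incl p[OF j] by auto
    qed (use p[OF j] in simp)
  qed
  fix U assume U: "openin (X j) U"
  show "openin (wedge_topology J X p) {w \<in> topspace (wedge_topology J X p). ?\<pi> w \<in> U}"
    unfolding openin_wedge_topology
  proof (intro conjI ballI)
    fix i assume i: "i \<in> J"
    have mem: "wedge_incl p i x \<in> wedge_set J X p" if "x \<in> topspace (X i)" for x
      using i that by (auto simp: wedge_set_def)
    have "{x \<in> topspace (X i). wedge_incl p i x \<in> {w \<in> topspace (wedge_topology J X p). ?\<pi> w \<in> U}} =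
        (if i = j then U else if p j \<in> U then topspace (X i) else {})"
      using mem incl openin_subset[OF U] by auto
    then show "openin (X i) {x \<in> topspace (X i). wedge_incl p i x \<in> {w \<in> topspace (wedge_topology J X p). ?\<pi> w \<in> U}}"
      using U by simp
  qed auto
qed

text \<open>Of two distinct points one is not the base point; the projection to its summand sends
  them to distinct points, and disjoint neighbourhoods pull back.\<close>

lemma Hausdorff_wedge:
  assumes H: "\<And>i. i \<in> J \<Longrightarrow> Hausdorff_space (X i)" and p: "\<And>i. i \<in> J \<Longrightarrow> p i \<in> topspace (X i)"
  shows "Hausdorff_space (wedge_topology J X p)"
  unfolding Hausdorff_space_def
proof (intro allI impI)
  define \<pi> where "\<pi> j = (\<lambda>w. case w of None \<Rightarrow> p j | Some (i, x) \<Rightarrow> if i = j then x else p j)" for j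
  fix w w' assume A: "w \<in> topspace (wedge_topology J X p) \<and> w' \<in> topspace (wedge_topology J X p) \<and> w \<noteq> w'"
  have sep: "\<exists>j\<in>J. \<pi> j w \<noteq> \<pi> j w'" if w: "w \<in> wedge_set J X p" "w \<noteq> w'" "w \<noteq> None" for w w'
  proof -
    obtain j x where j: "j \<in> J" "x \<in> topspace (X j)" "x \<noteq> p j" "w = Some (j, x)"
      using w(1,3) by (auto simp: wedge_set_def wedge_incl_def split: if_splits)
    have "\<pi> j w \<noteq> \<pi> j w'"
      using j(3,4) w(2) by (auto simp: \<pi>_def split: option.split)
    then show ?thesis using j(1) by blast
  qed
  have "\<exists>j\<in>J. \<pi> j w \<noteq> \<pi> j w'"
  proof (cases "w = None")
    case True
    then have "w' \<noteq> None" "w' \<noteq> w" "w' \<in> wedge_set J X p" using A by (metis topspace_wedge_topology)+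
    then have "\<exists>j\<in>J. \<pi> j w' \<noteq> \<pi> j w" by (intro sep)
    then show ?thesis by metis
  next
    case False
    then show ?thesis using A sep[of w w'] by simp
  qed
  then obtain j where j: "j \<in> J" "\<pi> j w \<noteq> \<pi> j w'" by blast
  have c: "continuous_map (wedge_topology J X p) (X j) (\<pi> j)"
    unfolding \<pi>_def by (rule wedge_projection_continuous[OF j(1) p])
  then have "\<pi> j w \<in> topspace (X j)" "\<pi> j w' \<in> topspace (X j)"
    using A by (auto simp: continuous_map_def)
  then obtain U V where UV: "openin (X j) U" "openin (X j) V" "\<pi> j w \<in> U" "\<pi> j w' \<in> V" "disjnt U V"
    using H[OF j(1)] j(2) unfolding Hausdorff_space_def by blast
  let ?U = "{v \<in> topspace (wedge_topology J X p). \<pi> j v \<in> U}"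
  let ?V = "{v \<in> topspace (wedge_topology J X p). \<pi> j v \<in> V}"
  have "openin (wedge_topology J X p) ?U" "openin (wedge_topology J X p) ?V"
    using c UV(1,2) by (auto simp: continuous_map_def)
  moreover have "w \<in> ?U" "w' \<in> ?V" using A UV by auto
  moreover have "disjnt ?U ?V" using UV(5) by (auto simp: disjnt_def)
  ultimately show "\<exists>U V. openin (wedge_topology J X p) U \<and> openin (wedge_topology J X p) V \<and>
      w \<in> U \<and> w' \<in> V \<and> disjnt U V"
    by (intro exI[of _ ?U] exI[of _ ?V] conjI)
qed

text \<open>A quotient topology makes maps out of the wedge easy, not maps into it. Here at most one
  component \<open>s j\<close> is off the base point at any \<open>y\<close>. So the preimage of an
  open set is the intersection of the preimages \<open>T j\<close> if the set contains
  \<open>None\<close>, and their union otherwise; finiteness of \<open>J\<close> keeps the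
  intersection open.\<close>

lemma continuous_map_into_wedge:
  assumes J: "finite J" and s: "\<And>j. j \<in> J \<Longrightarrow> continuous_map Y (X j) (s j)"
    and p: "\<And>j. j \<in> J \<Longrightarrow> p j \<in> topspace (X j)"
    and at: "\<And>y j. y \<in> topspace Y \<Longrightarrow> j \<in> J \<Longrightarrow> s j y \<noteq> p j \<Longrightarrow> q y = Some (j, s j y)"
    and base: "\<And>y. y \<in> topspace Y \<Longrightarrow> (\<And>j. j \<in> J \<Longrightarrow> s j y = p j) \<Longrightarrow> q y = None"
  shows "continuous_map Y (wedge_topology J X p) q"
  unfolding continuous_map_def
proof (intro conjI allI impI)
  have s_in: "s j y \<in> topspace (X j)" if "j \<in> J" "y \<in> topspace Y" for j y
    using s[OF that(1)] that(2) by (auto simp: continuous_map_def)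
  have q: "wedge_incl p j (s j y) = (if s j y = p j then None else q y)" if "y \<in> topspace Y" "j \<in> J" for j y
    using at[OF that] by (auto simp: wedge_incl_def)
  show "q \<in> topspace Y \<rightarrow> topspace (wedge_topology J X p)"
  proof
    fix y assume y: "y \<in> topspace Y"
    show "q y \<in> topspace (wedge_topology J X p)"
    proof (cases "\<forall>j\<in>J. s j y = p j")
      case True
      then show ?thesis using base[OF y] by (simp add: wedge_set_def)
    next
      case False
      then obtain j where j: "j \<in> J" "s j y \<noteq> p j" by blast
      then have "q y = wedge_incl p j (s j y)" using q[OF y j(1)] by simp
      then show ?thesis using s_in[OF j(1) y] j(1) by (auto simp: wedge_set_def)
    qed
  qed
  fix U assume "openin (wedge_topology J X p) U"
  then have op: "openin (X j) {x \<in> topspace (X j). wedge_incl p j x \<in> U}" if "j \<in> J" for j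
    using that by (simp add: openin_wedge_topology)
  define T where "T j = {y \<in> topspace Y. s j y \<in> {x \<in> topspace (X j). wedge_incl p j x \<in> U}}" for j
  have T: "openin Y (T j)" if "j \<in> J" for j
    unfolding T_def by (rule openin_continuous_map_preimage[OF s[OF that] op[OF that]])
  have Tiff: "y \<in> T j \<longleftrightarrow> (if s j y = p j then None \<in> U else q y \<in> U)" if "y \<in> topspace Y" "j \<in> J" for y j
    using q[OF that] s_in[OF that(2,1)] that(1) by (simp add: T_def)
  show "openin Y {y \<in> topspace Y. q y \<in> U}"
  proof (cases "None \<in> U")
    case True
    have "{y \<in> topspace Y. q y \<in> U} = topspace Y \<inter> (\<Inter>j\<in>J. T j)"
    proof (intro set_eqI iffI)
      fix y assume "y \<in> {y \<in> topspace Y. q y \<in> U}"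
      then show "y \<in> topspace Y \<inter> (\<Inter>j\<in>J. T j)" using Tiff True by auto
    next
      fix y assume y: "y \<in> topspace Y \<inter> (\<Inter>j\<in>J. T j)"
      show "y \<in> {y \<in> topspace Y. q y \<in> U}"
      proof (cases "\<forall>j\<in>J. s j y = p j")
        case True
        then show ?thesis using base[of y] y \<open>None \<in> U\<close> by simp
      next
        case False
        then obtain j where "j \<in> J" "s j y \<noteq> p j" by blast
        then show ?thesis using Tiff[of y j] y by simp
      qed
    qed
    moreover have "openin Y (topspace Y \<inter> (\<Inter>j\<in>J. T j))"
      using openin_Inter[of "insert (topspace Y) (T ` J)" Y] J T by auto
    ultimately show ?thesis by simp
  next
    case False
    have "{y \<in> topspace Y. q y \<in> U} = (\<Union>j\<in>J. T j)"
    proof (intro set_eqI iffI)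
      fix y assume y: "y \<in> {y \<in> topspace Y. q y \<in> U}"
      have "\<not> (\<forall>j\<in>J. s j y = p j)"
      proof
        assume "\<forall>j\<in>J. s j y = p j"
        then have "q y = None" using y by (intro base) auto
        then show False using y False by simp
      qed
      then obtain j where "j \<in> J" "s j y \<noteq> p j" by blast
      then show "y \<in> (\<Union>j\<in>J. T j)" using Tiff[of y j] y by auto
    next
      fix y assume "y \<in> (\<Union>j\<in>J. T j)"
      then obtain j where j: "j \<in> J" "y \<in> T j" by blast
      then have "y \<in> topspace Y" by (simp add: T_def)
      then show "y \<in> {y \<in> topspace Y. q y \<in> U}" using Tiff[of y j] j False by (simp split: if_splits)
    qed
    then show ?thesis using T by auto
  qed
qed

section \<open>Complexes that are collapsible up to top simplices\<close>

lemma Hausdorff_nsphere: "Hausdorff_space (nsphere d)"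
  unfolding nsphere by (intro Hausdorff_space_subtopology) (simp add: Hausdorff_space_product_topology)

text \<open>A finite union of closed simplices is closed in the product topology, and it lies in a
  product of compact sets, trivial outside the finitely many vertices.\<close>

lemma compact_realization:
  fixes L :: "'v set set"
  assumes fc: "face_closed L" and fin: "finite L"
  shows "compact_space (geometric_realization L)"
proof -
  define V where "V = \<Union>L"
  have V: "finite V" unfolding V_def using fin face_closed_finite[OF fc] by blast
  define B where "B = (PiE UNIV (\<lambda>v. if v \<in> V then {0..1} else {0::real}))"
  have B: "compactin (powertop_real UNIV) B"
    unfolding B_def by (auto simp: compactin_PiE)
  define F where "F \<sigma> = {x \<in> topspace (powertop_real UNIV). (\<forall>v. 0 \<le> x v) \<and> (\<forall>v. v \<notin> \<sigma> \<longrightarrow> x v = 0) \<and> (\<Sum>v\<in>\<sigma>. x v) = 1}" for \<sigma> :: "'v set"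
  have c: "continuous_map (powertop_real UNIV) euclideanreal (\<lambda>x. x v)" for v
    by (rule continuous_map_product_projection) simp
  have F: "closedin (powertop_real UNIV) (F \<sigma>)" if "\<sigma> \<in> L" for \<sigma>
  proof -
    have f: "finite \<sigma>" using face_closed_finite[OF fc that] .
    have 1: "closedin (powertop_real UNIV) {x \<in> topspace (powertop_real UNIV). x v \<in> {0..}}" for v
      by (rule closedin_continuous_map_preimage[OF c]) simp
    have 2: "closedin (powertop_real UNIV) {x \<in> topspace (powertop_real UNIV). x v \<in> (if v \<notin> \<sigma> then {0} else UNIV)}" for v
      by (rule closedin_continuous_map_preimage[OF c]) simp
    have 3: "closedin (powertop_real UNIV) {x \<in> topspace (powertop_real UNIV). (\<Sum>v\<in>\<sigma>. x v) \<in> {1}}"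
      by (rule closedin_continuous_map_preimage) (auto intro!: continuous_intros c f)
    have "F \<sigma> = (\<Inter>v. {x \<in> topspace (powertop_real UNIV). x v \<in> {0..}}) \<inter>
        (\<Inter>v. {x \<in> topspace (powertop_real UNIV). x v \<in> (if v \<notin> \<sigma> then {0} else UNIV)}) \<inter>
        {x \<in> topspace (powertop_real UNIV). (\<Sum>v\<in>\<sigma>. x v) \<in> {1}}"
      unfolding F_def by (auto split: if_splits)
    then show ?thesis using 1 2 3 by (auto intro!: closedin_Int closedin_Inter)
  qed
  have "topspace (geometric_realization L) = (\<Union>\<sigma>\<in>L. F \<sigma>)"
  proof (intro set_eqI iffI)
    fix x assume x: "x \<in> topspace (geometric_realization L)"
    then have "x \<in> F (supp x)" by (auto simp: F_def in_realization_iff supp_def)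
    then show "x \<in> (\<Union>\<sigma>\<in>L. F \<sigma>)" using realization_supp[OF x] by blast
  next
    fix x assume "x \<in> (\<Union>\<sigma>\<in>L. F \<sigma>)"
    then obtain \<sigma> where \<sigma>: "\<sigma> \<in> L" "x \<in> F \<sigma>" by blast
    show "x \<in> topspace (geometric_realization L)"
      using \<sigma>(2) by (intro in_realizationI[OF fc \<sigma>(1)]) (auto simp: F_def supp_def)
  qed
  then have cl: "closedin (powertop_real UNIV) (topspace (geometric_realization L))"
    using F fin by (auto intro: closedin_Union)
  have "topspace (geometric_realization L) \<subseteq> B"
  proof
    fix x assume x: "x \<in> topspace (geometric_realization L)"
    have "x v \<in> (if v \<in> V then {0..1} else {0})" for v
    proof (cases "v \<in> V")
      case True
      have f: "finite (supp x)" using face_closed_finite[OF fc realization_supp[OF x]] .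
      have "x v \<le> 1"
      proof (cases "v \<in> supp x")
        case True
        have "x v \<le> (\<Sum>v\<in>supp x. x v)"
          using realization_nonneg[OF x] by (intro member_le_sum True f) auto
        then show ?thesis using x by (simp add: in_realization_iff)
      qed (simp add: supp_def)
      then show ?thesis using True realization_nonneg[OF x] by simp
    next
      case False
      then have "v \<notin> supp x" using realization_supp[OF x] by (auto simp: V_def)
      then show ?thesis using False by (simp add: supp_def)
    qed
    then show "x \<in> B" by (simp add: B_def PiE_iff)
  qed
  then have "compactin (powertop_real UNIV) (topspace (geometric_realization L))"
    using closed_compactin[OF B _ cl] by blast
  moreover have "geometric_realization L = subtopology (powertop_real UNIV) (topspace (geometric_realization L))"
    by (simp add: geometric_realization_def)
  ultimately show ?thesis by (metis compact_space_subtopology)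
qed

lemma collapsible_morse_built: "collapsible L \<Longrightarrow> morse_built c L"
proof (induction rule: collapsible.induct)
  case (expand L \<sigma> v)
  then show ?case by (intro morse_built.expand)
qed (rule morse_built.empty)

text \<open>\<open>q\<close> maps each open top simplex bijectively onto its sphere without the base
  point and sends all of \<open>C\<close> to the base point. So the only identification it makes is
  that of \<open>C\<close> to a point, and the contraction of \<open>C\<close> extends to a
  deformation of the whole complex, as collapsing requires.\<close>

lemma wedge_of_top_simplices:
  fixes L C :: "'v set set"
  assumes fcL: "face_closed L" and finL: "finite L" and L: "L = C \<union> S" "C \<inter> S = {}"
    and card: "\<And>\<sigma>. \<sigma> \<in> S \<Longrightarrow> card \<sigma> = Suc d" and C: "collapsible C" "C \<noteq> {}"
  shows "\<exists>m. geometric_realization L homotopy_equivalent_space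
    wedge_topology {..<m::nat} (\<lambda>_. nsphere d) (\<lambda>_. sphere_base)"
proof -
  let ?L = "topspace (geometric_realization L)" and ?C = "topspace (geometric_realization C)"
  have finS: "finite S" using finL L(1) by simp
  have mbC: "morse_built 1 C" using C(1) by (rule collapsible_morse_built)
  then have fcC: "face_closed C" by (rule morse_built_face_closed)
  obtain A where "A \<in> C" "A \<noteq> {}" using morse_built_nonempty[OF mbC _ C(2)] by auto
  then have neC: "?C \<noteq> {}" by (rule realization_nonempty[OF fcC])
  have "\<forall>\<sigma>\<in>S. \<exists>s. continuous_map (geometric_realization L) (nsphere d) s \<and>
      (\<forall>x\<in>?L. s x = sphere_base \<longleftrightarrow> supp x \<noteq> \<sigma>) \<and>
      inj_on s {x \<in> ?L. supp x = \<sigma>} \<and>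
      (\<forall>z\<in>topspace (nsphere d). z \<noteq> sphere_base \<longrightarrow> (\<exists>x\<in>?L. supp x = \<sigma> \<and> s x = z))"
  proof
    fix \<sigma> assume \<sigma>: "\<sigma> \<in> S"
    show "\<exists>s. continuous_map (geometric_realization L) (nsphere d) s \<and>
      (\<forall>x\<in>?L. s x = sphere_base \<longleftrightarrow> supp x \<noteq> \<sigma>) \<and>
      inj_on s {x \<in> ?L. supp x = \<sigma>} \<and>
      (\<forall>z\<in>topspace (nsphere d). z \<noteq> sphere_base \<longrightarrow> (\<exists>x\<in>?L. supp x = \<sigma> \<and> s x = z))"
    proof (rule simplex_sphere_map[OF fcL])
      show "A = \<sigma>" if "A \<in> L" "\<sigma> \<subseteq> A" for A
        by (rule top_simplex_maximal[OF fcC L _ _ \<sigma> that]) (use card in auto)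
    qed (use \<sigma> L(1) card in auto)
  qed
  then obtain s where s: "\<forall>\<sigma>\<in>S. continuous_map (geometric_realization L) (nsphere d) (s \<sigma>) \<and>
      (\<forall>x\<in>?L. s \<sigma> x = sphere_base \<longleftrightarrow> supp x \<noteq> \<sigma>) \<and>
      inj_on (s \<sigma>) {x \<in> ?L. supp x = \<sigma>} \<and>
      (\<forall>z\<in>topspace (nsphere d). z \<noteq> sphere_base \<longrightarrow> (\<exists>x\<in>?L. supp x = \<sigma> \<and> s \<sigma> x = z))"
    by (rule bchoice[THEN exE])
  then have s_cont: "continuous_map (geometric_realization L) (nsphere d) (s \<sigma>)"
    and s_base: "x \<in> ?L \<Longrightarrow> s \<sigma> x = sphere_base \<longleftrightarrow> supp x \<noteq> \<sigma>"
    and s_inj: "x \<in> ?L \<Longrightarrow> y \<in> ?L \<Longrightarrow> supp x = \<sigma> \<Longrightarrow> supp y = \<sigma> \<Longrightarrow> s \<sigma> x = s \<sigma> y \<Longrightarrow> x = y"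
    and s_surj: "z \<in> topspace (nsphere d) \<Longrightarrow> z \<noteq> sphere_base \<Longrightarrow> \<exists>x\<in>?L. supp x = \<sigma> \<and> s \<sigma> x = z"
    if "\<sigma> \<in> S" for \<sigma> x y z
    using that by (simp_all add: inj_on_def)
  define m where "m = card S"
  obtain b where b: "bij_betw b {..<m} S"
    using ex_bij_betw_nat_finite[OF finS] by (auto simp: m_def lessThan_atLeast0)
  have bS: "b j \<in> S" if "j < m" for j using b that by (auto simp: bij_betw_def)
  define f where "f = inv_into {..<m} b"
  have fb: "f (b j) = j" if "j < m" for j
    unfolding f_def using b that by (intro inv_into_f_f) (auto simp: bij_betw_def)
  have bf: "b (f \<sigma>) = \<sigma>" "f \<sigma> < m" if "\<sigma> \<in> S" for \<sigma>
    using bij_betw_inv_into_right[OF b that] bij_betw_apply[OF bij_betw_inv_into[OF b] that]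
    by (auto simp: f_def)
  let ?W = "wedge_topology {..<m} (\<lambda>_. nsphere d) (\<lambda>_. sphere_base)"
  define q where "q x = (if supp x \<in> S then Some (f (supp x), s (supp x) x) else None)" for x
  have in_C: "x \<in> ?C \<longleftrightarrow> supp x \<notin> S" if "x \<in> ?L" for x
    using that L realization_supp[OF that] by (auto simp: in_realization_iff)
  have C_sub: "?C \<subseteq> ?L" using L(1) by (intro realization_mono) auto
  have q_cont: "continuous_map (geometric_realization L) ?W q"
  proof (rule continuous_map_into_wedge[where s = "\<lambda>j. s (b j)"])
    show "continuous_map (geometric_realization L) (nsphere d) (s (b j))" if "j \<in> {..<m}" for j
      using s_cont bS that by simp
    show "sphere_base \<in> topspace (nsphere d)" by (rule sphere_base_in_nsphere)
  next
    fix x j assume x: "x \<in> ?L" and j: "j \<in> {..<m}" and ne: "s (b j) x \<noteq> sphere_base"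
    then have "supp x = b j" using s_base[OF bS x, of j] by simp
    then show "q x = Some (j, s (b j) x)" using bS fb j by (simp add: q_def)
  next
    fix x assume x: "x \<in> ?L" and all: "\<And>j. j \<in> {..<m} \<Longrightarrow> s (b j) x = sphere_base"
    have "supp x \<notin> S"
    proof
      assume "supp x \<in> S"
      then show False using all[of "f (supp x)"] s_base[OF _ x, of "supp x"] bf by simp
    qed
    then show "q x = None" by (simp add: q_def)
  qed simp
  have q_surj: "q ` ?L = topspace ?W"
  proof
    show "q ` ?L \<subseteq> topspace ?W" using q_cont by (rule continuous_map_image_subset_topspace)
    show "topspace ?W \<subseteq> q ` ?L"
    proof
      fix w assume "w \<in> topspace ?W"
      then consider "w = None" | j z where "j < m" "z \<in> topspace (nsphere d)" "z \<noteq> sphere_base" "w = Some (j, z)"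
        by (auto simp: wedge_set_def wedge_incl_def split: if_splits)
      then show "w \<in> q ` ?L"
      proof cases
        case 1
        obtain x where "x \<in> ?C" using neC by blast
        then have "x \<in> ?L" "q x = None" using C_sub in_C by (auto simp: q_def)
        then show ?thesis using 1 by force
      next
        case 2
        obtain x where x: "x \<in> ?L" "supp x = b j" "s (b j) x = z" using s_surj[OF bS 2(2,3)] 2(1) by blast
        then have "q x = w" using 2 bS fb by (simp add: q_def)
        then show ?thesis using x(1) by blast
      qed
    qed
  qed
  obtain E c0 where E: "continuous_map (prod_topology (top_of_set {0..1}) (geometric_realization L)) (geometric_realization L) E"
    "\<forall>x\<in>?L. E (0::real, x) = x" "\<forall>x\<in>?C. E (1, x) = c0" "\<forall>x\<in>?C. \<forall>t\<in>{0..1}. E (t, x) \<in> ?C"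
  proof -
    have "\<forall>\<sigma>\<in>S. card \<sigma> = Suc d" using card by blast
    note ex = contraction_extends[OF fcL fcC L finS this zero_less_Suc contractible_collapsible[OF C]]
    show thesis using ex by (elim exE conjE) (rule that)
  qed
  have "geometric_realization L homotopy_equivalent_space ?W"
  proof (rule collapse_homotopy_equivalence[OF _ _ q_cont q_surj E(1)])
    show "compact_space (geometric_realization L)" by (rule compact_realization[OF fcL finL])
    show "Hausdorff_space ?W"
      by (rule Hausdorff_wedge) (auto simp: Hausdorff_nsphere sphere_base_in_nsphere)
  next
    fix x y assume x: "x \<in> ?L" and y: "y \<in> ?L" and eq: "q x = q y"
    show "x = y \<or> x \<in> ?C \<and> y \<in> ?C"
    proof (cases "supp x \<in> S")
      case True
      then have yS: "supp y \<in> S" "f (supp x) = f (supp y)" "s (supp x) x = s (supp y) y"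
        using eq by (auto simp: q_def split: if_splits)
      have "supp x = b (f (supp x))" using bf(1)[OF True] by (rule sym)
      also have "\<dots> = b (f (supp y))" unfolding yS(2) ..
      also have "\<dots> = supp y" using bf(1)[OF yS(1)] .
      finally have eq': "supp x = supp y" .
      then have "s (supp x) x = s (supp x) y" using yS(3) by (simp only:)
      then have "x = y" by (rule s_inj[OF True x y refl eq'[symmetric]])
      then show ?thesis ..
    next
      case False
      then have "supp y \<notin> S" using eq by (auto simp: q_def split: if_splits)
      then show ?thesis using False in_C x y by blast
    qed
  next
    fix x y assume "x \<in> ?C" "y \<in> ?C"
    then have "supp x \<notin> S" "supp y \<notin> S" using in_C C_sub by blast+
    then show "q x = q y" by (simp add: q_def)
  qed (use E(2-4) in auto)
  then show ?thesis by blast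
qed

section \<open>Purity, dimension and homotopy type of Bier complexes\<close>

context complexes
begin

lemma Alexander_card_le:
  assumes "Alexander_tuple n r K" "S \<in> deleted_join r K"
  shows "card S \<le> Suc n - r"
proof -
  have S: "S \<subseteq> {1..n} \<times> {1..r}" "\<forall>i\<in>{1..r}. part S i \<in> K i"
    using assms(2) deleted_join_subset by (auto simp: deleted_join_iff)
  have "{y\<in>{1..n}. free S y} = {1..n} - (\<Union>i\<in>{1..r}. part S i)"
    using S(1) by (auto simp: free_def part_def)
  moreover have "r - 1 \<le> card ({1..n} - (\<Union>i\<in>{1..r}. part S i))"
    using assms(1) S(2) by (simp add: Alexander_tuple_def)
  ultimately show ?thesis using card_eq[OF assms(2)] by simp
qed

text \<open>A smaller simplex leaves at least \<open>r\<close> points unlabelled. Giving one of them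
  to each part keeps the parts disjoint, so by unavoidability one enlarged part is again a simplex
  of its complex, and the simplex was not maximal.\<close>

lemma unavoidable_facet_card:
  assumes cu: "collective_unavoidable n r K" and S: "S \<in> facets (deleted_join r K)"
  shows "Suc n - r \<le> card S"
proof (rule ccontr)
  assume small: "\<not> ?thesis"
  have SJ: "S \<in> deleted_join r K" using S by (simp add: facets_def)
  have parts: "part S i \<in> K i" if "i \<in> {1..r}" for i using SJ that by (simp add: deleted_join_iff)
  have sv: "single_valued S" using SJ by (simp add: deleted_join_iff)
  have "card {1..r} \<le> card {y\<in>{1..n}. free S y}" using small card_eq[OF SJ] by simp
  then obtain b where b: "b ` {1..r} \<subseteq> {y\<in>{1..n}. free S y}" "inj_on b {1..r}"
    using card_le_inj[of "{1..r}" "{y\<in>{1..n}. free S y}"] by auto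
  define A where "A i = insert (b i) (part S i)" for i
  have fr: "free S (b i)" "b i \<in> {1..n}" if "i \<in> {1..r}" for i using b(1) that by blast+
  have "A i \<subseteq> {1..n}" if "i \<in> {1..r}" for i
    using fr(2)[OF that] K_subset[OF that parts[OF that]] by (simp add: A_def)
  moreover have "disjoint_family_on A {1..r}"
    unfolding disjoint_family_on_def
  proof (intro ballI impI)
    fix i j assume ij: "i \<in> {1..r}" "j \<in> {1..r}" "i \<noteq> j"
    have "b i \<noteq> b j" using inj_on_eq_iff[OF b(2) ij(1,2)] ij(3) by simp
    then show "A i \<inter> A j = {}"
      using fr(1)[OF ij(1)] fr(1)[OF ij(2)] sv ij(3) by (auto simp: A_def part_def free_def single_valued_def)
  qed
  ultimately obtain i where i: "i \<in> {1..r}" "A i \<in> K i" using cu unfolding collective_unavoidable_def by blast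
  let ?T = "insert (b i, i) S"
  have "part ?T j \<in> K j" if "j \<in> {1..r}" for j
    using that i parts by (cases "j = i") (auto simp: part_insert A_def)
  moreover have "single_valued ?T" using sv fr(1)[OF i(1)] by (auto simp: single_valued_def free_def)
  ultimately have "?T \<in> deleted_join r K" using SJ i(1) by (auto simp: deleted_join_iff)
  then have "S = ?T" using S unfolding facets_def by blast
  then show False using fr(1)[OF i(1)] by (auto simp: free_def)
qed

lemma Alexander_facet_card:
  assumes "Alexander_tuple n r K" "S \<in> facets (deleted_join r K)"
  shows "card S = Suc n - r"
proof (rule antisym)
  show "card S \<le> Suc n - r" using assms by (intro Alexander_card_le) (auto simp: facets_def)
  show "Suc n - r \<le> card S" using assms by (intro unavoidable_facet_card) (auto simp: Alexander_tuple_def)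
qed

text \<open>The empty sets in the definition of an Alexander tuple give the bound. It ensures that
  the truncated \<open>Suc n - r\<close> agrees with the integer \<open>n - r + 1\<close>, including
  the case of dimension -1.\<close>

lemma Alexander_r_le:
  assumes "Alexander_tuple n r K"
  shows "r \<le> Suc n"
proof -
  have "r - 1 \<le> card ({1..n} - (\<Union>i\<in>{1..r}. {}))"
    using assms K_empty unfolding Alexander_tuple_def by (elim conjE allE[of _ "\<lambda>_. {}"]) simp
  then show ?thesis by simp
qed

lemma complex_dim_Bier:
  assumes "Alexander_tuple n r K"
  shows "complex_dim (Bier r K) = int n - int r"
proof -
  have dim: "int (Suc n - r) - 1 = int n - int r" using Alexander_r_le[OF assms] by linarith
  obtain S where S: "S \<in> deleted_join r K" "\<And>T. T \<in> deleted_join r K \<Longrightarrow> S \<subseteq> T \<Longrightarrow> S = T"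
    using finite_has_maximal[OF finite_deleted_join] empty_in_deleted_join by blast
  then have "card S = Suc n - r" by (intro Alexander_facet_card[OF assms]) (auto simp: facets_def)
  show ?thesis unfolding complex_dim_def
  proof (rule Max_eqI)
    fix y assume "y \<in> simplex_dim ` Bier r K"
    then obtain T where "T \<in> Bier r K" "y = int (card T) - 1" by (auto simp: simplex_dim_def)
    then show "y \<le> int n - int r" using Alexander_card_le[OF assms, of T] dim by simp
  next
    show "int n - int r \<in> simplex_dim ` Bier r K"
      using S(1) \<open>card S = Suc n - r\<close> dim by (intro image_eqI[of _ _ S]) (simp_all add: simplex_dim_def)
  qed (simp add: finite_deleted_join)
qed

lemma pure_Bier:
  assumes "Alexander_tuple n r K"
  shows "pure_complex (Bier r K)"
  unfolding pure_complex_def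
proof
  fix S assume "S \<in> facets (Bier r K)"
  then show "simplex_dim S = complex_dim (Bier r K)"
    using Alexander_facet_card[OF assms, of S] Alexander_r_le[OF assms]
    by (simp add: complex_dim_Bier[OF assms] simplex_dim_def of_nat_diff)
qed

lemma Bier_wedge:
  assumes "Alexander_tuple n r K"
  shows "\<exists>m. geometric_realization (Bier r K) homotopy_equivalent_space sphere_wedge (int n - int r) m"
proof (cases "r \<le> n")
  case True
  let ?L = "deleted_join r K"
  define d where "d = n - r"
  have c: "Suc n - r = Suc d" using True by (simp add: d_def)
  have cu: "collective_unavoidable n r K" using assms by (simp add: Alexander_tuple_def)
  obtain S where S: "S \<subseteq> ?L" "\<forall>A\<in>S. card A = Suc d" "collapsible (?L - S)"
    using morse_built_split[OF morse_built_deleted_join[OF cu]] Alexander_card_le[OF assms] c by auto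
  \<comment> \<open>The removed simplices have \<open>Suc d\<close> elements, so the empty one
    remains and the collapsible part is not void.\<close>
  have "{} \<in> ?L - S" using empty_in_deleted_join S(2) by force
  then have "?L - S \<noteq> {}" by blast
  then have "\<exists>m. geometric_realization ?L homotopy_equivalent_space
      wedge_topology {..<m::nat} (\<lambda>_. nsphere d) (\<lambda>_. sphere_base)"
    using S by (intro wedge_of_top_simplices[OF face_closed_deleted_join finite_deleted_join, of "?L - S" S]) auto
  moreover have "sphere_wedge (int n - int r) m = wedge_topology {..<m} (\<lambda>_. nsphere d) (\<lambda>_. sphere_base)" for m
  proof -
    have "nat (int n - int r) = d" "\<not> int n - int r < 0" using True by (auto simp: d_def)
    then show ?thesis unfolding sphere_wedge_def by simp
  qed
  ultimately show ?thesis by simp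
next
  case False
  \<comment> \<open>For \<open>r > n\<close> every simplex has at most \<open>Suc n - r = 0\<close>
    elements; the realization has no points, like the sphere of dimension -1.\<close>
  have "topspace (geometric_realization (Bier r K)) = {}"
  proof (rule equals0I)
    fix x assume x: "x \<in> topspace (geometric_realization (Bier r K))"
    have "card (supp x) = 0" using Alexander_card_le[OF assms realization_supp[OF x]] False by simp
    then have "supp x = {}" using finite_simplex[OF realization_supp[OF x]] by simp
    then show False using x by (simp add: in_realization_iff)
  qed
  then have "geometric_realization (Bier r K) = trivial_topology" by (simp add: null_topspace_iff_trivial)
  moreover have "sphere_wedge (int n - int r) 0 = trivial_topology" using False by (simp add: sphere_wedge_def)
  ultimately have "geometric_realization (Bier r K) homeomorphic_space sphere_wedge (int n - int r) 0"
    by (simp add: homeomorphic_empty_space_eq)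
  then show ?thesis by (blast intro: homeomorphic_imp_homotopy_equivalent_space)
qed

lemma deleted_join_k_connected:
  assumes "collective_unavoidable n r K"
  shows "k_connected_space (int n - int r - 1) (geometric_realization (deleted_join r K))"
proof (cases "r \<le> Suc n")
  case True
  have "deleted_join r K \<noteq> {}" using empty_in_deleted_join by blast
  then have "k_connected_space (int (Suc n - r) - 2) (geometric_realization (deleted_join r K))"
    by (rule morse_built_k_connected[OF morse_built_deleted_join[OF assms]])
  moreover have "int (Suc n - r) - 2 = int n - int r - 1" using True by simp
  ultimately show ?thesis by simp
next
  \<comment> \<open>Here the claimed connectivity is below -1, which is no condition.\<close>
  case False
  then show ?thesis by (auto simp: k_connected_space_def)
qed

end

theorem theorem4p3:
  fixes n r :: nat and K :: "nat \<Rightarrow> nat set set"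
  assumes "\<And>i. i \<in> {1..r} \<Longrightarrow> simplicial_complex_on {1..n} (K i)"
    and "\<And>i. i \<in> {1..r} \<Longrightarrow> K i \<subset> Pow {1..n}"
  shows "(collective_unavoidable n r K \<longrightarrow>
            k_connected_space (int n - int r - 1) (geometric_realization (deleted_join r K))) \<and>
         (Alexander_tuple n r K \<longrightarrow>
            simplicial_complex_on ({1..n} \<times> {1..r}) (Bier r K) \<and>
            pure_complex (Bier r K) \<and>
            complex_dim (Bier r K) = int n - int r \<and>
            (\<exists>m. geometric_realization (Bier r K) homotopy_equivalent_space
                  sphere_wedge (int n - int r) m))"
proof -
  interpret complexes n r K by unfold_locales (rule assms(1))
  show ?thesis
    using deleted_join_k_connected simplicial_complex_deleted_join pure_Bier complex_dim_Bier Bier_wedge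
    by blast
qed

end
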